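(* Let $\mathcal A$ be a unital C$^*$-algebra with a family of self-adjoint generators $x_1,\ldots,x_n$, and let $TS(\mathcal A)$ be the set of all tracial states of $\mathcal A$. If $TS(\mathcal A)$ consists of a single element, then $$\delta_{top}(x_1,\ldots,x_n)\le\kappa\delta(x_1,\ldots,x_n).$$
   Context: Matrices: $\mathcal M_k^{s.a}(\mathbb C)$ is the set of self-adjoint $k\times k$ complex matrices, $\tau_k=\frac1k Tr$; for a tuple, $\|(A_1,\ldots,A_n)\|=\max_i\|A_i\|$ (operator norms). Topological free entropy dimension: let $\{P_r\}_{r=1}^\infty$ be a fixed enumeration of all noncommutative polynomials in $\mathbb C\langle X_1,\ldots,X_n\rangle$ (constant terms allowed, evaluated as multiples of the identity) whose coefficients have rational real and imaginary parts. For $R,\epsilon>0$ and integers $r,k\ge1$, $\Gamma^{(top)}_R(x_1,\ldots,x_n;k,\epsilon,P_1,\ldots,P_r)$ is the set of $(A_1,\ldots,A_n)\in(\mathcal M_k^{s.a}(\mathbb C))^n$ with $\|A_i\|\le R$ for all $i$ and $|\|P_j(A_1,\ldots,A_n)\|-\|P_j(x_1,\ldots,x_n)\||\le\epsilon$ for $1\le j\le r$. $\nu_\infty(\Sigma,\omega)$ is the minimal number of open $\|\cdot\|$-balls of radius $\omega$ with centers in $\Sigma$ covering $\Sigma$. Then (with $\log 0=-\infty$, $0<\omega<1$) $$\delta_{top}(x_1,\ldots,x_n)=\limsup_{\omega\to0^+}\ \sup_{R>0}\ \inf_{\epsilon>0,\,r\in\mathbb N}\ \limsup_{k\to\infty}\frac{\log\nu_\infty(\Gamma^{(top)}_R(x_1,\ldots,x_n;k,\epsilon,P_1,\ldots,P_r),\omega)}{-k^2\log\omega}.$$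 Free dimension capacity: if $TS(\mathcal A)\neq\varnothing$, $\kappa\delta(x_1,\ldots,x_n)=\sup_{\tau\in TS(\mathcal A)}\delta_0(x_1,\ldots,x_n:\tau)$, where $\delta_0(x_1,\ldots,x_n:\tau)$ is Voiculescu's (modified, microstates) free entropy dimension of $x_1,\ldots,x_n$ with respect to $\tau$. This is the standard notion: for self-adjoint elements of a tracial algebra with trace $\tau$, $\Gamma_R(z_1,\ldots,z_n;k,m,\epsilon;\tau)$ is the set of $(A_1,\ldots,A_n)\in(\mathcal M_k^{s.a}(\mathbb C))^n$ with $\|A_i\|\le R$ and $|\tau_k(A_{i_1}\cdots A_{i_p})-\tau(z_{i_1}\cdots z_{i_p})|<\epsilon$ for all $1\le p\le m$ and all indices; $\Gamma_R(z_1,\ldots,z_n:w_1,\ldots,w_q;k,m,\epsilon;\tau)$ is the projection onto the first $n$ coordinates of $\Gamma_R(z_1,\ldots,z_n,w_1,\ldots,w_q;k,m,\epsilon;\tau)$; $\chi(z_1,\ldots,z_n:w_1,\ldots,w_q)=\sup_{R>0}\inf_{m,\epsilon}\limsup_{k\to\infty}\left(k^{-2}\log \mathrm{vol}\,\Gamma_R(z_1,\ldots,z_n:w_1,\ldots,w_q;k,m,\epsilon;\tau)+\frac n2\log k\right)$, with $\mathrm{vol}$ Lebesgue measure for the inner product given by $Tr$; and $$\delta_0(x_1,\ldots,x_n:\tau)=n+\limsup_{\epsilon\to0^+}\frac{\chi(x_1+\epsilon s_1,\ldots,x_n+\epsilon s_n:s_1,\ldots,s_n)}{|\log\epsilon|},$$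 where $s_1,\ldots,s_n$ is a free family of standard semicircular elements that is free from $\{x_1,\ldots,x_n\}$. Equivalently (Jung), $\delta_0(x_1,\ldots,x_n:\tau)=\limsup_{\omega\to0^+}\inf_{m,\epsilon}\limsup_{k\to\infty}\frac{\log\nu_2(\Gamma_R(x_1,\ldots,x_n;k,m,\epsilon;\tau),\omega)}{-k^2\log\omega}$ for $R>\max_i\|x_i\|$, where $\nu_2$ is the covering number for balls of the norm $\|(A_1,\ldots,A_n)\|_2=\left(\sum_i\tau_k(A_i^*A_i)\right)^{1/2}$. *)

theory Defs
  imports
    "HOL-Analysis.Analysis"
    "HOL-Library.Poly_Mapping"
    "Jordan_Normal_Form.Schur_Decomposition"
begin

unbundle no vec_syntax

section \<open>Unital C*-algebras and tracial states\<close>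

text \<open>The class axiom \<open>norm 1 = 1\<close> inherited from \<open>real_normed_algebra_1\<close> holds in every nonzero
  unital C*-algebra; the zero algebra, which has no states, is not an instance.\<close>

class cstar_algebra_1 = real_normed_algebra_1 + banach +
  fixes scaleC :: "complex \<Rightarrow> 'a \<Rightarrow> 'a" (infixr "*\<^sub>C" 75)
    and star :: "'a \<Rightarrow> 'a"
  assumes scaleC_add_right: "c *\<^sub>C (a + b) = c *\<^sub>C a + c *\<^sub>C b"
    and scaleC_add_left: "(c + d) *\<^sub>C a = c *\<^sub>C a + d *\<^sub>C a"
    and scaleC_scaleC: "c *\<^sub>C (d *\<^sub>C a) = (c * d) *\<^sub>C a"
    and scaleC_of_real: "complex_of_real r *\<^sub>C a = r *\<^sub>R a"
    and scaleC_mult_left: "(c *\<^sub>C a) * b = c *\<^sub>C (a * b)"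
    and scaleC_mult_right: "a * (c *\<^sub>C b) = c *\<^sub>C (a * b)"
    and norm_scaleC: "norm (c *\<^sub>C a) = cmod c * norm a"
    and star_star: "star (star a) = a"
    and star_add: "star (a + b) = star a + star b"
    and star_scaleC: "star (c *\<^sub>C a) = cnj c *\<^sub>C star a"
    and star_mult: "star (a * b) = star b * star a"
    and cstar_identity: "norm (star a * a) = (norm a)\<^sup>2"

definition selfadjoint :: "'a::cstar_algebra_1 \<Rightarrow> bool" where
  "selfadjoint a \<longleftrightarrow> star a = a"

definition cstar_subalgebra :: "'a::cstar_algebra_1 set \<Rightarrow> bool" where
  "cstar_subalgebra B \<longleftrightarrow> closed B \<and> 1 \<in> B
     \<and> (\<forall>a\<in>B. \<forall>b\<in>B. a + b \<in> B \<and> a * b \<in> B)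
     \<and> (\<forall>c. \<forall>a\<in>B. c *\<^sub>C a \<in> B) \<and> (\<forall>a\<in>B. star a \<in> B)"

definition tracial_states :: "('a::cstar_algebra_1 \<Rightarrow> complex) set" where
  "tracial_states = {\<tau>.
     (\<forall>a b. \<tau> (a + b) = \<tau> a + \<tau> b) \<and> (\<forall>c a. \<tau> (c *\<^sub>C a) = c * \<tau> a)
     \<and> (\<forall>a. \<tau> (star a * a) \<in> \<real>\<^sub>\<ge>\<^sub>0) \<and> \<tau> 1 = 1
     \<and> (\<forall>a b. \<tau> (a * b) = \<tau> (b * a))}"

section \<open>Noncommutative polynomials\<close>

text \<open>The free monoid on \<open>'v\<close>, written additively because finitely supported functions on a
  \<open>monoid_add\<close> carry the convolution product: \<open>'v ncpoly\<close> is the free unital complex algebra on \<open>'v\<close>.\<close>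

datatype 'v word = Word (letters: "'v list")

instantiation word :: (type) monoid_add
begin

definition zero_word :: "'a word" where "zero_word = Word []"

definition plus_word :: "'a word \<Rightarrow> 'a word \<Rightarrow> 'a word" where
  "plus_word u v = Word (letters u @ letters v)"

instance
  by standard (simp_all add: zero_word_def plus_word_def)

end

type_synonym 'v ncpoly = "'v word \<Rightarrow>\<^sub>0 complex"

definition nc_const :: "complex \<Rightarrow> 'v ncpoly" where
  "nc_const c = Poly_Mapping.single 0 c"

definition nc_var :: "'v \<Rightarrow> 'v ncpoly" where
  "nc_var v = Poly_Mapping.single (Word [v]) 1"

definition ncpolys :: "'v set \<Rightarrow> 'v ncpoly set" where
  "ncpolys V = {p. \<forall>w\<in>Poly_Mapping.keys p. set (letters w) \<subseteq> V}"

definition rat_ncpolys :: "nat \<Rightarrow> nat ncpoly set" where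
  "rat_ncpolys n = {p \<in> ncpolys {..<n}.
     \<forall>w. Re (Poly_Mapping.lookup p w) \<in> \<rat> \<and> Im (Poly_Mapping.lookup p w) \<in> \<rat>}"

definition nc_eval :: "('v \<Rightarrow> 'a::cstar_algebra_1) \<Rightarrow> 'v ncpoly \<Rightarrow> 'a" where
  "nc_eval x p =
     (\<Sum>w\<in>Poly_Mapping.keys p. Poly_Mapping.lookup p w *\<^sub>C prod_list (map x (letters w)))"

section \<open>Tuples of self-adjoint matrices\<close>

definition sa_mats :: "nat \<Rightarrow> complex mat set" where
  "sa_mats k = {A \<in> carrier_mat k k. mat_adjoint A = A}"

text \<open>Tuples \<open>(A\<^sub>1,\<dots>,A\<^sub>n)\<close> are indexed by \<open>0,\<dots>,n-1\<close> and are \<open>undefined\<close> elsewhere.\<close>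

definition sa_tuples :: "nat \<Rightarrow> nat \<Rightarrow> (nat \<Rightarrow> complex mat) set" where
  "sa_tuples n k = (\<Pi>\<^sub>E i\<in>{..<n}. sa_mats k)"

definition vec_l2norm :: "complex vec \<Rightarrow> real" where
  "vec_l2norm v = L2_set (\<lambda>i. cmod (v $ i)) {..<dim_vec v}"

definition opnorm :: "complex mat \<Rightarrow> real" where
  "opnorm A = (SUP v\<in>{v. v \<in> carrier_vec (dim_col A) \<and> vec_l2norm v \<le> 1}. vec_l2norm (A *\<^sub>v v))"

definition tuple_dist :: "nat \<Rightarrow> (nat \<Rightarrow> complex mat) \<Rightarrow> (nat \<Rightarrow> complex mat) \<Rightarrow> real" where
  "tuple_dist n A B = Max ((\<lambda>i. opnorm (A i - B i)) ` {..<n})"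

definition mat_word :: "nat \<Rightarrow> ('v \<Rightarrow> complex mat) \<Rightarrow> 'v list \<Rightarrow> complex mat" where
  "mat_word k A w = foldr (\<lambda>v M. A v * M) w (1\<^sub>m k)"

definition mat_nc_eval :: "nat \<Rightarrow> ('v \<Rightarrow> complex mat) \<Rightarrow> 'v ncpoly \<Rightarrow> complex mat" where
  "mat_nc_eval k A p = mat k k (\<lambda>ij.
     \<Sum>w\<in>Poly_Mapping.keys p. Poly_Mapping.lookup p w * mat_word k A (letters w) $$ ij)"

definition ntrace :: "nat \<Rightarrow> complex mat \<Rightarrow> complex" where
  "ntrace k A = (\<Sum>i<k. A $$ (i, i)) / of_nat k"

section \<open>Topological free entropy dimension\<close>

definition ext_log :: "ennreal \<Rightarrow> ereal" where
  "ext_log t = (if t = 0 then -\<infinity> else if t = \<infinity> then \<infinity> else ereal (ln (enn2real t)))"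

text \<open>The value is \<open>\<infinity>\<close> if there is no finite cover.\<close>

definition covering_number :: "('b \<Rightarrow> 'b \<Rightarrow> real) \<Rightarrow> 'b set \<Rightarrow> real \<Rightarrow> ennreal" where
  "covering_number d S \<omega> =
     (INF C\<in>{C. finite C \<and> C \<subseteq> S \<and> (\<forall>a\<in>S. \<exists>c\<in>C. d a c < \<omega>)}. of_nat (card C))"

text \<open>\<open>P 0, P 1, \<dots>\<close> plays the role of \<open>P\<^sub>1, P\<^sub>2, \<dots>\<close>, so \<open>P\<^sub>1, \<dots>, P\<^sub>r\<close> are the \<open>P j\<close> with \<open>j < r\<close>.\<close>

definition top_microstates ::
  "(nat \<Rightarrow> nat ncpoly) \<Rightarrow> nat \<Rightarrow> (nat \<Rightarrow> 'a::cstar_algebra_1) \<Rightarrow> real \<Rightarrow> nat \<Rightarrow> real \<Rightarrow> nat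
     \<Rightarrow> (nat \<Rightarrow> complex mat) set" where
  "top_microstates P n x R k \<epsilon> r = {A \<in> sa_tuples n k.
     (\<forall>i<n. opnorm (A i) \<le> R)
     \<and> (\<forall>j<r. \<bar>opnorm (mat_nc_eval k A (P j)) - norm (nc_eval x (P j))\<bar> \<le> \<epsilon>)}"

definition delta_top ::
  "(nat \<Rightarrow> nat ncpoly) \<Rightarrow> nat \<Rightarrow> (nat \<Rightarrow> 'a::cstar_algebra_1) \<Rightarrow> ereal" where
  "delta_top P n x =
     Limsup (at_right 0) (\<lambda>\<omega>::real.
       SUP R\<in>{0<..}. INF (\<epsilon>, r)\<in>{0<..} \<times> {1..}.
         limsup (\<lambda>k. ext_log (covering_number (tuple_dist n) (top_microstates P n x R k \<epsilon> r) \<omega>)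
                       / ereal (- (real k)\<^sup>2 * ln \<omega>)))"

section \<open>Free entropy in the presence of other variables\<close>

text \<open>Here \<open>\<phi>\<close> is the trace on the algebra containing the tuple \<open>z\<close> of length \<open>N\<close>.\<close>

definition microstates ::
  "('b::monoid_mult \<Rightarrow> complex) \<Rightarrow> nat \<Rightarrow> (nat \<Rightarrow> 'b) \<Rightarrow> real \<Rightarrow> nat \<Rightarrow> nat \<Rightarrow> real
     \<Rightarrow> (nat \<Rightarrow> complex mat) set" where
  "microstates \<phi> N z R k m \<epsilon> = {A \<in> sa_tuples N k.
     (\<forall>i<N. opnorm (A i) \<le> R)
     \<and> (\<forall>w. set w \<subseteq> {..<N} \<and> 1 \<le> length w \<and> length w \<le> m \<longrightarrow>
          cmod (ntrace k (mat_word k A w) - \<phi> (prod_list (map z w))) < \<epsilon>)}"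

definition rel_microstates ::
  "('b::monoid_mult \<Rightarrow> complex) \<Rightarrow> nat \<Rightarrow> (nat \<Rightarrow> 'b) \<Rightarrow> nat \<Rightarrow> (nat \<Rightarrow> 'b) \<Rightarrow> real \<Rightarrow> nat \<Rightarrow> nat \<Rightarrow> real
     \<Rightarrow> (nat \<Rightarrow> complex mat) set" where
  "rel_microstates \<phi> n z q w R k m \<epsilon> =
     (\<lambda>A. restrict A {..<n}) `
       microstates \<phi> (n + q) (\<lambda>i. if i < n then z i else w (i - n)) R k m \<epsilon>"

text \<open>Coordinates of a self-adjoint matrix in an orthonormal basis for the inner product \<open>Tr (A * B)\<close>:
  \<open>c i i\<close> is the diagonal entry and, for \<open>i < j\<close>, the \<open>(i, j)\<close> entry is
  \<open>(c i j + \<i> * c j i) / sqrt 2\<close>.\<close>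

definition sa_mat_of_coords :: "nat \<Rightarrow> (nat \<Rightarrow> nat \<Rightarrow> real) \<Rightarrow> complex mat" where
  "sa_mat_of_coords k c = mat k k (\<lambda>(i, j).
     if i = j then complex_of_real (c i i)
     else if i < j then Complex (c i j / sqrt 2) (c j i / sqrt 2)
     else Complex (c j i / sqrt 2) (- c i j / sqrt 2))"

definition sa_volume :: "nat \<Rightarrow> nat \<Rightarrow> (nat \<Rightarrow> complex mat) set \<Rightarrow> ennreal" where
  "sa_volume n k S = (let M = \<Pi>\<^sub>M l\<in>{..<n} \<times> {..<k} \<times> {..<k}. (lborel :: real measure) in
     emeasure M {c \<in> space M. (\<lambda>l\<in>{..<n}. sa_mat_of_coords k (\<lambda>i j. c (l, i, j))) \<in> S})"

definition free_entropy ::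
  "('b::monoid_mult \<Rightarrow> complex) \<Rightarrow> nat \<Rightarrow> (nat \<Rightarrow> 'b) \<Rightarrow> nat \<Rightarrow> (nat \<Rightarrow> 'b) \<Rightarrow> ereal" where
  "free_entropy \<phi> n z q w =
     (SUP R\<in>{0<..}. INF (m, \<epsilon>)\<in>{1..} \<times> {0<..}.
        limsup (\<lambda>k. ext_log (sa_volume n k (rel_microstates \<phi> n z q w R k m \<epsilon>)) / ereal ((real k)\<^sup>2)
                      + ereal (real n / 2 * ln (real k))))"

section \<open>Free semicircular perturbations and free entropy dimension\<close>

definition free_family :: "('b::ring_1 \<Rightarrow> complex) \<Rightarrow> 'i set \<Rightarrow> ('i \<Rightarrow> 'b set) \<Rightarrow> bool" where
  "free_family \<phi> I B \<longleftrightarrow>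
     (\<forall>ps :: ('i \<times> 'b) list. ps \<noteq> [] \<and> distinct_adj (map fst ps)
        \<and> (\<forall>(i, b)\<in>set ps. i \<in> I \<and> b \<in> B i \<and> \<phi> b = 0)
        \<longrightarrow> \<phi> (prod_list (map snd ps)) = 0)"

definition standard_semicircular :: "('b::monoid_mult \<Rightarrow> complex) \<Rightarrow> 'b \<Rightarrow> bool" where
  "standard_semicircular \<phi> s \<longleftrightarrow>
     (\<forall>p. \<phi> (s ^ p) =
        complex_of_real (integral {-2..2} (\<lambda>t. t ^ p * sqrt (4 - t\<^sup>2)) / (2 * pi)))"

text \<open>Joint laws of \<open>x\<^sub>i\<close> (the letters \<open>Inl i\<close>) and a free family of standard semicirculars \<open>s\<^sub>i\<close>
  (the letters \<open>Inr i\<close>) which is free from \<open>{x\<^sub>1,\<dots>,x\<^sub>n}\<close>: the algebra containing all these elements is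
  represented by the free algebra on the letters with the functional \<open>\<mu>\<close>. In the index type of the
  free family, \<open>None\<close> stands for the algebra generated by \<open>x\<^sub>1,\<dots>,x\<^sub>n\<close>.\<close>

definition free_semicircular_law ::
  "('a::cstar_algebra_1 \<Rightarrow> complex) \<Rightarrow> nat \<Rightarrow> (nat \<Rightarrow> 'a) \<Rightarrow> ((nat + nat) ncpoly \<Rightarrow> complex) \<Rightarrow> bool" where
  "free_semicircular_law \<tau> n x \<mu> \<longleftrightarrow>
     (\<forall>p q. \<mu> (p + q) = \<mu> p + \<mu> q) \<and> (\<forall>c p. \<mu> (nc_const c * p) = c * \<mu> p)
     \<and> (\<forall>w. set w \<subseteq> {..<n} \<longrightarrow>
          \<mu> (prod_list (map (\<lambda>i. nc_var (Inl i)) w)) = \<tau> (prod_list (map x w)))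
     \<and> (\<forall>i<n. standard_semicircular \<mu> (nc_var (Inr i)))
     \<and> free_family \<mu> (insert None (Some ` {..<n}))
         (case_option (ncpolys (Inl ` {..<n})) (\<lambda>i. ncpolys {Inr i}))"

text \<open>The law is unique on polynomials in the letters \<open>Inl i\<close>, \<open>Inr i\<close> with \<open>i < n\<close>, which are the only
  ones used below, so the choice made by \<open>SOME\<close> does not matter.\<close>

definition delta0 :: "('a::cstar_algebra_1 \<Rightarrow> complex) \<Rightarrow> nat \<Rightarrow> (nat \<Rightarrow> 'a) \<Rightarrow> ereal" where
  "delta0 \<tau> n x =
     (let \<mu> = (SOME \<mu>. free_semicircular_law \<tau> n x \<mu>) in
      ereal (real n) + Limsup (at_right 0) (\<lambda>\<epsilon>::real.
        free_entropy \<mu> n (\<lambda>i. nc_var (Inl i) + nc_const (complex_of_real \<epsilon>) * nc_var (Inr i))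
                       n (\<lambda>i. nc_var (Inr i))
          / ereal \<bar>ln \<epsilon>\<bar>))"

definition kappa_delta :: "nat \<Rightarrow> (nat \<Rightarrow> 'a::cstar_algebra_1) \<Rightarrow> ereal" where
  "kappa_delta n x = (SUP \<tau>\<in>tracial_states. delta0 \<tau> n x)"

end

theory Submission
  imports Defs "HOL-Probability.Probability"
begin

text \<open>The single tracial state is denoted by \<open>\<tau>\<close>. The proof shows that its free entropy dimension is at least the
topological one, by perturbing topological microstates with Gaussian random matrices.

Let \<open>A\<close> be a topological microstate of size \<open>k\<close> and let \<open>S\<close> be a tuple of independent self-adjoint Gaussian matrices
whose entries have variance \<open>1 / k\<close>. Along a sequence of microstates with sizes tending to infinity and tolerances
tending to zero, the normalized traces of polynomials in \<open>A\<close> have a limit point, and each limit point is a tracial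
state of the C*-algebra (\<open>tracial_limit\<close>), hence equal to \<open>\<tau>\<close>. So control of operator norms alone forces the
moments of \<open>A\<close> to be close to those of \<open>x\<close>, uniformly in the microstate. Gaussian matrices are asymptotically
free from \<open>A\<close> (\<open>gue_words_converge\<close>) and have norms at most \<open>12\<close> up to an exponentially small probability
(\<open>gue_opnorm_tail\<close>). Consequently, for large \<open>k\<close> a set of tuples \<open>S\<close> of Gaussian probability at least \<open>1 / 2\<close> is good
for \<open>A\<close>: the pair of \<open>A\<close> and \<open>S\<close> has nearly the moments of \<open>x\<close> and a free semicircular family \<open>s\<close>, with bounded
norms (\<open>good_coords_probable\<close>). Then \<open>A + \<epsilon> * S\<close> is a microstate of \<open>x + \<epsilon> * s\<close> in the presence of \<open>s\<close>.

The Gaussian density is bounded by \<open>sqrt k\<close> to the power \<open>n * k\<^sup>2\<close>, so the good set for \<open>A\<close> has a Lebesgue measure of at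
least half the inverse of this number. If \<open>A\<close> and \<open>B\<close> have distance at least \<open>25 * \<epsilon>\<close>, their perturbations by \<open>\<epsilon>\<close>
times good tuples are disjoint, because good tuples have norms at most \<open>12\<close>. A maximal \<open>25 * \<epsilon>\<close>-separated family of
topological microstates has at least as many members as the covering number at this scale. Summing the volumes
over such a family (\<open>rel_volume_lower\<close>) and taking logarithms bounds the free entropy of \<open>x + \<epsilon> * s\<close> in the
presence of \<open>s\<close> from below by \<open>\<theta> * \<bar>ln (25 * \<epsilon>)\<bar> + n * ln \<epsilon> - ln 2\<close> whenever the topological dimension at scale
\<open>25 * \<epsilon>\<close> exceeds \<open>\<theta>\<close> (\<open>pert_entropy_lower\<close>). After division by \<open>\<bar>ln \<epsilon>\<bar>\<close> the constants \<open>25\<close> and \<open>2\<close> disappear in the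
limit, and \<open>n * ln \<epsilon>\<close> cancels the summand \<open>n\<close> of the free entropy dimension.

The free entropy dimension refers to an arbitrary functional with the defining properties of the joint law of \<open>x\<close>
and \<open>s\<close>. Such a functional exists, as the vacuum state of a Fock space (\<open>fock_law_is_free_semicircular\<close>), and it is unique
(\<open>free_semicircular_law_unique\<close>). The moments in the Fock space satisfy a recursion (\<open>fock_word_recursion\<close>) which is the
large \<open>k\<close> limit of the Schwinger--Dyson equations for Gaussian matrices (\<open>schwinger_dyson\<close>); this proves asymptotic
freeness without combinatorics of pairings.\<close>

section \<open>Linear functionals on noncommutative polynomials\<close>

text \<open>Every extension of a function of words to polynomials below is an instance of \<open>nc_sum\<close>. Writing a
  polynomial as the sum of its terms reduces statements about \<open>nc_sum\<close> to single words.\<close>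

lemma poly_mapping_sum_singles:
  "p = (\<Sum>u\<in>Poly_Mapping.keys p. Poly_Mapping.single u (Poly_Mapping.lookup p u))"
  by (rule poly_mapping_eqI)
     (auto simp: lookup_sum lookup_single when_def in_keys_iff sum.delta[OF finite_keys, simplified eq_commute] cong: if_cong)

text \<open>The coefficient is passed to \<open>F\<close> instead of being factored out, so that values in a ring without a
  scalar multiplication and values in a C*-algebra are covered alike.\<close>

definition nc_sum :: "(complex \<Rightarrow> 'w \<Rightarrow> 'b::comm_monoid_add) \<Rightarrow> ('w \<Rightarrow>\<^sub>0 complex) \<Rightarrow> 'b" where
  "nc_sum F p = (\<Sum>w\<in>Poly_Mapping.keys p. F (Poly_Mapping.lookup p w) w)"

lemma nc_sum_zero [simp]: "nc_sum F 0 = 0"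
  by (simp add: nc_sum_def)

lemma nc_sum_single: "(\<And>w. F 0 w = 0) \<Longrightarrow> nc_sum F (Poly_Mapping.single u c) = F c u"
  by (simp add: nc_sum_def)

lemma nc_sum_add:
  assumes "\<And>w. F 0 w = 0" "\<And>c d w. F (c + d) w = F c w + F d w"
  shows "nc_sum F (p + q) = nc_sum F p + nc_sum F q"
  unfolding nc_sum_def
  by (rule setsum_keys_plus_distrib[where f = "\<lambda>w c. F c w"]) (use assms in auto)

lemma nc_sum_sum:
  assumes "\<And>w. F 0 w = 0" "\<And>c d w. F (c + d) w = F c w + F d w"
  shows "nc_sum F (\<Sum>i\<in>I. p i) = (\<Sum>i\<in>I. nc_sum F (p i))"
  by (induction I rule: infinite_finite_induct) (simp_all add: nc_sum_add[OF assms])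

lemma nc_sum_mult:
  fixes p q :: "'v ncpoly"
  assumes "\<And>w. F 0 w = 0" "\<And>c d w. F (c + d) w = F c w + F d w"
  shows "nc_sum F (p * q) = (\<Sum>u\<in>Poly_Mapping.keys p. \<Sum>v\<in>Poly_Mapping.keys q.
            F (Poly_Mapping.lookup p u * Poly_Mapping.lookup q v) (u + v))"
proof -
  have "p * q = (\<Sum>u\<in>Poly_Mapping.keys p. Poly_Mapping.single u (Poly_Mapping.lookup p u))
      * (\<Sum>u\<in>Poly_Mapping.keys q. Poly_Mapping.single u (Poly_Mapping.lookup q u))"
    using poly_mapping_sum_singles[of p] poly_mapping_sum_singles[of q] by simp
  also have "\<dots> = (\<Sum>u\<in>Poly_Mapping.keys p. \<Sum>v\<in>Poly_Mapping.keys q.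
      Poly_Mapping.single (u + v) (Poly_Mapping.lookup p u * Poly_Mapping.lookup q v))"
    by (simp add: sum_product mult_single)
  finally show ?thesis
    by (simp add: nc_sum_sum[OF assms] nc_sum_single assms)
qed

lemma nc_sum_const_mult:
  assumes "\<And>w. F 0 w = 0" "\<And>c d w. F (c + d) w = F c w + F d w"
  shows "nc_sum F (nc_const c * p) = (\<Sum>v\<in>Poly_Mapping.keys p. F (c * Poly_Mapping.lookup p v) v)"
proof (cases "c = 0")
  case True
  then show ?thesis by (simp add: nc_const_def assms)
next
  case False
  then show ?thesis unfolding nc_const_def
    by (subst nc_sum_mult[OF assms]) simp
qed

lemma letters_zero [simp]: "letters 0 = []" by (simp add: zero_word_def)

lemma letters_plus [simp]: "letters (u + v) = letters u @ letters v" by (simp add: plus_word_def)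

lemma prod_list_nc_var:
  "prod_list (map (\<lambda>i. nc_var (f i)) w) = Poly_Mapping.single (Word (map f w)) 1"
  by (induction w) (simp_all add: nc_var_def mult_single plus_word_def flip: zero_word_def single_one)

lemma ncpolys_times: "p \<in> ncpolys V \<Longrightarrow> q \<in> ncpolys V \<Longrightarrow> p * q \<in> ncpolys V"
  using keys_mult[of p q] by (fastforce simp: ncpolys_def)

lemma ncpolys_add: "p \<in> ncpolys V \<Longrightarrow> q \<in> ncpolys V \<Longrightarrow> p + q \<in> ncpolys V"
  using Poly_Mapping.keys_add[of p q] by (fastforce simp: ncpolys_def)

lemma ncpolys_diff: "p \<in> ncpolys V \<Longrightarrow> q \<in> ncpolys V \<Longrightarrow> p - q \<in> ncpolys V"
  using Poly_Mapping.keys_diff[of p q] by (fastforce simp: ncpolys_def)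

lemma ncpolys_const: "nc_const c \<in> ncpolys V"
  by (auto simp: ncpolys_def nc_const_def)

section \<open>A Fock space model\<close>

text \<open>The model is the Fock space whose basis vectors are the words in the letters \<open>Inl j\<close> (for \<open>x\<^sub>j\<close>) and
  \<open>Inr i\<close> (for a creation operator). A letter \<open>Inl j\<close> acts by prepending itself, and the semicircular
  variable \<open>s\<^sub>i\<close> acts as the sum of prepending \<open>Inr i\<close> and of the annihilation operator, which maps
  \<open>map Inl b @ Inr k # z\<close> to \<open>t b\<close> times \<open>z\<close> if \<open>k = i\<close> and to zero otherwise; words without a letter
  \<open>Inr k\<close> are mapped to zero. Here \<open>t\<close> is the moment function of the \<open>x\<^sub>j\<close>.

  Linear combinations of basis vectors are avoided by transposition: a state is a function \<open>G\<close> that assigns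
  a number to every basis vector, and operators act on states by composition. Then \<open>ann t i [] G\<close> is \<open>G\<close>
  composed with the annihilation operator; the argument \<open>b\<close> collects the letters \<open>Inl\<close> read so far.\<close>

fun ann :: "(nat list \<Rightarrow> complex) \<Rightarrow> nat \<Rightarrow> nat list \<Rightarrow> ((nat + nat) list \<Rightarrow> complex) \<Rightarrow> (nat + nat) list \<Rightarrow> complex"
where
  "ann t k b f [] = 0"
| "ann t k b f (Inl j # z) = ann t k (b @ [j]) f z"
| "ann t k b f (Inr m # z) = (if m = k then t b * f z else 0)"

text \<open>Composition of a state with the operator of one letter.\<close>

fun act :: "(nat list \<Rightarrow> complex) \<Rightarrow> ((nat + nat) list \<Rightarrow> complex) \<Rightarrow> nat + nat \<Rightarrow> (nat + nat) list \<Rightarrow> complex"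
where
  "act t G (Inl j) = (\<lambda>v. G (Inl j # v))"
| "act t G (Inr i) = (\<lambda>v. G (Inr i # v) + ann t i [] G v)"

text \<open>The state that pairs a basis vector with the vacuum vector, which is the empty word.\<close>

definition vac :: "(nat list \<Rightarrow> complex) \<Rightarrow> (nat + nat) list \<Rightarrow> complex" where
  "vac t v = (if list_all isl v then t (map projl v) else 0)"

text \<open>The vacuum expectation of the product of the operators of the letters of \<open>w\<close>.\<close>

definition fock_word :: "(nat list \<Rightarrow> complex) \<Rightarrow> (nat + nat) list \<Rightarrow> complex" where
  "fock_word t w = foldl (act t) (vac t) w []"

lemma ann_linear:
  "ann t k b (\<lambda>v. c * f v) z = c * ann t k b f z"
  "ann t k b (\<lambda>v. f v + g v) z = ann t k b f z + ann t k b g z"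
  "ann t k b (\<lambda>v. 0) z = 0"
  by (induction z arbitrary: b rule: list.induct; case_tac x1 rule: sum.exhaust; simp add: algebra_simps)+

lemma act_linear:
  "act t (\<lambda>v. c * f v) x = (\<lambda>z. c * act t f x z)"
  "act t (\<lambda>v. f v + g v) x = (\<lambda>z. act t f x z + act t g x z)"
  "act t (\<lambda>v. 0) x = (\<lambda>z. 0)"
  by (cases x; simp add: ann_linear algebra_simps)+

lemma foldl_act_linear:
  "foldl (act t) (\<lambda>v. c * f v) w = (\<lambda>z. c * foldl (act t) f w z)"
  "foldl (act t) (\<lambda>v. f v + g v) w = (\<lambda>z. foldl (act t) f w z + foldl (act t) g w z)"
  "foldl (act t) (\<lambda>v. 0) w = (\<lambda>z. 0)"
  by (induction w arbitrary: f g) (simp_all add: act_linear)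

lemma foldl_act_sum:
  "foldl (act t) (\<lambda>v. \<Sum>i\<in>I. f i v) w = (\<lambda>z. \<Sum>i\<in>I. foldl (act t) (f i) w z)"
  by (induction I rule: infinite_finite_induct) (simp_all add: foldl_act_linear)

lemma ann_sum: "ann t k b (\<lambda>v. \<Sum>i\<in>I. f i v) z = (\<Sum>i\<in>I. ann t k b (f i) z)"
  by (induction I rule: infinite_finite_induct) (simp_all add: ann_linear)

lemma foldl_act_Inl: "foldl (act t) G (map Inl a) = (\<lambda>v. G (map Inl a @ v))"
  by (induction a arbitrary: G) simp_all

lemma ann_Inl: "ann t k b f (map Inl a @ z) = ann t k (b @ a) f z"
  by (induction a arbitrary: b) simp_all

text \<open>The sum of \<open>f u * G v\<close> over all factorizations of the argument as \<open>u @ Inr i # v\<close>.\<close>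

fun splits :: "nat \<Rightarrow> ((nat + nat) list \<Rightarrow> complex) \<Rightarrow> ((nat + nat) list \<Rightarrow> complex) \<Rightarrow> (nat + nat) list \<Rightarrow> complex"
where
  "splits i f G [] = 0"
| "splits i f G (x # y) = (if x = Inr i then f [] * G y else 0) + splits i (\<lambda>z. f (x # z)) G y"

lemma splits_linear:
  "splits i (\<lambda>v. c * f v) G z = c * splits i f G z"
  "splits i (\<lambda>v. f v + g v) G z = splits i f G z + splits i g G z"
  "splits i (\<lambda>v. 0) G z = 0"
  by (induction z arbitrary: f g) (simp_all add: algebra_simps)

text \<open>The annihilation operator consumes an initial segment of the word, and a factorization at a later
  letter \<open>Inr i\<close> does not interfere with it. A factorization at the consumed letter contributes nothing,
  because its first component is annihilated to zero.\<close>

lemma splits_ann: "splits i (ann t k b f) G z = ann t k b (splits i f G) z"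
proof (induction z arbitrary: b)
  case (Cons x z)
  show ?case
  proof (cases x)
    case (Inl j)
    have "(\<lambda>z. ann t k b f (Inl j # z)) = ann t k (b @ [j]) f" by auto
    then show ?thesis using Inl Cons by simp
  next
    case (Inr m)
    show ?thesis
    proof (cases "m = k")
      case True
      then show ?thesis using Inr by (simp add: splits_linear)
    next
      case False
      then show ?thesis using Inr by (simp add: splits_linear)
    qed
  qed
qed simp

text \<open>The vacuum state vanishes on words with a semicircular letter, so only the first such letter of \<open>y\<close> can
  be the place of the factorization, which is also the letter that the annihilation operator consumes.\<close>

lemma vac_ann_base: "splits i (vac t) G y = ann t i [] G y"
proof -
  have "splits i (\<lambda>z. if list_all isl z then t (b @ map projl z) else 0) G y = ann t i b G y" for b
  proof (induction y arbitrary: b)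
    case (Cons x y)
    then show ?case
      using Cons[of "b @ [projl x]"] by (cases x) (simp_all add: splits_linear cong: if_cong)
  qed simp
  from this[of "[]"] show ?thesis by (simp add: vac_def[abs_def] cong: if_cong)
qed

text \<open>An annihilation operator in front of the word \<open>u\<close> is moved to the right. Each letter \<open>Inr i\<close> of \<open>u\<close>
  can absorb it, which leaves the vacuum expectation of the part of \<open>u\<close> before that letter; if no letter of
  \<open>u\<close> does so, the annihilation operator is paired with a letter of the basis vector \<open>y\<close>, which is the
  \<open>splits\<close> term. The statement is by induction on the last letter of \<open>u\<close>, because states are acted on from
  the right.\<close>

lemma foldl_ann:
  "foldl (act t) (ann t i [] G) u y = splits i (foldl (act t) (vac t) u) G y
     + (\<Sum>q<length u. if u ! q = Inr i then fock_word t (take q u) * foldl (act t) G (drop (Suc q) u) y else 0)"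
proof (induction u arbitrary: y rule: rev_induct)
  case Nil
  then show ?case by (simp add: vac_ann_base)
next
  case (snoc x u)
  have fn: "foldl (act t) (ann t i [] G) u = (\<lambda>y. splits i (foldl (act t) (vac t) u) G y
     + (\<Sum>q<length u. if u ! q = Inr i then fock_word t (take q u) * foldl (act t) G (drop (Suc q) u) y else 0))"
    using snoc by blast
  have S: "act t (\<lambda>y. \<Sum>q<length u. if u ! q = Inr i then fock_word t (take q u) * foldl (act t) G (drop (Suc q) u) y else 0) x
     = (\<lambda>y. \<Sum>q<length u. if u ! q = Inr i then fock_word t (take q u) * foldl (act t) G (drop (Suc q) u @ [x]) y else 0)" for x
  proof -
    have *: "(\<lambda>y. \<Sum>q<length u. if u ! q = Inr i then fock_word t (take q u) * foldl (act t) G (drop (Suc q) u) y else 0)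
      = (\<lambda>y. \<Sum>q<length u. (if u ! q = Inr i then fock_word t (take q u) else 0) * foldl (act t) G (drop (Suc q) u) y)"
      by (intro ext sum.cong) auto
    have "foldl (act t) (\<lambda>y. \<Sum>q<length u. (if u ! q = Inr i then fock_word t (take q u) else 0) * foldl (act t) G (drop (Suc q) u) y) [x]
      = (\<lambda>y. \<Sum>q<length u. (if u ! q = Inr i then fock_word t (take q u) else 0) * foldl (act t) G (drop (Suc q) u @ [x]) y)"
      by (subst foldl_act_sum) (simp only: foldl_act_linear foldl_append)
    then show ?thesis unfolding * by (auto simp: fun_eq_iff if_distrib intro!: sum.cong)
  qed
  have T: "act t (splits i f G) x y = splits i (act t f x) G y + (if x = Inr i then f [] * G y else 0)" for f
  proof (cases x)
    case (Inl j)
    then show ?thesis by simp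
  next
    case (Inr m)
    then show ?thesis by (simp add: splits_linear splits_ann)
  qed
  have "foldl (act t) (ann t i [] G) (u @ [x]) y = act t (\<lambda>y. splits i (foldl (act t) (vac t) u) G y
     + (\<Sum>q<length u. if u ! q = Inr i then fock_word t (take q u) * foldl (act t) G (drop (Suc q) u) y else 0)) x y"
    by (simp add: fn)
  also have "\<dots> = splits i (foldl (act t) (vac t) (u @ [x])) G y + (if x = Inr i then fock_word t u * G y else 0)
     + (\<Sum>q<length u. if u ! q = Inr i then fock_word t (take q u) * foldl (act t) G (drop (Suc q) u @ [x]) y else 0)"
    by (simp only: act_linear S T) (simp add: fock_word_def)
  also have "\<dots> = splits i (foldl (act t) (vac t) (u @ [x])) G y
     + (\<Sum>q<length (u @ [x]). if (u @ [x]) ! q = Inr i then fock_word t (take q (u @ [x])) * foldl (act t) G (drop (Suc q) (u @ [x])) y else 0)"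
    by (auto simp: nth_append intro!: sum.cong)
  finally show ?case .
qed

text \<open>The creation part of the first semicircular letter has zero vacuum expectation, since nothing to
  the left of it can annihilate the created letter. The annihilation part is distributed by \<open>foldl_ann\<close>. This
  recursion determines \<open>fock_word\<close> from \<open>t\<close>, and it is the large \<open>k\<close> limit of the Schwinger--Dyson equations
  for Gaussian matrices.\<close>

lemma fock_word_recursion:
  "fock_word t (map Inl a @ Inr i # w) =
     (\<Sum>q<length w. if w ! q = Inr i
        then fock_word t (take q w) * fock_word t (map Inl a @ drop (Suc q) w) else 0)"
proof -
  have *: "foldl (act t) (vac t) (map Inl a @ [Inr i]) = ann t i [] (\<lambda>v. vac t (map Inl a @ v))"
    by (simp add: foldl_act_Inl) (simp add: vac_def)
  have "fock_word t (map Inl a @ Inr i # w) = foldl (act t) (ann t i [] (\<lambda>v. vac t (map Inl a @ v))) w []"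
    by (simp add: fock_word_def flip: *)
  also have "\<dots> = (\<Sum>q<length w. if w ! q = Inr i
        then fock_word t (take q w) * fock_word t (map Inl a @ drop (Suc q) w) else 0)"
    by (subst foldl_ann) (simp add: fock_word_def foldl_act_Inl cong: if_cong)
  finally show ?thesis .
qed

lemma fock_word_Inl: "fock_word t (map Inl a) = t a"
  by (simp add: fock_word_def foldl_act_Inl vac_def list_all_iff comp_def)

section \<open>Freeness in the Fock space model\<close>

text \<open>Composition of the state \<open>G\<close> with the operator of the polynomial \<open>p\<close>.\<close>

definition fock_poly :: "(nat list \<Rightarrow> complex) \<Rightarrow> ((nat + nat) list \<Rightarrow> complex) \<Rightarrow> (nat + nat) ncpoly \<Rightarrow> (nat + nat) list \<Rightarrow> complex" where
  "fock_poly t G p v = nc_sum (\<lambda>c w. c * foldl (act t) G (letters w) v) p"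

lemma fock_poly_mult: "fock_poly t (fock_poly t G p) q = fock_poly t G (p * q)"
proof
  fix v
  have "fock_poly t (fock_poly t G p) q v = (\<Sum>w\<in>Poly_Mapping.keys q. Poly_Mapping.lookup q w *
      (\<Sum>u\<in>Poly_Mapping.keys p. Poly_Mapping.lookup p u * foldl (act t) G (letters u @ letters w) v))"
    unfolding fock_poly_def nc_sum_def by (simp add: foldl_act_sum foldl_act_linear)
  also have "\<dots> = fock_poly t G (p * q) v"
    unfolding fock_poly_def
    by (subst nc_sum_mult) (auto simp: algebra_simps sum_distrib_left intro: sum.swap)
  finally show "fock_poly t (fock_poly t G p) q v = fock_poly t G (p * q) v" .
qed

lemma fock_poly_prod_list: "foldl (fock_poly t) G ps = fock_poly t G (prod_list ps)"
proof (induction ps arbitrary: G)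
  case Nil
  have "fock_poly t G 1 = G" by (simp add: fun_eq_iff fock_poly_def nc_sum_single flip: single_one)
  then show ?case by simp
next
  case (Cons p ps)
  then show ?case by (simp add: fock_poly_mult)
qed

text \<open>The vacuum state, as a functional on polynomials.\<close>

definition fock_law :: "(nat list \<Rightarrow> complex) \<Rightarrow> (nat + nat) ncpoly \<Rightarrow> complex" where
  "fock_law t p = fock_poly t (vac t) p []"

lemma fock_law_word: "fock_law t (Poly_Mapping.single (Word w) 1) = fock_word t w"
  by (simp add: fock_law_def fock_poly_def nc_sum_single fock_word_def)

text \<open>The number of paths with \<open>p\<close> steps \<open>+1\<close> or \<open>-1\<close> from \<open>0\<close> to \<open>j\<close> that stay
  nonnegative. For \<open>j = 0\<close> these are the Catalan numbers interlaced with zeros.\<close>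

fun walks :: "nat \<Rightarrow> nat \<Rightarrow> nat" where
  "walks 0 j = (if j = 0 then 1 else 0)"
| "walks (Suc p) j = (if j = 0 then 0 else walks p (j - 1)) + walks p (Suc j)"

lemma walks_eq_0: "j > p \<Longrightarrow> walks p j = 0"
  by (induction p arbitrary: j) auto

text \<open>Powers of \<open>s\<^sub>i\<close> are reordered with creation operators on the left, where the assumption on \<open>G\<close> kills
  them. Only powers of the annihilation operator survive; one more factor \<open>s\<^sub>i\<close> on the right adds an
  annihilation operator or cancels one, which is one step of a path.\<close>

lemma foldl_act_Inr:
  assumes t: "t [] = 1" and G: "\<And>v. G (Inr i # v) = 0"
  shows "foldl (act t) G (replicate p (Inr i)) v = (\<Sum>j\<le>p. of_nat (walks p j) * (ann t i [] ^^ j) G v)"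
proof (induction p arbitrary: v)
  case (Suc p)
  define a where "a j = (ann t i [] ^^ j) G" for j
  have a0: "a 0 (Inr i # v) = 0" for v using G by (simp add: a_def)
  have aS: "a (Suc j) (Inr i # v) = a j v" for j v using t by (simp add: a_def)
  have aa: "ann t i [] (a j) v = a (Suc j) v" for j v by (simp add: a_def)
  have step: "act t (a j) (Inr i) v = (if j = 0 then 0 else a (j - 1) v) + a (Suc j) v" for j v
    using a0 aS aa by (cases j) auto
  have fn: "foldl (act t) G (replicate p (Inr i)) = (\<lambda>v. \<Sum>j\<le>p. of_nat (walks p j) * (ann t i [] ^^ j) G v)"
    using Suc by blast
  have "foldl (act t) G (replicate (Suc p) (Inr i)) v = act t (\<lambda>v. \<Sum>j\<le>p. of_nat (walks p j) * a j v) (Inr i) v"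
    unfolding replicate_Suc replicate_append_same[symmetric] foldl_append fn a_def by simp
  also have "\<dots> = (\<Sum>j\<le>p. of_nat (walks p j) * act t (a j) (Inr i) v)"
    by (simp add: ann_sum ann_linear sum.distrib distrib_left)
  also have "\<dots> = (\<Sum>j\<le>p. of_nat (walks p j) * (if j = 0 then 0 else a (j - 1) v)) + (\<Sum>j\<le>p. of_nat (walks p j) * a (Suc j) v)"
    unfolding step by (simp add: algebra_simps sum.distrib)
  also have "(\<Sum>j\<le>p. of_nat (walks p j) * (if j = 0 then 0 else a (j - 1) v)) = (\<Sum>j\<le>Suc p. of_nat (walks p (Suc j)) * a j v)"
  proof -
    have "(\<Sum>j\<le>p. of_nat (walks p j) * (if j = 0 then 0 else a (j - 1) v))
       = (\<Sum>j\<le>Suc (Suc p). of_nat (walks p j) * (if j = 0 then 0 else a (j - 1) v))"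
      by (simp add: walks_eq_0)
    also have "\<dots> = (\<Sum>j\<le>Suc p. of_nat (walks p (Suc j)) * a j v)"
      by (subst sum.atMost_Suc_shift) simp
    finally show ?thesis .
  qed
  also have "(\<Sum>j\<le>p. of_nat (walks p j) * a (Suc j) v) = (\<Sum>j\<le>Suc p. of_nat (if j = 0 then 0 else walks p (j - 1)) * a j v)"
    by (subst sum.atMost_Suc_shift) simp
  finally show ?case by (simp only: a_def walks.simps of_nat_add distrib_right sum.distrib add.commute)
qed simp

lemma letters_replicate: "set (letters w) \<subseteq> {x} \<Longrightarrow> letters w = replicate (length (letters w)) x"
  by (metis replicate_eqI subset_singletonD singletonD empty_iff in_mono)

text \<open>After the reordering of \<open>foldl_act_Inr\<close> a polynomial in \<open>s\<^sub>i\<close> is a polynomial in the annihilation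
  operator, whose constant coefficient is its vacuum expectation. If that vanishes, an annihilation operator
  can be split off on the right.\<close>

lemma fock_poly_Inr_centred:
  assumes t: "t [] = 1" and G: "\<And>v. G (Inr i # v) = 0"
    and p: "p \<in> ncpolys {Inr i}" and c: "fock_law t p = 0"
  shows "\<exists>H. fock_poly t G p = ann t i [] H"
proof -
  \<comment> \<open>Any common upper bound for the lengths of the words would do.\<close>
  define N where "N = (\<Sum>w\<in>Poly_Mapping.keys p. length (letters w))"
  define C where "C j = (\<Sum>w\<in>Poly_Mapping.keys p. Poly_Mapping.lookup p w * of_nat (walks (length (letters w)) j))" for j
  have N: "length (letters w) \<le> N" if "w \<in> Poly_Mapping.keys p" for w
    unfolding N_def using that by (intro member_le_sum) auto
  have ex: "fock_poly t G p v = (\<Sum>j\<le>N. C j * (ann t i [] ^^ j) G v)" if G: "\<And>v. G (Inr i # v) = 0" for G v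
  proof -
    have "foldl (act t) G (letters w) v = (\<Sum>j\<le>N. of_nat (walks (length (letters w)) j) * (ann t i [] ^^ j) G v)"
      if w: "w \<in> Poly_Mapping.keys p" for w
    proof -
      have r: "letters w = replicate (length (letters w)) (Inr i)"
        using p w by (intro letters_replicate) (auto simp: ncpolys_def)
      have "foldl (act t) G (letters w) v = (\<Sum>j\<le>length (letters w). of_nat (walks (length (letters w)) j) * (ann t i [] ^^ j) G v)"
        by (subst r, rule foldl_act_Inr) (use t G in auto)
      also have "\<dots> = (\<Sum>j\<le>N. of_nat (walks (length (letters w)) j) * (ann t i [] ^^ j) G v)"
        using N[OF w] by (intro sum.mono_neutral_left) (auto simp: walks_eq_0)
      finally show ?thesis .
    qed
    then have "fock_poly t G p v = (\<Sum>w\<in>Poly_Mapping.keys p. Poly_Mapping.lookup p w *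
        (\<Sum>j\<le>N. of_nat (walks (length (letters w)) j) * (ann t i [] ^^ j) G v))"
      by (simp add: fock_poly_def nc_sum_def)
    also have "\<dots> = (\<Sum>j\<le>N. C j * (ann t i [] ^^ j) G v)"
      unfolding C_def by (simp add: sum_distrib_left sum_distrib_right mult.assoc) (rule sum.swap)
    finally show ?thesis .
  qed
  have "fock_law t p = (\<Sum>j\<le>N. C j * (ann t i [] ^^ j) (vac t) [])"
    unfolding fock_law_def by (rule ex) (simp add: vac_def)
  also have "\<dots> = C 0"
    by (simp add: sum.atMost_shift vac_def t)
  finally have C0: "C 0 = 0" using c by simp
  have "fock_poly t G p = ann t i [] (\<lambda>v. \<Sum>j<N. C (Suc j) * (ann t i [] ^^ j) G v)"
    by (rule ext, subst ex, rule G) (simp add: sum.atMost_shift C0 ann_sum ann_linear)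
  then show ?thesis by blast
qed

lemma pure_letters: "set (letters w) \<subseteq> Inl ` A \<Longrightarrow> \<exists>a. set a \<subseteq> A \<and> letters w = map Inl a"
  by (rule exI[of _ "map projl (letters w)"]) (force simp: comp_def intro!: map_idI[symmetric])

text \<open>On the vacuum and on words that begin with a semicircular letter, the state \<open>G\<close> is zero or sees a
  polynomial in the \<open>x\<^sub>j\<close> only through its moment, which is zero.\<close>

lemma fock_poly_Inl_centred:
  assumes t: "t [] = 1" and G: "G = vac t \<or> (\<exists>k H. G = ann t k [] H)"
    and p: "p \<in> ncpolys (Inl ` A)" and c: "fock_law t p = 0"
  shows "fock_poly t G p [] = 0" "fock_poly t G p (Inr i # v) = 0"
proof -
  define a where "a w = map projl (letters w)" for w :: "(nat + nat) word"
  have a: "letters w = map Inl (a w)" if "w \<in> Poly_Mapping.keys p" for w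
    using pure_letters[of w A] p that by (auto simp: ncpolys_def a_def comp_def)
  have ex: "fock_poly t G p v = (\<Sum>w\<in>Poly_Mapping.keys p. Poly_Mapping.lookup p w * G (map Inl (a w) @ v))" for G v
    unfolding fock_poly_def nc_sum_def using a by (auto simp: foldl_act_Inl intro!: sum.cong)
  have vacI: "vac t (map Inl b) = t b" for b by (simp add: vac_def list_all_iff comp_def)
  have c': "(\<Sum>w\<in>Poly_Mapping.keys p. Poly_Mapping.lookup p w * t (a w)) = 0"
    using c by (simp add: fock_law_def ex vacI)
  have annI: "ann t k [] H (map Inl b) = 0" for k H b
    using ann_Inl[of t k "[]" H b "[]"] by simp
  from G show "fock_poly t G p [] = 0"
  proof
    assume "G = vac t" then show ?thesis using c' by (simp add: ex vacI)
  next
    assume "\<exists>k H. G = ann t k [] H" then show ?thesis by (auto simp: ex annI)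
  qed
  from G show "fock_poly t G p (Inr i # v) = 0"
  proof
    assume "G = vac t" then show ?thesis by (simp add: ex vac_def)
  next
    assume "\<exists>k H. G = ann t k [] H"
    then obtain k H where G: "G = ann t k [] H" by blast
    show ?thesis
      using c' by (cases "i = k") (simp_all add: ex G ann_Inl flip: sum_distrib_right mult.assoc)
  qed
qed

text \<open>The state obtained from an alternating product of centred factors remembers its last factor: it
  factors through the annihilation operator of \<open>s\<^sub>i\<close> after a factor in \<open>s\<^sub>i\<close>, and it is zero on the vacuum and on
  words that begin with a semicircular letter after a factor in the \<open>x\<^sub>j\<close>. Either condition makes the state
  vanish on the vacuum, and together with alternation it is the assumption of \<open>fock_poly_Inl_centred\<close>
  or \<open>fock_poly_Inr_centred\<close> for the next factor.\<close>

lemma fock_law_free: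
  assumes t: "t [] = 1"
  shows "free_family (fock_law t) (insert None (Some ` {..<n}))
         (case_option (ncpolys (Inl ` {..<n})) (\<lambda>i. ncpolys {Inr i}))"
proof -
  define B where "B = case_option (ncpolys (Inl ` {..<n})) (\<lambda>i. ncpolys {Inr i :: nat + nat})"
  \<comment> \<open>The condition that a factor from the algebra \<open>o'\<close> leaves on the state.\<close>
  define St where "St = (\<lambda>o' G. case o' of
     None \<Rightarrow> G [] = 0 \<and> (\<forall>k v. G (Inr k # v) = 0)
   | Some i \<Rightarrow> (\<exists>H. G = ann t i [] H))"
  have main: "ps \<noteq> [] \<Longrightarrow> distinct_adj (map fst ps) \<Longrightarrow> (\<forall>(i, b)\<in>set ps. b \<in> B i \<and> fock_law t b = 0)
     \<Longrightarrow> St (fst (last ps)) (foldl (fock_poly t) (vac t) (map snd ps))" for ps :: "(nat option \<times> (nat + nat) ncpoly) list"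
  proof (induction ps rule: rev_induct)
    case (snoc p ps)
    obtain i b where p: "p = (i, b)" by force
    define G where "G = foldl (fock_poly t) (vac t) (map snd ps)"
    have b: "b \<in> B i" "fock_law t b = 0" using snoc.prems p by auto
    have G: "G = vac t \<or> (\<exists>j. j \<noteq> i \<and> St j G)"
    proof (cases "ps = []")
      case False
      have "distinct_adj (map fst ps)" "fst (last ps) \<noteq> i"
        using snoc.prems(2) False by (auto simp: distinct_adj_append_iff last_map p)
      then show ?thesis using snoc.IH[OF False] snoc.prems(3) unfolding G_def by auto
    qed (simp add: G_def)
    have "St i (fock_poly t G b)"
    proof (cases i)
      case None
      have "G = vac t \<or> (\<exists>k H. G = ann t k [] H)"
        using G None by (auto simp: St_def split: option.splits)
      then show ?thesis
        using fock_poly_Inl_centred[of t, OF t _ _ b(2)] b(1) None by (simp add: St_def B_def)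
    next
      case (Some m)
      have "G (Inr m # v) = 0" for v
        using G Some by (auto simp: St_def vac_def split: option.splits)
      then show ?thesis
        using fock_poly_Inr_centred[of t, OF t _ _ b(2)] b(1) Some by (simp add: St_def B_def)
    qed
    then show ?case by (simp add: G_def p)
  qed simp
  have "fock_law t (prod_list (map snd ps)) = 0"
    if "ps \<noteq> []" "distinct_adj (map fst ps)" "\<forall>(i, b)\<in>set ps. b \<in> B i \<and> fock_law t b = 0"
    for ps :: "(nat option \<times> (nat + nat) ncpoly) list"
  proof -
    have "foldl (fock_poly t) (vac t) (map snd ps) [] = 0"
      using main[OF that] by (auto simp: St_def split: option.splits)
    then show ?thesis by (simp add: fock_law_def fock_poly_prod_list)
  qed
  then show ?thesis unfolding free_family_def B_def[symmetric] by (auto simp: split_beta)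
qed

lemma fock_law_linear:
  "fock_law t (p + q) = fock_law t p + fock_law t q"
  "fock_law t (nc_const c * p) = c * fock_law t p"
  unfolding fock_law_def fock_poly_def
  by (simp_all add: nc_sum_add nc_sum_const_mult algebra_simps) (simp add: nc_sum_def sum_distrib_left algebra_simps)

lemma fock_law_semicircular_moment:
  assumes "t [] = 1"
  shows "fock_law t (nc_var (Inr i) ^ p) = of_nat (walks p 0)"
proof -
  have e: "nc_var (Inr i :: nat + nat) ^ p = prod_list (map (\<lambda>_. nc_var (Inr i)) (replicate p ()))"
    by (induction p) auto
  have "fock_law t (nc_var (Inr i) ^ p) = fock_word t (replicate p (Inr i))"
    unfolding e by (subst prod_list_nc_var) (simp add: fock_law_word)
  also have "\<dots> = (\<Sum>j\<le>p. of_nat (walks p j) * (ann t i [] ^^ j) (vac t) [])"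
    unfolding fock_word_def by (rule foldl_act_Inr) (simp_all add: assms vac_def)
  also have "\<dots> = of_nat (walks p 0)" by (simp add: sum.atMost_shift vac_def assms)
  finally show ?thesis .
qed

section \<open>Moments of the semicircle law\<close>

text \<open>The Chebyshev polynomials of the second kind, evaluated at \<open>t / 2\<close>.\<close>

fun cheb :: "nat \<Rightarrow> real \<Rightarrow> real" where
  "cheb 0 t = 1"
| "cheb (Suc 0) t = t"
| "cheb (Suc (Suc j)) t = t * cheb (Suc j) t - cheb j t"

lemma cheb_continuous: "continuous_on A (cheb j)"
  by (induction j rule: cheb.induct[of "\<lambda>j _. continuous_on A (cheb j)" _ undefined])
     (auto intro!: continuous_intros simp: fun_eq_iff[symmetric] cong: continuous_on_cong)

lemma cheb_cos: "sin \<theta> * cheb j (2 * cos \<theta>) = sin (real (Suc j) * \<theta>)"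
\<comment> \<open>The induction rule of \<open>cheb\<close> carries the second argument along; \<open>undefined\<close> fills its place.\<close>
proof (induction j rule: cheb.induct[of "\<lambda>j _. sin \<theta> * cheb j (2 * cos \<theta>) = sin (real (Suc j) * \<theta>)" _ undefined])
  case (2 t)
  then show ?case by (simp add: sin_double)
next
  case (3 j t)
  define a where "a = real (Suc (Suc j)) * \<theta>"
  have "real (Suc (Suc (Suc j))) * \<theta> = a + \<theta>" "real (Suc j) * \<theta> = a - \<theta>"
    by (simp_all add: a_def algebra_simps)
  moreover have "sin (a + \<theta>) = 2 * cos \<theta> * sin a - sin (a - \<theta>)"
    by (simp add: sin_add sin_diff)
  ultimately show ?case using 3 by (simp add: algebra_simps a_def)
qed simp

text \<open>The substitution \<open>t = - 2 * cos x\<close> turns this into the orthogonality of \<open>sin x\<close> and \<open>sin ((j + 1) * x)\<close>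
  on the interval from \<open>0\<close> to \<open>pi\<close>.\<close>

lemma semicircle_cheb: "integral {-2..2} (\<lambda>t. cheb j t * sqrt (4 - t\<^sup>2)) = (if j = 0 then 2 * pi else 0)"
proof -
  let ?f = "\<lambda>t. cheb j t * sqrt (4 - t\<^sup>2)"
  have c: "continuous_on {-2..2} ?f"
    by (intro continuous_intros cheb_continuous)
  have img: "(\<lambda>x. - 2 * cos x) ` {0..pi} \<subseteq> {-2..2::real}"
  proof clarify
    fix x :: real
    show "- 2 * cos x \<in> {-2..2}" unfolding atLeastAtMost_iff using cos_ge_minus_one[of x] cos_le_one[of x] by linarith
  qed
  have "((\<lambda>x. (2 * sin x) *\<^sub>R ?f (- 2 * cos x)) has_integral integral {-2 * cos 0..- 2 * cos pi} ?f) {0..pi}"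
    by (rule has_integral_substitution[where c = "-2" and d = 2])
       (use c img in \<open>auto intro!: derivative_eq_intros continuous_intros\<close>)
  then have "((\<lambda>x. 2 * sin x * ?f (- 2 * cos x)) has_integral integral {-2..2} ?f) {0..pi}"
    by simp
  moreover have "2 * sin x * ?f (-2 * cos x) = (- 1) ^ j * 4 * sin x * sin (real (Suc j) * x)" if "x \<in> {0..pi}" for x
  proof -
    have "4 - (-2 * cos x)\<^sup>2 = (2 * sin x)\<^sup>2" by (simp add: power_mult_distrib sin_squared_eq)
    then have "sqrt (4 - (-2 * cos x)\<^sup>2) = \<bar>2 * sin x\<bar>" by (simp only: real_sqrt_abs)
    then have r: "sqrt (4 - (-2 * cos x)\<^sup>2) = 2 * sin x" using that sin_ge_zero[of x] by simp
    have c: "cheb j (- t) = (- 1) ^ j * cheb j t" for t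
      by (induction j rule: cheb.induct[of "\<lambda>j _. cheb j (- t) = (- 1) ^ j * cheb j t" _ undefined]) (auto simp: algebra_simps)
    have "cheb j (-2 * cos x) = (-1)^j * cheb j (2 * cos x)" using c[of "2 * cos x"] by simp
    then show ?thesis unfolding r using cheb_cos[of x j] by (simp add: mult_ac)
  qed
  ultimately have I: "((\<lambda>x. (- 1) ^ j * 4 * sin x * sin (real (Suc j) * x)) has_integral integral {-2..2} ?f) {0..pi}"
    by (metis (no_types, lifting) has_integral_cong)
  have "((\<lambda>x. (- 1) ^ j * 4 * sin x * sin (real (Suc j) * x)) has_integral (if j = 0 then 2 * pi else 0)) {0..pi}"
  proof (cases "j = 0")
    case True
    have "((\<lambda>x. 4 * sin x * sin x) has_integral (2 * pi - sin (2 * pi)) - (2 * 0 - sin (2 * 0))) {0..pi}"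
      by (intro fundamental_theorem_of_calculus)
         (auto intro!: derivative_eq_intros simp: has_real_derivative_iff_has_vector_derivative[symmetric] cos_double_sin power2_eq_square)
    then show ?thesis using True by simp
  next
    case False
    define F where "F x = (-1)^j * 2 * (sin (real j * x) / real j - sin (real (j + 2) * x) / real (j + 2))" for x
    have "((\<lambda>x. (- 1) ^ j * 4 * sin x * sin (real (Suc j) * x)) has_integral F pi - F 0) {0..pi}"
    proof (intro fundamental_theorem_of_calculus)
      fix x :: real
      have "(F has_real_derivative (-1)^j * 2 * (cos (real j * x) - cos (real (j + 2) * x))) (at x within {0..pi})"
        unfolding F_def using False by (auto intro!: derivative_eq_intros)
      moreover have "real j * x = real (Suc j) * x - x" "real (j + 2) * x = real (Suc j) * x + x"
        by (simp_all add: algebra_simps)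
      then have "cos (real j * x) - cos (real (j + 2) * x) = 2 * sin x * sin (real (Suc j) * x)"
        by (simp only: cos_add cos_diff) simp
      ultimately show "(F has_vector_derivative (- 1) ^ j * 4 * sin x * sin (real (Suc j) * x)) (at x within {0..pi})"
        by (simp add: has_real_derivative_iff_has_vector_derivative[symmetric] algebra_simps)
    qed (auto)
    moreover have "F pi = 0" "F 0 = 0" unfolding F_def sin_npi by simp_all
    ultimately show ?thesis using False by simp
  qed
  with I show ?thesis by (rule has_integral_unique)
qed

text \<open>Multiplication by \<open>t\<close> maps \<open>cheb j\<close> to \<open>cheb (j + 1) + cheb (j - 1)\<close>, which is one step of a path. So
  the integrals satisfy the recursion of \<open>walks\<close>.\<close>

lemma semicircle_walks: "integral {-2..2} (\<lambda>t. t ^ p * cheb j t * sqrt (4 - t\<^sup>2)) = 2 * pi * real (walks p j)"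
proof (induction p arbitrary: j)
  case 0
  then show ?case by (simp add: semicircle_cheb)
next
  case (Suc p)
  have i: "(\<lambda>t. t ^ p * cheb j t * sqrt (4 - t\<^sup>2)) integrable_on {-2..2}" for j
    by (intro integrable_continuous_real continuous_intros cheb_continuous)
  show ?case
  proof (cases j)
    case 0
    then show ?thesis using Suc[of 1] by (simp add: mult_ac)
  next
    case (Suc m)
    have "(\<lambda>t. t ^ Suc p * cheb j t * sqrt (4 - t\<^sup>2))
      = (\<lambda>t. t ^ p * cheb m t * sqrt (4 - t\<^sup>2) + t ^ p * cheb (Suc j) t * sqrt (4 - t\<^sup>2))"
      using Suc by (auto simp: fun_eq_iff algebra_simps)
    then have "integral {-2..2} (\<lambda>t. t ^ Suc p * cheb j t * sqrt (4 - t\<^sup>2))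
      = integral {-2..2} (\<lambda>t. t ^ p * cheb m t * sqrt (4 - t\<^sup>2))
        + integral {-2..2} (\<lambda>t. t ^ p * cheb (Suc j) t * sqrt (4 - t\<^sup>2))"
      using i by (simp only: integral_add)
    then show ?thesis using Suc Suc.IH[of m] Suc.IH[of "Suc j"] by (simp add: distrib_left)
  qed
qed

lemma semicircle_moment: "integral {-2..2} (\<lambda>t. t ^ p * sqrt (4 - t\<^sup>2)) / (2 * pi) = real (walks p 0)"
  using semicircle_walks[of p 0] by simp

section \<open>Existence and uniqueness of the joint law\<close>

lemma nc_const_commute: "nc_const c * p = p * nc_const c"
proof -
  have "nc_const c * (\<Sum>u\<in>K. Poly_Mapping.single u (f u)) = (\<Sum>u\<in>K. Poly_Mapping.single u (f u)) * nc_const c" for K f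
    unfolding nc_const_def sum_distrib_left sum_distrib_right mult_single by (simp add: mult.commute)
  then show ?thesis using poly_mapping_sum_singles[of p] by metis
qed

lemma linear_functional_expand:
  fixes \<mu> :: "'v ncpoly \<Rightarrow> complex"
  assumes add: "\<And>p q. \<mu> (p + q) = \<mu> p + \<mu> q" and sc: "\<And>c p. \<mu> (nc_const c * p) = c * \<mu> p"
  shows "\<mu> p = (\<Sum>w\<in>Poly_Mapping.keys p. Poly_Mapping.lookup p w * \<mu> (Poly_Mapping.single w 1))"
proof -
  have "\<mu> 0 = 0" using add[of 0 0] by simp
  then have s: "\<mu> (\<Sum>u\<in>K. f u) = (\<Sum>u\<in>K. \<mu> (f u))" for K and f :: "'v word \<Rightarrow> 'v ncpoly"
    by (induction K rule: infinite_finite_induct) (simp_all add: add)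
  have "\<mu> (Poly_Mapping.single u c) = c * \<mu> (Poly_Mapping.single u 1)" for u c
    using sc[of c "Poly_Mapping.single u 1"] by (simp add: nc_const_def mult_single)
  then have "(\<Sum>u\<in>Poly_Mapping.keys p. \<mu> (Poly_Mapping.single u (Poly_Mapping.lookup p u)))
      = (\<Sum>u\<in>Poly_Mapping.keys p. Poly_Mapping.lookup p u * \<mu> (Poly_Mapping.single u 1))"
    by (rule sum.cong[OF refl])
  moreover have "\<mu> p = \<mu> (\<Sum>u\<in>Poly_Mapping.keys p. Poly_Mapping.single u (Poly_Mapping.lookup p u))"
    by (rule arg_cong[OF poly_mapping_sum_singles])
  ultimately show ?thesis using s by simp
qed

text \<open>In particular, the joint law of a tuple and a free semicircular family exists.\<close>

theorem fock_law_is_free_semicircular: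
  assumes "\<tau> 1 = 1"
  shows "free_semicircular_law \<tau> n x (fock_law (\<lambda>a. \<tau> (prod_list (map x a))))"
proof -
  define t where "t = (\<lambda>a. \<tau> (prod_list (map x a)))"
  have t1: "t [] = 1" using assms by (simp add: t_def)
  have "fock_law t (prod_list (map (\<lambda>i. nc_var (Inl i)) w)) = \<tau> (prod_list (map x w))" for w
    by (subst prod_list_nc_var) (simp add: fock_law_word fock_word_Inl t_def)
  then have "free_semicircular_law \<tau> n x (fock_law t)"
    unfolding free_semicircular_law_def standard_semicircular_def
    by (auto simp: fock_law_linear fock_law_semicircular_moment[of t, OF t1] semicircle_moment
             simp del: of_real_divide intro!: fock_law_free[of t, OF t1])
  then show ?thesis by (simp add: t_def)
qed

lemma not_distinct_adj_split:
  "\<not> distinct_adj (map f ps) \<Longrightarrow> \<exists>xs p q ys. ps = xs @ p # q # ys \<and> f p = f q"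
proof (induction ps)
  case (Cons p ps)
  show ?case
  proof (cases ps)
    case Nil
    then show ?thesis using Cons.prems by simp
  next
    case (Cons q ys)
    show ?thesis
    proof (cases "f p = f q")
      case True
      then show ?thesis using Cons by (metis append_Nil)
    next
      case False
      then have "\<not> distinct_adj (map f ps)" using Cons.prems Cons by simp
      then obtain xs p' q' ys' where "ps = xs @ p' # q' # ys'" "f p' = f q'" using Cons.IH by blast
      then show ?thesis by (metis append_Cons)
    qed
  qed
qed simp

text \<open>Both functionals agree on each of the free algebras. A product of elements of these algebras
  becomes an alternating product after neighbours from the same algebra are multiplied. In an alternating
  product the factors are centred one by one from the left: centring the factor \<open>b\<close> costs a scalar multiple of
  a shorter product, which is covered by the outer induction on the number of factors, and a product of centred
  factors has expectation zero by freeness.\<close>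

theorem free_semicircular_law_unique:
  assumes mu: "free_semicircular_law \<tau> n x \<mu>" and nu: "free_semicircular_law \<tau> n x \<nu>" and "\<tau> 1 = 1"
    and w: "set w \<subseteq> Inl ` {..<n} \<union> Inr ` {..<n}"
  shows "\<mu> (Poly_Mapping.single (Word w) 1) = \<nu> (Poly_Mapping.single (Word w) 1)"
proof -
  define I where "I = insert None (Some ` {..<n})"
  define B where "B = case_option (ncpolys (Inl ` {..<n})) (\<lambda>i. ncpolys {Inr i :: nat + nat})"
  have lin: "\<mu> (p + q) = \<mu> p + \<mu> q" "\<mu> (nc_const c * p) = c * \<mu> p"
    "\<nu> (p + q) = \<nu> p + \<nu> q" "\<nu> (nc_const c * p) = c * \<nu> p" for p q c
    using mu nu by (auto simp: free_semicircular_law_def)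
  have val: "\<mu> (prod_list (map (\<lambda>i. nc_var (Inl i)) a)) = \<tau> (prod_list (map x a))"
    "\<nu> (prod_list (map (\<lambda>i. nc_var (Inl i)) a)) = \<tau> (prod_list (map x a))" if "set a \<subseteq> {..<n}" for a
    using mu nu that by (simp_all add: free_semicircular_law_def)
  have semi: "standard_semicircular \<mu> (nc_var (Inr j))" "standard_semicircular \<nu> (nc_var (Inr j))" if "j < n" for j
    using mu nu that by (simp_all add: free_semicircular_law_def)
  have one: "\<mu> 1 = 1" "\<nu> 1 = 1"
    using val[of "[]"] \<open>\<tau> 1 = 1\<close> by simp_all
  have const: "\<mu> (nc_const c) = c" "\<nu> (nc_const c) = c" for c
    using lin(2)[of c 1] lin(4)[of c 1] one by simp_all
  have diff: "\<mu> (p - nc_const c) = \<mu> p - c" "\<nu> (p - nc_const c) = \<nu> p - c" for p c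
    using lin(1)[of "p - nc_const c" "nc_const c"] lin(3)[of "p - nc_const c" "nc_const c"] const by simp_all
  have free: "\<mu> (prod_list (map snd ps)) = 0"
    if "ps \<noteq> []" "distinct_adj (map fst ps)" "\<forall>(i, b)\<in>set ps. i \<in> I \<and> b \<in> B i \<and> \<mu> b = 0" for ps
    using mu that unfolding free_semicircular_law_def free_family_def I_def B_def by blast
  have free': "\<nu> (prod_list (map snd ps)) = 0"
    if "ps \<noteq> []" "distinct_adj (map fst ps)" "\<forall>(i, b)\<in>set ps. i \<in> I \<and> b \<in> B i \<and> \<nu> b = 0" for ps
    using nu that unfolding free_semicircular_law_def free_family_def I_def B_def by blast
  have block: "\<mu> b = \<nu> b" if "i \<in> I" "b \<in> B i" for i b
  proof -
    have "\<mu> (Poly_Mapping.single v 1) = \<nu> (Poly_Mapping.single v 1)" if v: "v \<in> Poly_Mapping.keys b" for v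
    proof (cases i)
      case None
      then obtain a where a: "set a \<subseteq> {..<n}" "letters v = map Inl a"
        using pure_letters[of v "{..<n}"] v \<open>b \<in> B i\<close> by (auto simp: B_def ncpolys_def)
      have "Poly_Mapping.single v 1 = prod_list (map (\<lambda>i. nc_var (Inl i :: nat + nat)) a)"
        unfolding prod_list_nc_var a(2)[symmetric] by simp
      then show ?thesis using val[OF a(1)] by simp
    next
      case (Some j)
      then have j: "j < n" using \<open>i \<in> I\<close> by (auto simp: I_def)
      have "letters v = replicate (length (letters v)) (Inr j)"
        using v \<open>b \<in> B i\<close> Some by (intro letters_replicate) (auto simp: B_def ncpolys_def)
      then obtain p where p: "letters v = replicate p (Inr j)" by blast
      have e: "nc_var (Inr j :: nat + nat) ^ p = prod_list (map (\<lambda>_. nc_var (Inr j)) (replicate p ()))"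
        by (induction p) auto
      have "nc_var (Inr j) ^ p = Poly_Mapping.single (Word (letters v)) 1"
        unfolding e by (subst prod_list_nc_var) (simp add: p)
      then have "Poly_Mapping.single v 1 = nc_var (Inr j) ^ p" by simp
      then show ?thesis using semi[OF j] by (simp add: standard_semicircular_def)
    qed
    then show ?thesis
      using linear_functional_expand[of \<mu> b] linear_functional_expand[of \<nu> b] lin by simp
  qed
  have Bdiff: "b - nc_const c \<in> B i" if "b \<in> B i" for b c i
    using that by (auto simp: B_def intro!: ncpolys_const ncpolys_diff split: option.splits)
  have Btimes: "b * c \<in> B i" if "b \<in> B i" "c \<in> B i" for b c i
    using that by (auto simp: B_def intro!: ncpolys_times split: option.splits)
  have main: "\<mu> (prod_list (map snd ps)) = \<nu> (prod_list (map snd ps))"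
    if "\<forall>(i, b)\<in>set ps. i \<in> I \<and> b \<in> B i" for ps
    using that
  proof (induction "length ps" arbitrary: ps rule: less_induct)
    case (less ps)
    show ?case
    proof (cases "distinct_adj (map fst ps)")
      case False
      then obtain xs p q ys where ps: "ps = xs @ p # q # ys" "fst p = fst q"
        using not_distinct_adj_split by blast
      define ps' where "ps' = xs @ (fst p, snd p * snd q) # ys"
      have "prod_list (map snd ps) = prod_list (map snd ps')"
        by (simp add: ps ps'_def mult.assoc)
      moreover have "\<mu> (prod_list (map snd ps')) = \<nu> (prod_list (map snd ps'))"
        using less.prems ps by (intro less.hyps) (auto simp: ps'_def intro!: Btimes)
      ultimately show ?thesis by simp
    next
      case True
      have "\<mu> (prod_list (map snd (qs @ rs))) = \<nu> (prod_list (map snd (qs @ rs)))"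
        if "length (qs @ rs) = length ps" "distinct_adj (map fst (qs @ rs))"
          "\<forall>(i, b)\<in>set (qs @ rs). i \<in> I \<and> b \<in> B i" "\<forall>(i, b)\<in>set qs. \<mu> b = 0" for qs rs
        using that
      proof (induction rs arbitrary: qs)
        \<comment> \<open>All factors are centred.\<close>
        case Nil
        have q: "i \<in> I \<and> b \<in> B i \<and> \<mu> b = 0 \<and> \<nu> b = 0" if "(i, b) \<in> set qs" for i b
        proof -
          have "i \<in> I" "b \<in> B i" "\<mu> b = 0" using Nil.prems(3,4) that by auto
          then show ?thesis using block[of i b] by simp
        qed
        have qd: "distinct_adj (map fst qs)" using Nil.prems(2) by simp
        show ?case
        proof (cases "qs = []")
          case True
          then show ?thesis using one by simp
        next
          case False
          have "\<mu> (prod_list (map snd qs)) = 0" by (rule free[OF False qd]) (use q in blast)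
          moreover have "\<nu> (prod_list (map snd qs)) = 0" by (rule free'[OF False qd]) (use q in blast)
          ultimately show ?thesis by simp
        qed
      next
        case (Cons r rs)
        obtain i b where r: "r = (i, b)" by force
        have ib: "i \<in> I" "b \<in> B i" using Cons.prems(3) r by auto
        define c where "c = \<mu> b"
        have c: "\<nu> b = c" using block ib by (simp add: c_def)
        \<comment> \<open>The factor after the centred ones is centred.\<close>
        have e: "prod_list (map snd (qs @ r # rs)) = prod_list (map snd ((qs @ [(i, b - nc_const c)]) @ rs))
              + nc_const c * prod_list (map snd (qs @ rs))"
        proof -
          have "prod_list (map snd qs) * nc_const c = nc_const c * prod_list (map snd qs)"
            by (rule nc_const_commute[symmetric])
          then show ?thesis by (simp add: r algebra_simps flip: mult.assoc)
        qed
        have 1: "\<mu> (prod_list (map snd ((qs @ [(i, b - nc_const c)]) @ rs))) = \<nu> (prod_list (map snd ((qs @ [(i, b - nc_const c)]) @ rs)))"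
        proof (rule Cons.IH)
          show "length ((qs @ [(i, b - nc_const c)]) @ rs) = length ps" using Cons.prems(1) by simp
          show "distinct_adj (map fst ((qs @ [(i, b - nc_const c)]) @ rs))" using Cons.prems(2) r by simp
          show "\<forall>(i, b)\<in>set ((qs @ [(i, b - nc_const c)]) @ rs). i \<in> I \<and> b \<in> B i"
            using Cons.prems(3) ib Bdiff by auto
          have "\<mu> (b - nc_const c) = 0" by (simp add: diff c_def)
          then show "\<forall>(i, b)\<in>set (qs @ [(i, b - nc_const c)]). \<mu> b = 0" using Cons.prems(4) by simp
        qed
        have 2: "\<mu> (prod_list (map snd (qs @ rs))) = \<nu> (prod_list (map snd (qs @ rs)))"
        proof (rule less.hyps)
          show "length (qs @ rs) < length ps" using Cons.prems(1) by simp
          show "\<forall>(i, b)\<in>set (qs @ rs). i \<in> I \<and> b \<in> B i" using Cons.prems(3) by simp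
        qed
        show ?case unfolding e lin 1 2 ..
      qed
      from this[of "[]" ps] show ?thesis using True less.prems by simp
    qed
  qed
  \<comment> \<open>A single letter is an element of one of the free algebras.\<close>
  define blk where "blk = (\<lambda>l :: nat + nat. (case l of Inl _ \<Rightarrow> None | Inr i \<Rightarrow> Some i, nc_var l))"
  have "\<forall>(i, b)\<in>set (map blk w). i \<in> I \<and> b \<in> B i"
    using w by (auto simp: blk_def I_def B_def ncpolys_def nc_var_def)
  from main[OF this] have "\<mu> (prod_list (map (\<lambda>l. nc_var l) w)) = \<nu> (prod_list (map (\<lambda>l. nc_var l) w))"
    by (simp add: blk_def comp_def)
  then show ?thesis using prod_list_nc_var[of id w] by simp
qed

section \<open>Self-adjoint matrices and operator norms\<close>

lemma mat_adjoint_index: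
  assumes "A \<in> carrier_mat k m" "i < m" "j < k"
  shows "mat_adjoint A $$ (i, j) = cnj (A $$ (j, i))"
  using assms unfolding mat_adjoint_def by (simp add: mat_of_rows_index conjugate_complex_def)

lemma sa_mats_iff:
  "A \<in> sa_mats k \<longleftrightarrow> A \<in> carrier_mat k k \<and> (\<forall>i<k. \<forall>j<k. A $$ (i, j) = cnj (A $$ (j, i)))"
proof (cases "A \<in> carrier_mat k k")
  case True
  have d: "dim_row (mat_adjoint A) = k" "dim_col (mat_adjoint A) = k"
    using True by (auto simp: mat_adjoint_def)
  have "mat_adjoint A = A \<longleftrightarrow> (\<forall>i<k. \<forall>j<k. A $$ (i, j) = cnj (A $$ (j, i)))"
  proof
    assume *: "mat_adjoint A = A"
    show "\<forall>i<k. \<forall>j<k. A $$ (i, j) = cnj (A $$ (j, i))"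
      using mat_adjoint_index[OF True] unfolding * by blast
  next
    assume *: "\<forall>i<k. \<forall>j<k. A $$ (i, j) = cnj (A $$ (j, i))"
    show "mat_adjoint A = A"
    proof (rule eq_matI)
      fix i j assume "i < dim_row A" "j < dim_col A"
      then have ij: "i < k" "j < k" using True by auto
      show "mat_adjoint A $$ (i, j) = A $$ (i, j)"
        using mat_adjoint_index[OF True ij] * ij by metis
    qed (use d True in auto)
  qed
  then show ?thesis using True by (simp add: sa_mats_def)
qed (simp add: sa_mats_def)

lemma sa_mats_index: "A \<in> sa_mats k \<Longrightarrow> i < k \<Longrightarrow> j < k \<Longrightarrow> cnj (A $$ (i, j)) = A $$ (j, i)"
proof -
  assume "A \<in> sa_mats k" "i < k" "j < k"
  then have "A $$ (j, i) = cnj (A $$ (i, j))" unfolding sa_mats_iff by blast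
  then show ?thesis by (rule sym)
qed

lemma sa_mats_carrier: "A \<in> sa_mats k \<Longrightarrow> A \<in> carrier_mat k k"
  by (simp add: sa_mats_def)

lemma vec_l2norm_nonneg [simp]: "0 \<le> vec_l2norm v"
  by (simp add: vec_l2norm_def)

lemma vec_l2norm_add:
  assumes "v \<in> carrier_vec k" "w \<in> carrier_vec k"
  shows "vec_l2norm (v + w) \<le> vec_l2norm v + vec_l2norm w"
proof -
  have "vec_l2norm (v + w) = L2_set (\<lambda>i. cmod (v $ i + w $ i)) {..<k}"
    unfolding vec_l2norm_def using assms by (intro L2_set_cong) auto
  also have "\<dots> \<le> L2_set (\<lambda>i. cmod (v $ i) + cmod (w $ i)) {..<k}"
    by (rule L2_set_mono) (auto simp: norm_triangle_ineq)
  also have "\<dots> \<le> vec_l2norm v + vec_l2norm w"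
    using assms L2_set_triangle_ineq[of "\<lambda>i. cmod (v $ i)" "\<lambda>i. cmod (w $ i)" "{..<k}"]
    unfolding vec_l2norm_def by auto
  finally show ?thesis .
qed

lemma vec_l2norm_smult: "vec_l2norm (c \<cdot>\<^sub>v v) = cmod c * vec_l2norm v"
proof -
  have "vec_l2norm (c \<cdot>\<^sub>v v) = L2_set (\<lambda>i. cmod c * cmod (v $ i)) {..<dim_vec v}"
    unfolding vec_l2norm_def by (intro L2_set_cong) (auto simp: norm_mult)
  then show ?thesis by (simp add: L2_set_right_distrib vec_l2norm_def)
qed

lemma vec_l2norm_eq_0: "v \<in> carrier_vec k \<Longrightarrow> vec_l2norm v = 0 \<Longrightarrow> v = 0\<^sub>v k"
  by (intro eq_vecI) (auto simp: vec_l2norm_def L2_set_eq_0_iff)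

lemma vec_l2norm_zero [simp]: "vec_l2norm (0\<^sub>v k) = 0"
  by (simp add: vec_l2norm_def L2_set_0')

lemma vec_l2norm_unit: "i < k \<Longrightarrow> vec_l2norm (unit_vec k i) = 1"
  unfolding vec_l2norm_def L2_set_def
  by (simp add: if_distrib[of cmod] if_distrib[of "\<lambda>x. x\<^sup>2"] unit_vec_def cong: if_cong)

lemma vec_index_le_l2norm: "i < dim_vec v \<Longrightarrow> cmod (v $ i) \<le> vec_l2norm v"
  unfolding vec_l2norm_def using member_le_L2_set[of "{..<dim_vec v}" i "\<lambda>i. cmod (v $ i)"] by simp

lemma opnorm_bdd:
  assumes "A \<in> carrier_mat k m"
  shows "bdd_above ((\<lambda>v. vec_l2norm (A *\<^sub>v v)) ` {v. v \<in> carrier_vec (dim_col A) \<and> vec_l2norm v \<le> 1})"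
proof (rule bdd_aboveI2)
  fix v assume "v \<in> {v. v \<in> carrier_vec (dim_col A) \<and> vec_l2norm v \<le> 1}"
  then have v: "v \<in> carrier_vec m" "vec_l2norm v \<le> 1" using assms by auto
  have "vec_l2norm (A *\<^sub>v v) \<le> (\<Sum>i<k. cmod ((A *\<^sub>v v) $ i))"
    unfolding vec_l2norm_def using assms by (intro order_trans[OF L2_set_le_sum]) auto
  also have "\<dots> \<le> (\<Sum>i<k. \<Sum>j<m. cmod (A $$ (i, j)))"
  proof (rule sum_mono)
    fix i assume i: "i \<in> {..<k}"
    have "(A *\<^sub>v v) $ i = (\<Sum>j<m. A $$ (i, j) * v $ j)"
      using i assms v by (simp add: scalar_prod_def atLeast0LessThan)
    also have "cmod \<dots> \<le> (\<Sum>j<m. cmod (A $$ (i, j) * v $ j))" by (rule norm_sum)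
    also have "\<dots> \<le> (\<Sum>j<m. cmod (A $$ (i, j)))"
    proof (rule sum_mono)
      fix j assume "j \<in> {..<m}"
      then have "cmod (v $ j) \<le> 1" using vec_index_le_l2norm[of j v] v by auto
      then show "cmod (A $$ (i, j) * v $ j) \<le> cmod (A $$ (i, j))" by (simp add: norm_mult mult_left_le)
    qed
    finally show "cmod ((A *\<^sub>v v) $ i) \<le> (\<Sum>j<m. cmod (A $$ (i, j)))" .
  qed
  finally show "vec_l2norm (A *\<^sub>v v) \<le> (\<Sum>i<k. \<Sum>j<m. cmod (A $$ (i, j)))" .
qed

lemma opnorm_upper1:
  assumes "A \<in> carrier_mat k m" "v \<in> carrier_vec m" "vec_l2norm v \<le> 1"
  shows "vec_l2norm (A *\<^sub>v v) \<le> opnorm A"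
proof -
  have "v \<in> {v. v \<in> carrier_vec (dim_col A) \<and> vec_l2norm v \<le> 1}" using assms by auto
  then have "vec_l2norm (A *\<^sub>v v) \<in> (\<lambda>v. vec_l2norm (A *\<^sub>v v)) ` {v. v \<in> carrier_vec (dim_col A) \<and> vec_l2norm v \<le> 1}"
    by (rule imageI)
  then show ?thesis unfolding opnorm_def by (rule cSup_upper[OF _ opnorm_bdd[OF assms(1)]])
qed

lemma opnorm_nonneg: "A \<in> carrier_mat k m \<Longrightarrow> 0 \<le> opnorm A"
  using opnorm_upper1[of A k m "0\<^sub>v m"] order_trans[OF vec_l2norm_nonneg, of "A *\<^sub>v 0\<^sub>v m" "opnorm A"] by simp

lemma opnorm_upper:
  assumes A: "A \<in> carrier_mat k m" and v: "v \<in> carrier_vec m"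
  shows "vec_l2norm (A *\<^sub>v v) \<le> opnorm A * vec_l2norm v"
proof (cases "vec_l2norm v = 0")
  case True
  then have "v = 0\<^sub>v m" using vec_l2norm_eq_0 v by blast
  moreover have "A *\<^sub>v 0\<^sub>v m = 0\<^sub>v k" using A by (intro eq_vecI) auto
  ultimately show ?thesis by simp
next
  case False
  define r where "r = vec_l2norm v"
  have r: "r > 0" using False vec_l2norm_nonneg[of v] unfolding r_def by linarith
  have "vec_l2norm (A *\<^sub>v (complex_of_real (1 / r) \<cdot>\<^sub>v v)) \<le> opnorm A"
    using r v by (intro opnorm_upper1[OF A]) (auto simp: vec_l2norm_smult norm_divide r_def[symmetric])
  also have "A *\<^sub>v (complex_of_real (1 / r) \<cdot>\<^sub>v v) = complex_of_real (1 / r) \<cdot>\<^sub>v (A *\<^sub>v v)"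
    using A v by (rule mult_mat_vec)
  finally show ?thesis using r by (simp add: vec_l2norm_smult norm_divide r_def[symmetric] field_simps)
qed

lemma opnorm_least:
  assumes "A \<in> carrier_mat k m" "\<And>v. v \<in> carrier_vec m \<Longrightarrow> vec_l2norm v \<le> 1 \<Longrightarrow> vec_l2norm (A *\<^sub>v v) \<le> c"
  shows "opnorm A \<le> c"
  unfolding opnorm_def
proof (rule cSUP_least)
  show "{v. v \<in> carrier_vec (dim_col A) \<and> vec_l2norm v \<le> 1} \<noteq> {}"
    by (auto intro!: exI[of _ "0\<^sub>v (dim_col A)"])
qed (use assms in auto)

lemma opnorm_le_iff:
  assumes "A \<in> carrier_mat k m"
  shows "opnorm A \<le> c \<longleftrightarrow> (\<forall>v\<in>carrier_vec m. vec_l2norm v \<le> 1 \<longrightarrow> vec_l2norm (A *\<^sub>v v) \<le> c)"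
proof
  assume "opnorm A \<le> c"
  then show "\<forall>v\<in>carrier_vec m. vec_l2norm v \<le> 1 \<longrightarrow> vec_l2norm (A *\<^sub>v v) \<le> c"
    using opnorm_upper1[OF assms] by (intro ballI impI) (rule order_trans)
next
  assume *: "\<forall>v\<in>carrier_vec m. vec_l2norm v \<le> 1 \<longrightarrow> vec_l2norm (A *\<^sub>v v) \<le> c"
  show "opnorm A \<le> c" by (rule opnorm_least[OF assms]) (use * in blast)
qed

lemma opnorm_add:
  assumes "A \<in> carrier_mat k m" "B \<in> carrier_mat k m"
  shows "opnorm (A + B) \<le> opnorm A + opnorm B"
proof (rule opnorm_least[of _ k m])
  fix v :: "complex vec" assume v: "v \<in> carrier_vec m" "vec_l2norm v \<le> 1"
  have "(A + B) *\<^sub>v v = A *\<^sub>v v + B *\<^sub>v v" using assms v by (intro add_mult_distrib_mat_vec)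
  then have "vec_l2norm ((A + B) *\<^sub>v v) \<le> vec_l2norm (A *\<^sub>v v) + vec_l2norm (B *\<^sub>v v)"
    using vec_l2norm_add[of "A *\<^sub>v v" k "B *\<^sub>v v"] assms v by simp
  then show "vec_l2norm ((A + B) *\<^sub>v v) \<le> opnorm A + opnorm B"
    using opnorm_upper1[OF assms(1) v] opnorm_upper1[OF assms(2) v] by linarith
qed (use assms in auto)

lemma opnorm_smult:
  assumes "A \<in> carrier_mat k m"
  shows "opnorm (c \<cdot>\<^sub>m A) \<le> cmod c * opnorm A"
proof (rule opnorm_least[of _ k m])
  fix v :: "complex vec" assume v: "v \<in> carrier_vec m" "vec_l2norm v \<le> 1"
  have "(c \<cdot>\<^sub>m A) *\<^sub>v v = c \<cdot>\<^sub>v (A *\<^sub>v v)"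
    using assms v by (intro eq_vecI) (auto simp: scalar_prod_def sum_distrib_left mult.assoc)
  then show "vec_l2norm ((c \<cdot>\<^sub>m A) *\<^sub>v v) \<le> cmod c * opnorm A"
    using opnorm_upper1[OF assms v] by (simp add: vec_l2norm_smult mult_left_mono)
qed (use assms in auto)

lemma index_le_opnorm:
  assumes "A \<in> carrier_mat k m" "i < k" "j < m"
  shows "cmod (A $$ (i, j)) \<le> opnorm A"
proof -
  have "A $$ (i, j) = (A *\<^sub>v unit_vec m j) $ i" using assms by simp
  also have "cmod \<dots> \<le> vec_l2norm (A *\<^sub>v unit_vec m j)"
    using assms by (intro vec_index_le_l2norm) simp
  also have "\<dots> \<le> opnorm A" using assms by (intro opnorm_upper1) (auto simp: vec_l2norm_unit)
  finally show ?thesis .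
qed

lemma ntrace_le_opnorm:
  assumes "A \<in> carrier_mat k k"
  shows "cmod (ntrace k A) \<le> opnorm A"
proof (cases "k = 0")
  case True
  then show ?thesis using opnorm_nonneg[OF assms] by (simp add: ntrace_def)
next
  case False
  have "cmod (\<Sum>i<k. A $$ (i, i)) \<le> (\<Sum>i<k. opnorm A)"
    by (rule sum_norm_le) (use assms index_le_opnorm in auto)
  then show ?thesis using False by (simp add: ntrace_def norm_divide field_simps)
qed

section \<open>Words in matrices\<close>

lemma mat_word_Nil [simp]: "mat_word k A [] = 1\<^sub>m k"
  by (simp add: mat_word_def)

lemma mat_word_Cons [simp]: "mat_word k A (x # w) = A x * mat_word k A w"
  by (simp add: mat_word_def)

lemma mat_word_carrier:
  "(\<And>x. x \<in> set w \<Longrightarrow> A x \<in> carrier_mat k k) \<Longrightarrow> mat_word k A w \<in> carrier_mat k k"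
proof (induction w)
  case (Cons x w)
  then have "A x \<in> carrier_mat k k" "mat_word k A w \<in> carrier_mat k k" by simp_all
  then show ?case unfolding mat_word_Cons by (rule mult_carrier_mat)
qed simp

lemma mat_word_append:
  assumes "\<And>x. x \<in> set u \<union> set v \<Longrightarrow> A x \<in> carrier_mat k k"
  shows "mat_word k A (u @ v) = mat_word k A u * mat_word k A v"
  using assms
proof (induction u)
  case Nil
  then have "mat_word k A v \<in> carrier_mat k k" using mat_word_carrier[of v A k] by simp
  then show ?case by simp
next
  case (Cons x u)
  have "mat_word k A u \<in> carrier_mat k k" "mat_word k A v \<in> carrier_mat k k" "A x \<in> carrier_mat k k"
    using Cons.prems mat_word_carrier[of u A k] mat_word_carrier[of v A k] by simp_all
  then show ?case using Cons by (simp add: assoc_mult_mat[of _ k k _ k _ k])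
qed

lemma mat_mult_index:
  assumes "A \<in> carrier_mat k l" "B \<in> carrier_mat l m" "i < k" "j < m"
  shows "(A * B) $$ (i, j) = (\<Sum>p<l. A $$ (i, p) * B $$ (p, j))"
  using assms by (simp add: scalar_prod_def atLeast0LessThan)

lemma ntrace_mult_commute:
  assumes "A \<in> carrier_mat k k" "B \<in> carrier_mat k k"
  shows "ntrace k (A * B) = ntrace k (B * A)"
proof -
  have "(\<Sum>i<k. (A * B) $$ (i, i)) = (\<Sum>i<k. \<Sum>p<k. A $$ (i, p) * B $$ (p, i))"
    using mat_mult_index[OF assms] by (intro sum.cong) auto
  also have "\<dots> = (\<Sum>p<k. \<Sum>i<k. B $$ (p, i) * A $$ (i, p))"
    by (subst sum.swap) (simp add: mult.commute)
  also have "\<dots> = (\<Sum>i<k. (B * A) $$ (i, i))"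
    using mat_mult_index[OF assms(2,1)] by (intro sum.cong) auto
  finally show ?thesis by (simp add: ntrace_def)
qed

lemma mat_word_rev_index:
  assumes "\<And>x. x \<in> set w \<Longrightarrow> A x \<in> sa_mats k" "i < k" "j < k"
  shows "mat_word k A (rev w) $$ (i, j) = cnj (mat_word k A w $$ (j, i))"
  using assms
proof (induction w arbitrary: i j)
  case Nil
  then show ?case by (auto simp: one_mat_def)
next
  case (Cons x w)
  have x: "A x \<in> sa_mats k" "A x \<in> carrier_mat k k" using Cons.prems by (auto simp: sa_mats_def)
  have w: "mat_word k A w \<in> carrier_mat k k" "mat_word k A (rev w) \<in> carrier_mat k k"
    using Cons.prems by (auto intro!: mat_word_carrier simp: sa_mats_def)
  have "mat_word k A (rev w @ [x]) = mat_word k A (rev w) * mat_word k A [x]"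
    by (rule mat_word_append) (use Cons.prems in \<open>auto simp: sa_mats_def\<close>)
  then have "mat_word k A (rev (x # w)) = mat_word k A (rev w) * A x"
    using x(2) by (simp add: right_mult_one_mat)
  then have "mat_word k A (rev (x # w)) $$ (i, j) = (\<Sum>p<k. mat_word k A (rev w) $$ (i, p) * A x $$ (p, j))"
    using mat_mult_index[OF w(2) x(2)] Cons.prems(2,3) by simp
  also have "\<dots> = (\<Sum>p<k. cnj (A x $$ (j, p) * mat_word k A w $$ (p, i)))"
  proof (rule sum.cong)
    fix p assume "p \<in> {..<k}"
    then have p: "p < k" by simp
    have "mat_word k A (rev w) $$ (i, p) = cnj (mat_word k A w $$ (p, i))"
      by (rule Cons.IH) (use Cons.prems p in auto)
    then show "mat_word k A (rev w) $$ (i, p) * A x $$ (p, j) = cnj (A x $$ (j, p) * mat_word k A w $$ (p, i))"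
      using sa_mats_index[OF x(1) Cons.prems(3) p] by simp
  qed simp
  also have "\<dots> = cnj (mat_word k A (x # w) $$ (j, i))"
    using mat_mult_index[OF x(2) w(1)] Cons.prems(2,3) by simp
  finally show ?case .
qed

lemma ntrace_mat_word_rev:
  assumes "\<And>x. x \<in> set w \<Longrightarrow> A x \<in> sa_mats k"
  shows "ntrace k (mat_word k A (rev w)) = cnj (ntrace k (mat_word k A w))"
proof -
  have "(\<Sum>i<k. mat_word k A (rev w) $$ (i, i)) = (\<Sum>i<k. cnj (mat_word k A w $$ (i, i)))"
    by (intro sum.cong refl mat_word_rev_index assms) auto
  then show ?thesis by (simp add: ntrace_def)
qed

section \<open>Evaluation in a C*-algebra\<close>

lemma scaleC_zero_left: "0 *\<^sub>C (a :: 'a::cstar_algebra_1) = 0"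
  using scaleC_of_real[of 0 a] by simp

lemma scaleC_one: "1 *\<^sub>C (a :: 'a::cstar_algebra_1) = a"
  using scaleC_of_real[of 1 a] by simp

lemma scaleC_diff_right: "c *\<^sub>C (a - b :: 'a::cstar_algebra_1) = c *\<^sub>C a - c *\<^sub>C b"
  using scaleC_add_right[of c "a - b" b] by (simp add: algebra_simps)

lemma scaleC_diff_left: "(c - d) *\<^sub>C (a :: 'a::cstar_algebra_1) = c *\<^sub>C a - d *\<^sub>C a"
  using scaleC_add_left[of "c - d" d a] by (simp add: algebra_simps)

lemma nc_eval_nc_sum: "nc_eval x = nc_sum (\<lambda>c w. c *\<^sub>C prod_list (map x (letters w)))"
  by (simp add: fun_eq_iff nc_eval_def nc_sum_def)

lemmas nc_eval_additive = scaleC_zero_left scaleC_add_left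

lemma nc_eval_single: "nc_eval x (Poly_Mapping.single w c) = c *\<^sub>C prod_list (map x (letters w))"
  by (simp add: nc_eval_nc_sum nc_sum_single scaleC_zero_left)

lemma nc_eval_add: "nc_eval x (p + q) = nc_eval x p + nc_eval x q"
  by (simp add: nc_eval_nc_sum nc_sum_add nc_eval_additive)

lemma nc_eval_sum: "nc_eval x (\<Sum>i\<in>I. f i) = (\<Sum>i\<in>I. nc_eval x (f i))"
  by (simp add: nc_eval_nc_sum nc_sum_sum nc_eval_additive)

lemma nc_eval_mult: "nc_eval x (p * q) = nc_eval x p * nc_eval x q"
proof -
  have "nc_eval x (p * q) = (\<Sum>u\<in>Poly_Mapping.keys p. \<Sum>v\<in>Poly_Mapping.keys q.
     (Poly_Mapping.lookup p u * Poly_Mapping.lookup q v) *\<^sub>C (prod_list (map x (letters u)) * prod_list (map x (letters v))))"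
    unfolding nc_eval_nc_sum by (subst nc_sum_mult) (simp_all add: nc_eval_additive)
  also have "\<dots> = nc_eval x p * nc_eval x q"
    unfolding nc_eval_def sum_product
    by (simp add: scaleC_mult_left scaleC_mult_right scaleC_scaleC mult.commute)
  finally show ?thesis .
qed

lemma nc_eval_const: "nc_eval x (nc_const c) = c *\<^sub>C 1"
  by (simp add: nc_const_def nc_eval_single)

lemma nc_eval_diff: "nc_eval x (p - q) = nc_eval x p - nc_eval x q"
  using nc_eval_add[of x "p - q" q] by simp

text \<open>The adjoint of a polynomial in self-adjoint variables.\<close>

definition nc_star :: "'v ncpoly \<Rightarrow> 'v ncpoly" where
  "nc_star p = (\<Sum>w\<in>Poly_Mapping.keys p. Poly_Mapping.single (Word (rev (letters w))) (cnj (Poly_Mapping.lookup p w)))"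

lemma star_zero: "star (0 :: 'a::cstar_algebra_1) = 0"
  using star_add[of 0 "0::'a"] by simp

lemma star_one: "star (1 :: 'a::cstar_algebra_1) = 1"
  using star_mult[of "star 1" "1::'a"] by (simp add: star_star)

lemma star_sum: "star (\<Sum>i\<in>I. f i :: 'a::cstar_algebra_1) = (\<Sum>i\<in>I. star (f i))"
  by (induction I rule: infinite_finite_induct) (simp_all add: star_zero star_add)

lemma star_prod_list:
  assumes "\<And>i. i \<in> set w \<Longrightarrow> star (x i) = (x i :: 'a::cstar_algebra_1)"
  shows "star (prod_list (map x w)) = prod_list (map x (rev w))"
  using assms by (induction w) (simp_all add: star_one star_mult)

lemma nc_eval_star:
  assumes "p \<in> ncpolys V" "\<And>i. i \<in> V \<Longrightarrow> star (x i) = (x i :: 'a::cstar_algebra_1)"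
  shows "nc_eval x (nc_star p) = star (nc_eval x p)"
proof -
  have "star (prod_list (map x (letters w))) = prod_list (map x (rev (letters w)))" if "w \<in> Poly_Mapping.keys p" for w
    using assms that by (intro star_prod_list) (auto simp: ncpolys_def)
  then show ?thesis
    by (simp add: nc_star_def nc_eval_sum nc_eval_single) (simp add: nc_eval_def star_sum star_scaleC)
qed

lemma norm_star: "norm (star a :: 'a::cstar_algebra_1) = norm a"
proof -
  have le: "norm a \<le> norm (star a)" for a :: 'a
  proof (cases "norm a = 0")
    case False
    have "norm a * norm a \<le> norm (star a) * norm a"
      using cstar_identity[of a] norm_mult_ineq[of "star a" a] by (simp add: power2_eq_square)
    then show ?thesis using False by simp
  qed simp
  show ?thesis using le[of a] le[of "star a"] by (simp add: star_star)
qed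

lemma tendsto_star: "(f \<longlongrightarrow> (a::'a::cstar_algebra_1)) F \<Longrightarrow> ((\<lambda>i. star (f i)) \<longlongrightarrow> star a) F"
proof -
  assume "(f \<longlongrightarrow> a) F"
  then have "((\<lambda>i. norm (f i - a)) \<longlongrightarrow> 0) F" by (intro tendsto_norm_zero LIM_zero)
  moreover have "norm (f i - a) = norm (star (f i) - star a)" for i
  proof -
    have "star (f i) - star a = star (f i - a)" using star_add[of "f i - a" a] by simp
    then show ?thesis by (simp add: norm_star)
  qed
  ultimately have "((\<lambda>i. norm (star (f i) - star a)) \<longlongrightarrow> 0) F" by simp
  then show ?thesis by (rule LIM_zero_cancel[OF tendsto_norm_zero_cancel])
qed

lemma tendsto_scaleC:
  assumes "(c \<longlongrightarrow> d) F" "(f \<longlongrightarrow> (a::'a::cstar_algebra_1)) F"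
  shows "((\<lambda>i. c i *\<^sub>C f i) \<longlongrightarrow> d *\<^sub>C a) F"
proof -
  have "((\<lambda>i. cmod (c i) * norm (f i - a) + cmod (c i - d) * norm a) \<longlongrightarrow> cmod d * 0 + 0 * norm a) F"
    using assms by (intro tendsto_intros) (auto simp: LIM_zero tendsto_norm_zero)
  then have lim: "((\<lambda>i. cmod (c i) * norm (f i - a) + cmod (c i - d) * norm a) \<longlongrightarrow> 0) F" by simp
  have "((\<lambda>i. c i *\<^sub>C f i - d *\<^sub>C a) \<longlongrightarrow> 0) F"
  proof (rule Lim_null_comparison[OF always_eventually lim], rule allI)
    fix i
    have "c i *\<^sub>C f i - d *\<^sub>C a = c i *\<^sub>C (f i - a) + (c i - d) *\<^sub>C a"
      by (simp add: scaleC_diff_right scaleC_diff_left)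
    then show "norm (c i *\<^sub>C f i - d *\<^sub>C a) \<le> cmod (c i) * norm (f i - a) + cmod (c i - d) * norm a"
      using norm_triangle_ineq[of "c i *\<^sub>C (f i - a)" "(c i - d) *\<^sub>C a"] by (simp add: norm_scaleC)
  qed
  then show ?thesis by (rule LIM_zero_cancel)
qed

section \<open>Density of the rational polynomials\<close>

definition rat_complex :: "complex \<Rightarrow> bool" where
  "rat_complex z \<longleftrightarrow> Re z \<in> \<rat> \<and> Im z \<in> \<rat>"

lemma rat_complex_closed:
  "rat_complex 0" "rat_complex 1" "rat_complex a \<Longrightarrow> rat_complex b \<Longrightarrow> rat_complex (a + b)"
  "rat_complex a \<Longrightarrow> rat_complex b \<Longrightarrow> rat_complex (a - b)"
  "rat_complex a \<Longrightarrow> rat_complex b \<Longrightarrow> rat_complex (a * b)" "rat_complex a \<Longrightarrow> rat_complex (cnj a)"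
  by (auto simp: rat_complex_def)

lemma rat_complex_seq: "\<exists>c. (\<forall>i. rat_complex (c i)) \<and> c \<longlonglongrightarrow> z"
proof -
  have *: "\<exists>r. (\<forall>i. r i \<in> \<rat>) \<and> r \<longlonglongrightarrow> a" for a :: real
  proof -
    have "\<exists>r\<in>\<rat>. a < r \<and> r < a + inverse (real (Suc i))" for i
      by (rule Rats_dense_in_real) simp
    then obtain r where r: "\<And>i. r i \<in> \<rat>" "\<And>i. a < r i" "\<And>i. r i < a + inverse (real (Suc i))" by metis
    have "r \<longlonglongrightarrow> a"
    proof (rule tendsto_sandwich[where f = "\<lambda>_. a" and h = "\<lambda>i. a + inverse (real (Suc i))"])
      show "(\<lambda>i. a + inverse (real (Suc i))) \<longlonglongrightarrow> a" by (rule LIMSEQ_inverse_real_of_nat_add)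
    qed (use r(2,3) in \<open>simp_all add: less_imp_le del: of_nat_Suc\<close>)
    then show ?thesis using r(1) by blast
  qed
  obtain r s where "\<forall>i. r i \<in> \<rat>" "r \<longlonglongrightarrow> Re z" "\<forall>i. s i \<in> \<rat>" "s \<longlonglongrightarrow> Im z"
    using *[of "Re z"] *[of "Im z"] by blast
  then show ?thesis
    by (intro exI[of _ "\<lambda>i. Complex (r i) (s i)"]) (auto simp: rat_complex_def tendsto_complex_iff)
qed

lemma rat_ncpolys_iff: "p \<in> rat_ncpolys n \<longleftrightarrow> p \<in> ncpolys {..<n} \<and> (\<forall>w. rat_complex (Poly_Mapping.lookup p w))"
  by (auto simp: rat_ncpolys_def rat_complex_def)

lemma rat_ncpolys_single: "set (letters w) \<subseteq> {..<n} \<Longrightarrow> rat_complex c \<Longrightarrow> Poly_Mapping.single w c \<in> rat_ncpolys n"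
  by (auto simp: rat_ncpolys_iff ncpolys_def lookup_single when_def rat_complex_closed)

lemma rat_ncpolys_const: "rat_complex c \<Longrightarrow> nc_const c \<in> rat_ncpolys n"
  unfolding nc_const_def by (rule rat_ncpolys_single) auto

lemma rat_ncpolys_add: "p \<in> rat_ncpolys n \<Longrightarrow> q \<in> rat_ncpolys n \<Longrightarrow> p + q \<in> rat_ncpolys n"
  by (auto simp: rat_ncpolys_iff ncpolys_add lookup_add rat_complex_closed)

lemma rat_ncpolys_diff: "p \<in> rat_ncpolys n \<Longrightarrow> q \<in> rat_ncpolys n \<Longrightarrow> p - q \<in> rat_ncpolys n"
  by (auto simp: rat_ncpolys_iff ncpolys_diff lookup_minus rat_complex_closed)

lemma rat_ncpolys_sum: "(\<And>i. i \<in> I \<Longrightarrow> f i \<in> rat_ncpolys n) \<Longrightarrow> (\<Sum>i\<in>I. f i) \<in> rat_ncpolys n"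
proof (induction I rule: infinite_finite_induct)
  case (insert i I)
  then show ?case by (simp add: rat_ncpolys_add)
qed (auto simp: rat_ncpolys_iff ncpolys_def rat_complex_closed)

lemma rat_ncpolys_mult: "p \<in> rat_ncpolys n \<Longrightarrow> q \<in> rat_ncpolys n \<Longrightarrow> p * q \<in> rat_ncpolys n"
proof -
  assume p: "p \<in> rat_ncpolys n" and q: "q \<in> rat_ncpolys n"
  have "p * q = (\<Sum>u\<in>Poly_Mapping.keys p. Poly_Mapping.single u (Poly_Mapping.lookup p u))
      * (\<Sum>u\<in>Poly_Mapping.keys q. Poly_Mapping.single u (Poly_Mapping.lookup q u))"
    using poly_mapping_sum_singles[of p] poly_mapping_sum_singles[of q] by simp
  also have "\<dots> = (\<Sum>u\<in>Poly_Mapping.keys p. \<Sum>v\<in>Poly_Mapping.keys q.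
      Poly_Mapping.single (u + v) (Poly_Mapping.lookup p u * Poly_Mapping.lookup q v))"
    by (simp add: sum_product mult_single)
  also have "\<dots> \<in> rat_ncpolys n"
    using p q by (intro rat_ncpolys_sum rat_ncpolys_single) (auto simp: rat_ncpolys_iff ncpolys_def rat_complex_closed)
  finally show ?thesis .
qed

lemma rat_ncpolys_star: "p \<in> rat_ncpolys n \<Longrightarrow> nc_star p \<in> rat_ncpolys n"
  unfolding nc_star_def
  by (intro rat_ncpolys_sum rat_ncpolys_single) (auto simp: rat_ncpolys_iff ncpolys_def rat_complex_closed)

text \<open>The closure of the set of values is a C*-subalgebra which contains the generators; for closure under
  complex scalars the scalar is approximated by rational ones.\<close>

lemma rat_polys_dense:
  fixes x :: "nat \<Rightarrow> 'a::cstar_algebra_1"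
  assumes sa: "\<And>i. i < n \<Longrightarrow> selfadjoint (x i)" and gen: "cstar_subalgebra hull (x ` {..<n}) = UNIV"
  shows "\<exists>p. (\<forall>i. p i \<in> rat_ncpolys n) \<and> (\<lambda>i. nc_eval x (p i)) \<longlonglongrightarrow> a"
proof -
  define C where "C = closure (nc_eval x ` rat_ncpolys n)"
  have seq: "b \<in> C \<longleftrightarrow> (\<exists>p. (\<forall>i. p i \<in> rat_ncpolys n) \<and> (\<lambda>i. nc_eval x (p i)) \<longlonglongrightarrow> b)" for b
  proof
    assume "b \<in> C"
    then obtain f where f: "\<forall>i. f i \<in> nc_eval x ` rat_ncpolys n" "f \<longlonglongrightarrow> b"
      unfolding C_def closure_sequential by blast
    then have "\<forall>i. \<exists>p. p \<in> rat_ncpolys n \<and> f i = nc_eval x p" by blast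
    then obtain p where p: "\<forall>i. p i \<in> rat_ncpolys n" "\<forall>i. f i = nc_eval x (p i)" by metis
    then show "\<exists>p. (\<forall>i. p i \<in> rat_ncpolys n) \<and> (\<lambda>i. nc_eval x (p i)) \<longlonglongrightarrow> b"
      using f(2) p(1) ext[of f "\<lambda>i. nc_eval x (p i)"] p(2) by (intro exI[of _ p]) simp
  next
    assume "\<exists>p. (\<forall>i. p i \<in> rat_ncpolys n) \<and> (\<lambda>i. nc_eval x (p i)) \<longlonglongrightarrow> b"
    then obtain p where "\<forall>i. p i \<in> rat_ncpolys n" "(\<lambda>i. nc_eval x (p i)) \<longlonglongrightarrow> b" by blast
    then show "b \<in> C" unfolding C_def closure_sequential
      by (intro exI[of _ "\<lambda>i. nc_eval x (p i)"]) auto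
  qed
  have "cstar_subalgebra C"
    unfolding cstar_subalgebra_def
  proof (intro conjI ballI allI)
    show "closed C" by (simp add: C_def)
    have "nc_eval x (nc_const 1) \<in> C"
      unfolding C_def by (intro subsetD[OF closure_subset] imageI rat_ncpolys_const rat_complex_closed)
    then show "1 \<in> C" by (simp add: nc_eval_const scaleC_one)
  next
    fix a b assume "a \<in> C" "b \<in> C"
    then obtain p q where p: "\<forall>i. p i \<in> rat_ncpolys n" "(\<lambda>i. nc_eval x (p i)) \<longlonglongrightarrow> a"
      and q: "\<forall>i. q i \<in> rat_ncpolys n" "(\<lambda>i. nc_eval x (q i)) \<longlonglongrightarrow> b" unfolding seq by blast
    show "a + b \<in> C" unfolding seq using p q
      by (intro exI[of _ "\<lambda>i. p i + q i"]) (simp add: nc_eval_add tendsto_add rat_ncpolys_add)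
    show "a * b \<in> C" unfolding seq using p q
      by (intro exI[of _ "\<lambda>i. p i * q i"]) (simp add: nc_eval_mult tendsto_mult rat_ncpolys_mult)
  next
    fix c a assume "a \<in> C"
    then obtain p where p: "\<forall>i. p i \<in> rat_ncpolys n" "(\<lambda>i. nc_eval x (p i)) \<longlonglongrightarrow> a" unfolding seq by blast
    obtain d where d: "\<forall>i. rat_complex (d i)" "d \<longlonglongrightarrow> c" using rat_complex_seq by blast
    show "c *\<^sub>C a \<in> C" unfolding seq using p d
      by (intro exI[of _ "\<lambda>i. nc_const (d i) * p i"])
         (simp add: nc_eval_mult nc_eval_const rat_ncpolys_mult rat_ncpolys_const scaleC_mult_left tendsto_scaleC)
  next
    fix a assume "a \<in> C"
    then obtain p where p: "\<forall>i. p i \<in> rat_ncpolys n" "(\<lambda>i. nc_eval x (p i)) \<longlonglongrightarrow> a" unfolding seq by blast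
    have "nc_eval x (nc_star (p i)) = star (nc_eval x (p i))" for i
      using p(1) sa by (intro nc_eval_star[of _ "{..<n}"]) (auto simp: selfadjoint_def rat_ncpolys_iff)
    then show "star a \<in> C" unfolding seq using p
      by (intro exI[of _ "\<lambda>i. nc_star (p i)"]) (simp add: rat_ncpolys_star tendsto_star)
  qed
  moreover have "x ` {..<n} \<subseteq> C"
  proof (rule image_subsetI)
    fix i assume "i \<in> {..<n}"
    then have "Poly_Mapping.single (Word [i]) 1 \<in> rat_ncpolys n"
      by (intro rat_ncpolys_single) (auto simp: rat_complex_closed)
    then have "nc_eval x (Poly_Mapping.single (Word [i]) 1) \<in> C"
      unfolding C_def by (intro subsetD[OF closure_subset] imageI)
    then show "x i \<in> C" by (simp add: nc_eval_single scaleC_one)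
  qed
  ultimately have "UNIV \<subseteq> C" using hull_minimal[of "x ` {..<n}" C cstar_subalgebra] gen by simp
  then show ?thesis using seq by blast
qed

text \<open>A functional defined on formal expressions whose values are dense extends to all values, by Cauchy
  sequences. The Lipschitz bound makes the extension independent of the approximating sequence.\<close>

lemma lipschitz_functional_extend:
  fixes ev :: "'p \<Rightarrow> 'a::real_normed_vector" and L :: "'p \<Rightarrow> complex"
  assumes lip: "\<And>p q. p \<in> Q \<Longrightarrow> q \<in> Q \<Longrightarrow> cmod (L p - L q) \<le> norm (ev p - ev q)"
    and dense: "\<And>a. \<exists>p. (\<forall>i::nat. p i \<in> Q) \<and> (\<lambda>i. ev (p i)) \<longlonglongrightarrow> a"
  shows "\<exists>\<tau>. \<forall>a p. (\<forall>i::nat. p i \<in> Q) \<longrightarrow> (\<lambda>i. ev (p i)) \<longlonglongrightarrow> a \<longrightarrow> (\<lambda>i. L (p i)) \<longlonglongrightarrow> \<tau> a"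
proof -
  from dense obtain P where P: "\<And>a i. P a i \<in> Q" "\<And>a. (\<lambda>i. ev (P a i)) \<longlonglongrightarrow> a" by metis
  have "convergent (\<lambda>i. L (P a i))" for a
  proof (rule Cauchy_convergent, rule CauchyI)
    fix e :: real assume "e > 0"
    have "Cauchy (\<lambda>i. ev (P a i))" using P(2) by (rule LIMSEQ_imp_Cauchy)
    then obtain M where "\<forall>m\<ge>M. \<forall>n\<ge>M. norm (ev (P a m) - ev (P a n)) < e"
      using CauchyD \<open>e > 0\<close> by blast
    then show "\<exists>M. \<forall>m\<ge>M. \<forall>n\<ge>M. norm (L (P a m) - L (P a n)) < e"
      by (intro exI[of _ M] allI impI) (rule le_less_trans[OF lip[OF P(1) P(1)]], blast)
  qed
  then obtain \<tau> where \<tau>: "\<And>a. (\<lambda>i. L (P a i)) \<longlonglongrightarrow> \<tau> a" unfolding convergent_def by metis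
  have "(\<lambda>i. L (p i)) \<longlonglongrightarrow> \<tau> a" if p: "\<forall>i. p i \<in> Q" "(\<lambda>i. ev (p i)) \<longlonglongrightarrow> a" for a and p :: "nat \<Rightarrow> 'p"
  proof -
    have "(\<lambda>i. norm (ev (p i) - ev (P a i))) \<longlonglongrightarrow> 0"
      using tendsto_diff[OF p(2) P(2)[of a]] by (intro tendsto_norm_zero) simp
    then have "(\<lambda>i. L (p i) - L (P a i)) \<longlonglongrightarrow> 0"
      by (rule Lim_null_comparison[rotated]) (use lip p(1) P(1) in auto)
    from tendsto_add[OF this \<tau>[of a]] show ?thesis by simp
  qed
  then show ?thesis by blast
qed

section \<open>Limits of matrix traces are tracial states\<close>

lemma ntrace_mat_nc_eval:
  "ntrace k (mat_nc_eval k A p) = nc_sum (\<lambda>c w. c * ntrace k (mat_word k A (letters w))) p"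
proof -
  have "(\<Sum>i<k. mat_nc_eval k A p $$ (i, i)) =
    (\<Sum>i<k. \<Sum>w\<in>Poly_Mapping.keys p. Poly_Mapping.lookup p w * mat_word k A (letters w) $$ (i, i))"
    by (intro sum.cong) (auto simp: mat_nc_eval_def)
  also have "\<dots> = (\<Sum>w\<in>Poly_Mapping.keys p. Poly_Mapping.lookup p w * (\<Sum>i<k. mat_word k A (letters w) $$ (i, i)))"
    by (subst sum.swap) (simp add: sum_distrib_left)
  finally show ?thesis
    by (simp add: ntrace_def nc_sum_def sum_divide_distrib[of "\<lambda>w. _ w * _ w"])
qed

lemma ntrace_nc_add: "ntrace k (mat_nc_eval k A (p + q)) = ntrace k (mat_nc_eval k A p) + ntrace k (mat_nc_eval k A q)"
  unfolding ntrace_mat_nc_eval by (rule nc_sum_add) (auto simp: algebra_simps)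

lemma ntrace_nc_mult:
  "ntrace k (mat_nc_eval k A (p * q)) = (\<Sum>u\<in>Poly_Mapping.keys p. \<Sum>v\<in>Poly_Mapping.keys q.
     Poly_Mapping.lookup p u * Poly_Mapping.lookup q v * ntrace k (mat_word k A (letters u @ letters v)))"
  unfolding ntrace_mat_nc_eval by (subst nc_sum_mult) (auto simp: algebra_simps)

lemma ntrace_nc_const_mult: "ntrace k (mat_nc_eval k A (nc_const c * p)) = c * ntrace k (mat_nc_eval k A p)"
  unfolding ntrace_mat_nc_eval
  by (subst nc_sum_const_mult) (auto simp: algebra_simps nc_sum_def sum_distrib_left)

lemma ntrace_nc_single: "ntrace k (mat_nc_eval k A (Poly_Mapping.single w c)) = c * ntrace k (mat_word k A (letters w))"
  by (simp add: ntrace_mat_nc_eval nc_sum_single)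

lemma ntrace_nc_commute:
  assumes "p \<in> ncpolys V" "q \<in> ncpolys V" "\<And>i. i \<in> V \<Longrightarrow> A i \<in> carrier_mat k k"
  shows "ntrace k (mat_nc_eval k A (p * q)) = ntrace k (mat_nc_eval k A (q * p))"
proof -
  have "ntrace k (mat_word k A (letters u @ letters v)) = ntrace k (mat_word k A (letters v @ letters u))"
    if "u \<in> Poly_Mapping.keys p" "v \<in> Poly_Mapping.keys q" for u v
  proof -
    have c: "A i \<in> carrier_mat k k" if "i \<in> set (letters u) \<union> set (letters v)" for i
    proof (rule assms(3))
      show "i \<in> V"
        using assms(1,2) that \<open>u \<in> Poly_Mapping.keys p\<close> \<open>v \<in> Poly_Mapping.keys q\<close> by (auto simp: ncpolys_def)
    qed
    have "mat_word k A (letters u @ letters v) = mat_word k A (letters u) * mat_word k A (letters v)"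
      "mat_word k A (letters v @ letters u) = mat_word k A (letters v) * mat_word k A (letters u)"
      using c by (intro mat_word_append; auto)+
    moreover have "mat_word k A (letters u) \<in> carrier_mat k k" "mat_word k A (letters v) \<in> carrier_mat k k"
      using c by (intro mat_word_carrier; auto)+
    ultimately show ?thesis using ntrace_mult_commute by simp
  qed
  then show ?thesis
    unfolding ntrace_nc_mult by (subst sum.swap) (simp add: mult.commute cong: sum.cong)
qed

lemma sum_swap3:
  "(\<Sum>v\<in>K. \<Sum>i\<in>I. \<Sum>j\<in>J. g v i j) = (\<Sum>i\<in>I. \<Sum>j\<in>J. \<Sum>v\<in>K. g v i j)"
proof -
  have "(\<Sum>v\<in>K. \<Sum>i\<in>I. \<Sum>j\<in>J. g v i j) = (\<Sum>i\<in>I. \<Sum>v\<in>K. \<Sum>j\<in>J. g v i j)" by (rule sum.swap)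
  also have "\<dots> = (\<Sum>i\<in>I. \<Sum>j\<in>J. \<Sum>v\<in>K. g v i j)" by (intro sum.cong refl sum.swap)
  finally show ?thesis .
qed

lemma sum_swap4:
  "(\<Sum>u\<in>U. \<Sum>v\<in>V. \<Sum>i\<in>I. \<Sum>j\<in>J. f u v i j) = (\<Sum>i\<in>I. \<Sum>j\<in>J. \<Sum>u\<in>U. \<Sum>v\<in>V. f u v i j)"
proof -
  have "(\<Sum>u\<in>U. \<Sum>v\<in>V. \<Sum>i\<in>I. \<Sum>j\<in>J. f u v i j) = (\<Sum>u\<in>U. \<Sum>i\<in>I. \<Sum>j\<in>J. \<Sum>v\<in>V. f u v i j)"
    by (intro sum.cong refl sum_swap3)
  also have "\<dots> = (\<Sum>i\<in>I. \<Sum>j\<in>J. \<Sum>u\<in>U. \<Sum>v\<in>V. f u v i j)" by (rule sum_swap3)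
  finally show ?thesis .
qed

text \<open>The trace is the sum of the squared moduli of the entries of the evaluated polynomial, divided by \<open>k\<close>.\<close>

lemma ntrace_nc_star_mult:
  assumes p: "p \<in> ncpolys V" and A: "\<And>i. i \<in> V \<Longrightarrow> A i \<in> sa_mats k"
  shows "ntrace k (mat_nc_eval k A (nc_star p * p)) \<in> \<real>\<^sub>\<ge>\<^sub>0"
proof -
  define W where "W w i j = mat_word k A (letters w) $$ (i, j)" for w i j
  have mem: "A i \<in> sa_mats k" if "w \<in> Poly_Mapping.keys p" "i \<in> set (letters w)" for w i
    using p A that by (auto simp: ncpolys_def)
  have mem': "A i \<in> carrier_mat k k" if "w \<in> Poly_Mapping.keys p" "i \<in> set (letters w)" for w i
    using mem[OF that] by (rule sa_mats_carrier)
  have tr: "ntrace k (mat_word k A (rev (letters u) @ letters v)) = (\<Sum>i<k. \<Sum>j<k. cnj (W u j i) * W v j i) / of_nat k"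
    if uv: "u \<in> Poly_Mapping.keys p" "v \<in> Poly_Mapping.keys p" for u v
  proof -
    have e: "mat_word k A (rev (letters u) @ letters v) = mat_word k A (rev (letters u)) * mat_word k A (letters v)"
      using mem'[OF uv(1)] mem'[OF uv(2)] by (intro mat_word_append) auto
    have c: "mat_word k A (rev (letters u)) \<in> carrier_mat k k" "mat_word k A (letters v) \<in> carrier_mat k k"
      using mem'[OF uv(1)] mem'[OF uv(2)] by (intro mat_word_carrier; auto)+
    have "(mat_word k A (rev (letters u)) * mat_word k A (letters v)) $$ (i, i) = (\<Sum>j<k. cnj (W u j i) * W v j i)"
      if "i < k" for i
      unfolding mat_mult_index[OF c that that] W_def
      using mat_word_rev_index[of "letters u" A k i] mem[OF uv(1)] that by (intro sum.cong) auto
    then show ?thesis unfolding e ntrace_def by simp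
  qed
  have "ntrace k (mat_nc_eval k A (nc_star p * p)) =
    (\<Sum>u\<in>Poly_Mapping.keys p. \<Sum>v\<in>Poly_Mapping.keys p. cnj (Poly_Mapping.lookup p u) * Poly_Mapping.lookup p v
        * ntrace k (mat_word k A (rev (letters u) @ letters v)))"
  proof -
    have "nc_star p * p = (\<Sum>u\<in>Poly_Mapping.keys p. Poly_Mapping.single (Word (rev (letters u))) (cnj (Poly_Mapping.lookup p u)))
        * (\<Sum>v\<in>Poly_Mapping.keys p. Poly_Mapping.single v (Poly_Mapping.lookup p v))"
      using poly_mapping_sum_singles[of p] by (simp add: nc_star_def)
    also have "\<dots> = (\<Sum>u\<in>Poly_Mapping.keys p. \<Sum>v\<in>Poly_Mapping.keys p.
       Poly_Mapping.single (Word (rev (letters u)) + v) (cnj (Poly_Mapping.lookup p u) * Poly_Mapping.lookup p v))"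
      by (simp add: sum_product mult_single)
    finally have e: "nc_star p * p = \<dots>" .
    show ?thesis unfolding e ntrace_mat_nc_eval
      by (subst nc_sum_sum, simp, simp add: algebra_simps)+ (simp add: nc_sum_single)
  qed
  also have "\<dots> = (\<Sum>u\<in>Poly_Mapping.keys p. \<Sum>v\<in>Poly_Mapping.keys p. \<Sum>i<k. \<Sum>j<k.
      cnj (Poly_Mapping.lookup p u * W u j i) * (Poly_Mapping.lookup p v * W v j i)) / of_nat k"
    by (simp add: tr sum_distrib_left sum_divide_distrib algebra_simps cong: sum.cong)
  also have "\<dots> = (\<Sum>i<k. \<Sum>j<k. cnj (\<Sum>u\<in>Poly_Mapping.keys p. Poly_Mapping.lookup p u * W u j i)
       * (\<Sum>v\<in>Poly_Mapping.keys p. Poly_Mapping.lookup p v * W v j i)) / of_nat k"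
    by (simp only: cnj_sum sum_product, subst sum_swap4, rule refl)
  also have "\<dots> = of_real ((\<Sum>i<k. \<Sum>j<k. (cmod (\<Sum>u\<in>Poly_Mapping.keys p. Poly_Mapping.lookup p u * W u j i))\<^sup>2) / real k)"
  proof -
    have e: "cnj z * z = of_real ((cmod z)\<^sup>2)" for z by (metis complex_norm_square mult.commute)
    show ?thesis by (simp only: e of_real_divide of_real_sum of_real_of_nat_eq)
  qed
  finally show ?thesis by (simp only: nonneg_Reals_of_real_iff) (intro divide_nonneg_nonneg sum_nonneg, auto)
qed

text \<open>A diagonal argument gives a subsequence along which the traces of all rational polynomials
  converge. Traces are bounded by operator norms, and these approach the norms in the C*-algebra, so the limit
  is a contraction with respect to the norm of the value and extends to the whole algebra. The trace property,
  positivity and the value at one pass to the limit.\<close>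

theorem tracial_limit:
  fixes x :: "nat \<Rightarrow> 'a::cstar_algebra_1" and A :: "nat \<Rightarrow> nat \<Rightarrow> complex mat"
  assumes sa: "\<And>i. i < n \<Longrightarrow> selfadjoint (x i)" and gen: "cstar_subalgebra hull (x ` {..<n}) = UNIV"
    and P: "range P = rat_ncpolys n"
    and k: "\<And>j. k j \<ge> 1" and A: "\<And>j. A j \<in> sa_tuples n (k j)"
    and close: "\<And>i j. i < j \<Longrightarrow>
       \<bar>opnorm (mat_nc_eval (k j) (A j) (P i)) - norm (nc_eval x (P i))\<bar> \<le> 1 / real (Suc j)"
  shows "\<exists>s \<tau>. strict_mono s \<and> \<tau> \<in> tracial_states \<and>
    (\<forall>w. set w \<subseteq> {..<n} \<longrightarrow>
      (\<lambda>j. ntrace (k (s j)) (mat_word (k (s j)) (A (s j)) w)) \<longlonglongrightarrow> \<tau> (prod_list (map x w)))"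
proof -
  define T where "T j p = ntrace (k j) (mat_nc_eval (k j) (A j) p)" for j p
  have Asa: "A j i \<in> sa_mats (k j)" if "i < n" for i j
    using A[of j] that by (auto simp: sa_tuples_def)
  have T_le: "cmod (T j p) \<le> opnorm (mat_nc_eval (k j) (A j) p)" for j p
    unfolding T_def by (rule ntrace_le_opnorm) (simp add: mat_nc_eval_def)
  have T_bound: "cmod (T j (P i)) \<le> norm (nc_eval x (P i)) + 1 / real (Suc j)" if "i < j" for i j
    using T_le[of j "P i"] close[OF that] by linarith
  define C where "C i = cball (0::complex) (norm (nc_eval x (P i)) + 1)" for i
  \<comment> \<open>Only finitely many polynomials are controlled at stage \<open>j\<close>; the value zero elsewhere keeps the
  sequence in a compact product of discs.\<close>
  define f where "f j i = (if i < j then T j (P i) else 0)" for j i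
  have "f j \<in> PiE UNIV C" for j
  proof -
    have 1: "1 / real (Suc j) \<le> 1" by simp
    have "cmod (f j i) \<le> norm (nc_eval x (P i)) + 1" for i
    proof (cases "i < j")
      case True
      then show ?thesis using order_trans[OF T_bound[OF True] add_left_mono[OF 1]] unfolding f_def by simp
    qed (simp add: f_def)
    then show ?thesis by (simp add: C_def PiE_iff)
  qed
  moreover have "compact (PiE UNIV C)"
  proof -
    have "compactin (product_topology (\<lambda>i. euclidean) UNIV) (PiE UNIV C)"
      unfolding compactin_PiE by (simp add: C_def)
    then show ?thesis by (simp add: euclidean_product_topology)
  qed
  ultimately obtain l s where s: "strict_mono (s :: nat \<Rightarrow> nat)" and l: "(f \<circ> s) \<longlonglongrightarrow> l"
    unfolding compact_eq_seq_compact_metric seq_compact_def by metis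
  have fl: "(\<lambda>j. f (s j) i) \<longlonglongrightarrow> l i" for i
  proof -
    have "continuous_on UNIV (\<lambda>g. g i :: complex)" by simp
    from continuous_on_tendsto_compose[OF this l] show ?thesis by (simp add: comp_def)
  qed
  have ev_s: "\<forall>\<^sub>F j in sequentially. i < s j" for i
    by (rule eventually_compose_filterlim[OF eventually_gt_at_top filterlim_subseq[OF s]])
  have Tl: "(\<lambda>j. T (s j) (P i)) \<longlonglongrightarrow> l i" for i
  proof (rule Lim_transform_eventually[OF fl])
    show "\<forall>\<^sub>F j in sequentially. f (s j) i = T (s j) (P i)"
      using ev_s[of i] by eventually_elim (simp add: f_def)
  qed
  define Q where "Q = rat_ncpolys n"
  \<comment> \<open>The enumeration need not be injective; the limit is the same for every index.\<close>
  define L where "L p = l (SOME i. P i = p)" for p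
  have L: "(\<lambda>j. T (s j) p) \<longlonglongrightarrow> L p" if "p \<in> Q" for p
  proof -
    have "P (SOME i. P i = p) = p" using that P unfolding Q_def by (metis (mono_tags) imageE someI_ex)
    then show ?thesis using Tl[of "SOME i. P i = p"] by (simp add: L_def)
  qed
  have L_bound: "cmod (L p) \<le> norm (nc_eval x p)" if "p \<in> Q" for p
  proof -
    have "p \<in> range P" using that by (simp add: Q_def P)
    then obtain i where i: "p = P i" by blast
    have "(\<lambda>j. 1 / real (Suc (s j))) \<longlonglongrightarrow> 0"
      using LIMSEQ_subseq_LIMSEQ[OF LIMSEQ_Suc[OF lim_1_over_n] s] by (simp add: comp_def)
    then have lim: "(\<lambda>j. norm (nc_eval x p) + 1 / real (Suc (s j))) \<longlonglongrightarrow> norm (nc_eval x p) + 0"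
      by (intro tendsto_intros)
    have ev: "\<forall>\<^sub>F j in sequentially. cmod (T (s j) p) \<le> norm (nc_eval x p) + 1 / real (Suc (s j))"
      using ev_s[of i] by eventually_elim (use T_bound i in simp)
    have "cmod (L p) \<le> norm (nc_eval x p) + 0"
      by (rule tendsto_le[OF sequentially_bot lim tendsto_norm[OF L[OF that]] ev])
    then show ?thesis by simp
  qed
  have L_add: "L (p + q) = L p + L q" if "p \<in> Q" "q \<in> Q" for p q
  proof (rule LIMSEQ_unique[OF L])
    show "(\<lambda>j. T (s j) (p + q)) \<longlonglongrightarrow> L p + L q"
      using tendsto_add[OF L[OF that(1)] L[OF that(2)]] by (simp add: T_def ntrace_nc_add)
  qed (use that in \<open>simp add: Q_def rat_ncpolys_add\<close>)
  have L_diff: "L (p - q) = L p - L q" if "p \<in> Q" "q \<in> Q" for p q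
    using L_add[of "p - q" q] that by (simp add: Q_def rat_ncpolys_diff)
  have L_scale: "L (nc_const c * p) = c * L p" if "p \<in> Q" "rat_complex c" for c p
  proof (rule LIMSEQ_unique[OF L])
    show "(\<lambda>j. T (s j) (nc_const c * p)) \<longlonglongrightarrow> c * L p"
      using tendsto_mult_left[OF L[OF that(1)], of c] by (simp add: T_def ntrace_nc_const_mult)
  qed (use that in \<open>simp add: Q_def rat_ncpolys_mult rat_ncpolys_const\<close>)
  have L_comm: "L (p * q) = L (q * p)" if "p \<in> Q" "q \<in> Q" for p q
  proof (rule LIMSEQ_unique[OF L])
    have "T (s j) (p * q) = T (s j) (q * p)" for j
      unfolding T_def using that by (intro ntrace_nc_commute[of _ "{..<n}"]) (auto simp: Q_def rat_ncpolys_iff intro!: sa_mats_carrier Asa)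
    then show "(\<lambda>j. T (s j) (p * q)) \<longlonglongrightarrow> L (q * p)"
      using L[of "q * p"] that by (simp add: Q_def rat_ncpolys_mult)
  qed (use that in \<open>simp add: Q_def rat_ncpolys_mult\<close>)
  have L_pos: "L (nc_star p * p) \<in> \<real>\<^sub>\<ge>\<^sub>0" if "p \<in> Q" for p
  proof (rule closed_sequentially[OF closed_nonneg_Reals_complex])
    show "(\<lambda>j. T (s j) (nc_star p * p)) \<longlonglongrightarrow> L (nc_star p * p)"
      using that by (intro L) (simp add: Q_def rat_ncpolys_mult rat_ncpolys_star)
    show "T (s j) (nc_star p * p) \<in> \<real>\<^sub>\<ge>\<^sub>0" for j
      unfolding T_def using that by (intro ntrace_nc_star_mult[of _ "{..<n}"]) (auto simp: Q_def rat_ncpolys_iff intro!: Asa)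
  qed
  have L_word: "(\<lambda>j. ntrace (k (s j)) (mat_word (k (s j)) (A (s j)) w)) \<longlonglongrightarrow> L (Poly_Mapping.single (Word w) 1)"
    if "set w \<subseteq> {..<n}" for w
    using L[of "Poly_Mapping.single (Word w) 1"] that
    by (simp add: Q_def rat_ncpolys_single rat_complex_closed T_def ntrace_nc_single)
  have L_one: "L (nc_const 1) = 1"
  proof (rule LIMSEQ_unique[OF L])
    have "T (s j) (nc_const 1) = 1" for j
      unfolding T_def nc_const_def ntrace_nc_single using k[of "s j"] by (simp add: ntrace_def)
    then show "(\<lambda>j. T (s j) (nc_const 1)) \<longlonglongrightarrow> 1" by simp
  qed (simp add: Q_def rat_ncpolys_const rat_complex_closed)
  have dense: "\<exists>p. (\<forall>i. p i \<in> Q) \<and> (\<lambda>i. nc_eval x (p i)) \<longlonglongrightarrow> a" for a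
    unfolding Q_def by (rule rat_polys_dense[OF sa gen])
  have "\<exists>\<tau>. \<forall>a p. (\<forall>i::nat. p i \<in> Q) \<longrightarrow> (\<lambda>i. nc_eval x (p i)) \<longlonglongrightarrow> a \<longrightarrow> (\<lambda>i. L (p i)) \<longlonglongrightarrow> \<tau> a"
  proof (rule lipschitz_functional_extend[OF _ dense])
    fix p q assume "p \<in> Q" "q \<in> Q"
    then show "cmod (L p - L q) \<le> norm (nc_eval x p - nc_eval x q)"
      using L_bound[of "p - q"] by (simp add: L_diff nc_eval_diff) (simp add: Q_def rat_ncpolys_diff)
  qed
  then obtain \<tau> where \<tau>: "\<And>a p. (\<forall>i::nat. p i \<in> Q) \<Longrightarrow> (\<lambda>i. nc_eval x (p i)) \<longlonglongrightarrow> a \<Longrightarrow> (\<lambda>i. L (p i)) \<longlonglongrightarrow> \<tau> a"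
    by blast
  have \<tau>_Q: "\<tau> (nc_eval x p) = L p" if "p \<in> Q" for p
    using \<tau>[of "\<lambda>_. p" "nc_eval x p"] that LIMSEQ_unique[OF tendsto_const] by force
  have tr: "\<tau> \<in> tracial_states"
    unfolding tracial_states_def
  proof (intro CollectI conjI allI)
    fix a b c
    obtain p where p: "\<forall>i. p i \<in> Q" "(\<lambda>i. nc_eval x (p i)) \<longlonglongrightarrow> a" using dense by blast
    obtain q where q: "\<forall>i. q i \<in> Q" "(\<lambda>i. nc_eval x (q i)) \<longlonglongrightarrow> b" using dense by blast
    obtain d where d: "\<forall>i. rat_complex (d i)" "d \<longlonglongrightarrow> c" using rat_complex_seq by blast
    note Lp = \<tau>[OF p] and Lq = \<tau>[OF q]
    have "(\<lambda>i. L (p i + q i)) \<longlonglongrightarrow> \<tau> (a + b)"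
      using p q by (intro \<tau>) (simp_all add: Q_def rat_ncpolys_add nc_eval_add tendsto_add)
    moreover have "(\<lambda>i. L (p i + q i)) \<longlonglongrightarrow> \<tau> a + \<tau> b"
      using tendsto_add[OF Lp Lq] p q by (simp add: L_add)
    ultimately show "\<tau> (a + b) = \<tau> a + \<tau> b" by (rule LIMSEQ_unique)
    have "(\<lambda>i. L (nc_const (d i) * p i)) \<longlonglongrightarrow> \<tau> (c *\<^sub>C a)"
      using p d by (intro \<tau>) (simp_all add: Q_def rat_ncpolys_mult rat_ncpolys_const nc_eval_mult nc_eval_const scaleC_mult_left tendsto_scaleC)
    moreover have "(\<lambda>i. L (nc_const (d i) * p i)) \<longlonglongrightarrow> c * \<tau> a"
      using tendsto_mult[OF d(2) Lp] p d by (simp add: L_scale)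
    ultimately show "\<tau> (c *\<^sub>C a) = c * \<tau> a" by (rule LIMSEQ_unique)
    have "(\<lambda>i. L (p i * q i)) \<longlonglongrightarrow> \<tau> (a * b)"
      using p q by (intro \<tau>) (simp_all add: Q_def rat_ncpolys_mult nc_eval_mult tendsto_mult)
    moreover have "(\<lambda>i. L (q i * p i)) \<longlonglongrightarrow> \<tau> (b * a)"
      using p q by (intro \<tau>) (simp_all add: Q_def rat_ncpolys_mult nc_eval_mult tendsto_mult)
    then have "(\<lambda>i. L (p i * q i)) \<longlonglongrightarrow> \<tau> (b * a)" using L_comm p q by simp
    ultimately show "\<tau> (a * b) = \<tau> (b * a)" by (rule LIMSEQ_unique)
    have "nc_eval x (nc_star (p i)) = star (nc_eval x (p i))" for i
      using p(1) sa by (intro nc_eval_star[of _ "{..<n}"]) (auto simp: selfadjoint_def Q_def rat_ncpolys_iff)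
    then have "(\<lambda>i. L (nc_star (p i) * p i)) \<longlonglongrightarrow> \<tau> (star a * a)"
      using p by (intro \<tau>) (simp_all add: Q_def rat_ncpolys_mult rat_ncpolys_star nc_eval_mult tendsto_mult tendsto_star)
    then show "\<tau> (star a * a) \<in> \<real>\<^sub>\<ge>\<^sub>0"
      by (rule closed_sequentially[OF closed_nonneg_Reals_complex, rotated]) (use L_pos p in blast)
    show "\<tau> 1 = 1"
      using \<tau>_Q[of "nc_const 1"] L_one by (simp add: Q_def rat_ncpolys_const rat_complex_closed nc_eval_const scaleC_one)
  qed
  have Lw: "L (Poly_Mapping.single (Word w) 1) = \<tau> (prod_list (map x w))" if "set w \<subseteq> {..<n}" for w
    using \<tau>_Q[of "Poly_Mapping.single (Word w) 1"] that
    by (simp add: Q_def rat_ncpolys_single rat_complex_closed nc_eval_single scaleC_one)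
  show ?thesis using s tr L_word Lw by (intro exI[of _ s] exI[of _ \<tau>] conjI allI impI) simp_all
qed

section \<open>Gaussian integration by parts\<close>

definition gauss1 :: "real \<Rightarrow> real measure" where
  "gauss1 \<sigma> = density lborel (normal_density 0 \<sigma>)"

definition gauss :: "real \<Rightarrow> 'i set \<Rightarrow> ('i \<Rightarrow> real) measure" where
  "gauss \<sigma> I = PiM I (\<lambda>_. gauss1 \<sigma>)"

lemma prob_space_gauss1: "\<sigma> > 0 \<Longrightarrow> prob_space (gauss1 \<sigma>)"
  unfolding gauss1_def by (rule prob_space_normal_density)

lemma sets_gauss1 [measurable_cong, simp]: "sets (gauss1 \<sigma>) = sets borel"
  by (simp add: gauss1_def)

lemma prob_space_gauss: "\<sigma> > 0 \<Longrightarrow> prob_space (gauss \<sigma> I)"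
  unfolding gauss_def by (intro prob_space_PiM prob_space_gauss1)

lemma gauss1_integrable_power: "\<sigma> > 0 \<Longrightarrow> integrable (gauss1 \<sigma>) (\<lambda>x. x ^ p)"
  using integrable_normal_moment[of \<sigma> 0 p]
  unfolding gauss1_def by (subst integrable_density) (auto simp: normal_density_nonneg)

definition gauss_moment :: "real \<Rightarrow> nat \<Rightarrow> real" where
  "gauss_moment \<sigma> p = integral\<^sup>L (gauss1 \<sigma>) (\<lambda>x. x ^ p)"

lemma gauss_moment_eq: "\<sigma> > 0 \<Longrightarrow> gauss_moment \<sigma> p = (\<integral>x. normal_density 0 \<sigma> x * x ^ p \<partial>lborel)"
  unfolding gauss_moment_def gauss1_def by (subst integral_density) (auto simp: normal_density_nonneg)

lemma gauss_moment_Suc: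
  assumes \<sigma>: "\<sigma> > 0"
  shows "gauss_moment \<sigma> (Suc p) = \<sigma>\<^sup>2 * real p * gauss_moment \<sigma> (p - 1)"
proof -
  have ev: "gauss_moment \<sigma> (2 * j) = fact (2 * j) / ((2 / \<sigma>\<^sup>2) ^ j * fact j)" for j
    using integral_normal_moment_even[OF \<sigma>, of 0 j] by (simp add: gauss_moment_eq[OF \<sigma>])
  have od: "gauss_moment \<sigma> (2 * j + 1) = 0" for j
    using integral_normal_moment_odd[OF \<sigma>, of 0 j] by (simp add: gauss_moment_eq[OF \<sigma>])
  show ?thesis
  proof (cases "even p")
    case True
    show ?thesis
    proof (cases p)
      case 0
      then show ?thesis using od[of 0] by simp
    next
      case (Suc m)
      then have "odd m" using True by simp
      then obtain j where "m = 2 * j + 1" by (auto elim: oddE)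
      then show ?thesis using od[of "Suc j"] od[of j] Suc by simp
    qed
  next
    case False
    then obtain j where j: "p = 2 * j + 1" by (auto elim: oddE)
    have "fact (2 * Suc j) / ((2 / \<sigma>\<^sup>2) ^ Suc j * fact (Suc j)) = \<sigma>\<^sup>2 * (2 * real j + 1) * (fact (2 * j) / ((2 / \<sigma>\<^sup>2) ^ j * fact j))"
      using \<sigma> by (simp add: field_simps del: of_nat_Suc fact_Suc) (simp add: algebra_simps)
    then show ?thesis using ev[of "Suc j"] ev[of j] j by simp
  qed
qed

definition monomial :: "'i set \<Rightarrow> ('i \<Rightarrow> nat) \<Rightarrow> ('i \<Rightarrow> real) \<Rightarrow> complex" where
  "monomial I p c = complex_of_real (\<Prod>i\<in>I. c i ^ p i)"

lemma monomial_integrable: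
  assumes "\<sigma> > 0" "finite I"
  shows "integrable (gauss \<sigma> I) (monomial I p)"
    "integral\<^sup>L (gauss \<sigma> I) (monomial I p) = complex_of_real (\<Prod>i\<in>I. gauss_moment \<sigma> (p i))"
proof -
  interpret prob_space "gauss1 \<sigma>" by (rule prob_space_gauss1) fact
  interpret product_sigma_finite "\<lambda>_. gauss1 \<sigma>" ..
  have i: "integrable (gauss \<sigma> I) (\<lambda>c. \<Prod>i\<in>I. c i ^ p i)"
    unfolding gauss_def using assms by (intro product_integrable_prod gauss1_integrable_power)
  have eq: "(\<integral>c. (\<Prod>i\<in>I. c i ^ p i) \<partial>gauss \<sigma> I) = (\<Prod>i\<in>I. gauss_moment \<sigma> (p i))"
    unfolding gauss_def gauss_moment_def
    using assms by (intro product_integral_prod gauss1_integrable_power)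
  show "integrable (gauss \<sigma> I) (monomial I p)"
    unfolding monomial_def[abs_def] by (rule integrable_of_real[OF i])
  show "integral\<^sup>L (gauss \<sigma> I) (monomial I p) = complex_of_real (\<Prod>i\<in>I. gauss_moment \<sigma> (p i))"
    unfolding monomial_def[abs_def] integral_complex_of_real eq ..
qed

text \<open>The functions \<open>F\<close> generated here are the polynomials in the coordinates from \<open>I\<close>, and \<open>D e\<close> is the
  formal partial derivative of \<open>F\<close> in the direction \<open>e\<close>. The inductive definition gives integration by parts for
  polynomials by induction, without any analysis of growth and decay.\<close>

inductive gdiff :: "'i set \<Rightarrow> (('i \<Rightarrow> real) \<Rightarrow> complex) \<Rightarrow> ('i \<Rightarrow> ('i \<Rightarrow> real) \<Rightarrow> complex) \<Rightarrow> bool"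
  for I where
  const: "gdiff I (\<lambda>_. z) (\<lambda>_ _. 0)"
| add: "gdiff I F D \<Longrightarrow> gdiff I G D' \<Longrightarrow> gdiff I (\<lambda>c. F c + G c) (\<lambda>e c. D e c + D' e c)"
| coord: "i \<in> I \<Longrightarrow> gdiff I F D \<Longrightarrow>
    gdiff I (\<lambda>c. of_real (c i) * F c) (\<lambda>e c. (if e = i then F c else 0) + of_real (c i) * D e c)"

lemma monomial_upd:
  assumes "finite I" "i \<in> I"
  shows "of_real (c i) * monomial I p c = monomial I (p(i := Suc (p i))) c"
  using assms by (simp add: monomial_def prod.remove mult.assoc flip: of_real_mult)

lemma gdiff_integrable:
  assumes "\<sigma> > 0" "finite I" "gdiff I F D"
  shows "integrable (gauss \<sigma> I) (\<lambda>c. monomial I p c * F c)" "integrable (gauss \<sigma> I) (\<lambda>c. monomial I p c * D e c)"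
proof -
  from assms(3) have "\<forall>p. integrable (gauss \<sigma> I) (\<lambda>c. monomial I p c * F c) \<and> (\<forall>e. integrable (gauss \<sigma> I) (\<lambda>c. monomial I p c * D e c))"
  proof induction
    case (const z)
    then show ?case using monomial_integrable(1)[OF assms(1,2)] by auto
  next
    case (add F D G D')
    then show ?case by (auto simp: distrib_left)
  next
    case (coord i F D)
    have e: "monomial I p c * (of_real (c i) * X) = monomial I (p(i := Suc (p i))) c * X" for p c X
      using monomial_upd[OF assms(2) coord(1), of c p] by (simp flip: mult.assoc) (simp add: mult.commute)
    show ?case
    proof (intro allI conjI)
      fix p e'
      show "integrable (gauss \<sigma> I) (\<lambda>c. monomial I p c * (of_real (c i) * F c))"
        unfolding e using coord by blast
      have "integrable (gauss \<sigma> I) (\<lambda>c. monomial I p c * (if e' = i then F c else 0))"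
        using coord.IH by (cases "e' = i") auto
      moreover have "integrable (gauss \<sigma> I) (\<lambda>c. monomial I p c * (of_real (c i) * D e' c))"
        unfolding e using coord by blast
      ultimately show "integrable (gauss \<sigma> I) (\<lambda>c. monomial I p c * ((if e' = i then F c else 0) + of_real (c i) * D e' c))"
        unfolding distrib_left by (rule Bochner_Integration.integrable_add)
    qed
  qed
  then show "integrable (gauss \<sigma> I) (\<lambda>c. monomial I p c * F c)" "integrable (gauss \<sigma> I) (\<lambda>c. monomial I p c * D e c)" by auto
qed

text \<open>Integration by parts against the weight \<open>monomial I p\<close>. The weight is there for the induction: the
  case of a product with a coordinate moves this coordinate into the weight, and the base case is the moment
  recursion of the normal distribution.\<close>

lemma gauss_stein_monomial:
  assumes \<sigma>: "\<sigma> > 0" and I: "finite I" and e: "e \<in> I" and d: "gdiff I F D"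
  shows "(\<integral>c. monomial I (p(e := Suc (p e))) c * F c \<partial>gauss \<sigma> I) =
    of_real (\<sigma>\<^sup>2) * (of_nat (p e) * (\<integral>c. monomial I (p(e := p e - 1)) c * F c \<partial>gauss \<sigma> I)
       + (\<integral>c. monomial I p c * D e c \<partial>gauss \<sigma> I))"
  using d
proof (induction arbitrary: p)
  case (const z)
  have "(\<Prod>i\<in>I. gauss_moment \<sigma> ((p(e := Suc (p e))) i)) = \<sigma>\<^sup>2 * real (p e) * (\<Prod>i\<in>I. gauss_moment \<sigma> ((p(e := p e - 1)) i))"
  proof -
    have "(\<Prod>i\<in>I. gauss_moment \<sigma> ((p(e := q)) i)) = gauss_moment \<sigma> q * (\<Prod>i\<in>I - {e}. gauss_moment \<sigma> (p i))" for q
      by (simp add: prod.remove[OF I e])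
    then show ?thesis using gauss_moment_Suc[OF \<sigma>, of "p e"] by simp
  qed
  then have "(\<integral>c. monomial I (p(e := Suc (p e))) c \<partial>gauss \<sigma> I)
     = of_real (\<sigma>\<^sup>2) * of_nat (p e) * (\<integral>c. monomial I (p(e := p e - 1)) c \<partial>gauss \<sigma> I)"
    by (simp only: monomial_integrable[OF \<sigma> I]) simp
  moreover have "(\<integral>c. monomial I q c * z \<partial>gauss \<sigma> I) = (\<integral>c. monomial I q c \<partial>gauss \<sigma> I) * z" for q by simp
  ultimately show ?case by (simp only: mult_zero_right integral_zero add_0_right mult.assoc)
next
  case (add F D G D')
  note int = gdiff_integrable[OF \<sigma> I]
  show ?case
    using add by (simp add: distrib_left int(1)[OF add(1)] int(1)[OF add(2)] int(2)[OF add(1)] int(2)[OF add(2)])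

next
  \<comment> \<open>The factor \<open>c i\<close> is absorbed by the weight; for \<open>e = i\<close> this changes the exponent that the
  integration by parts differentiates.\<close>
  case (coord i F D)
  note int = gdiff_integrable[OF \<sigma> I coord(2)]
  have m: "monomial I p c * (of_real (c i) * X) = monomial I (p(i := Suc (p i))) c * X" for p c X
    using monomial_upd[OF I coord(1), of c p] by (simp flip: mult.assoc) (simp add: mult.commute)
  let ?E = "\<lambda>f. integral\<^sup>L (gauss \<sigma> I) f"
  show ?case
  proof (cases "e = i")
    case False
    define q where "q = p(i := Suc (p i))"
    have 1: "monomial I (p(e := a)) c * (of_real (c i) * X) = monomial I (q(e := a)) c * X" for a c X
    proof -
      have "(p(e := a))(i := Suc ((p(e := a)) i)) = q(e := a)" using False by (auto simp: q_def)
      then show ?thesis by (simp only: m)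
    qed
    have 2: "monomial I p c * (of_real (c i) * X) = monomial I q c * X" for c X by (simp only: m q_def)
    have 3: "p e = q e" using False by (simp add: q_def)
    show ?thesis unfolding 3 1 using coord.IH[of q] False by (simp only: 2 if_False add_0_left)
  next
    case True
    define q where "q = p(i := Suc (p i))"
    have 1: "?E (\<lambda>c. monomial I (p(e := Suc (p e))) c * (of_real (c i) * F c)) = ?E (\<lambda>c. monomial I (q(e := Suc (q e))) c * F c)"
      unfolding m using True by (simp add: q_def)
    have 2: "of_nat (p e) * ?E (\<lambda>c. monomial I (p(e := p e - 1)) c * (of_real (c i) * F c)) = of_nat (p e) * ?E (\<lambda>c. monomial I p c * F c)"
      unfolding m using True by (cases "p e") (auto simp: fun_upd_idem)
    have 3: "?E (\<lambda>c. monomial I p c * ((if e = i then F c else 0) + of_real (c i) * D e c)) = ?E (\<lambda>c. monomial I p c * F c) + ?E (\<lambda>c. monomial I q c * D e c)"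
      unfolding distrib_left m using True int by (simp add: q_def)
    have 4: "q e = Suc (p e)" using True by (simp add: q_def)
    have 5: "q(e := p e) = p" using True by (auto simp: q_def)
    show ?thesis unfolding 1 2 3 unfolding coord.IH[of q] unfolding 4 diff_Suc_1 5 by (simp add: algebra_simps)
  qed
qed

lemma gauss_stein:
  assumes \<sigma>: "\<sigma> > 0" and I: "finite I" and e: "e \<in> I" and d: "gdiff I F D"
  shows "integrable (gauss \<sigma> I) F" "integrable (gauss \<sigma> I) (D e)" "integrable (gauss \<sigma> I) (\<lambda>c. of_real (c e) * F c)"
    "(\<integral>c. of_real (c e) * F c \<partial>gauss \<sigma> I) = of_real (\<sigma>\<^sup>2) * (\<integral>c. D e c \<partial>gauss \<sigma> I)"
proof -
  have m0: "monomial I (\<lambda>_. 0) c = 1" for c by (simp add: monomial_def)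
  have m1: "monomial I ((\<lambda>_. 0)(e := Suc 0)) c = of_real (c e)" for c
    using monomial_upd[OF I e, of c "\<lambda>_. 0"] by (simp add: m0)
  show "integrable (gauss \<sigma> I) F" "integrable (gauss \<sigma> I) (D e)"
    using gdiff_integrable[OF \<sigma> I d, of "\<lambda>_. 0"] by (simp_all add: m0)
  show "integrable (gauss \<sigma> I) (\<lambda>c. of_real (c e) * F c)"
    using gdiff_integrable(1)[OF \<sigma> I d, of "(\<lambda>_. 0)(e := Suc 0)"] by (simp add: m1)
  show "(\<integral>c. of_real (c e) * F c \<partial>gauss \<sigma> I) = of_real (\<sigma>\<^sup>2) * (\<integral>c. D e c \<partial>gauss \<sigma> I)"
    using gauss_stein_monomial[OF \<sigma> I e d, of "\<lambda>_. 0"] by (simp add: m0 m1)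
qed

lemma gdiff_scale: "gdiff I F D \<Longrightarrow> gdiff I (\<lambda>c. z * F c) (\<lambda>e c. z * D e c)"
proof (induction rule: gdiff.induct)
  case (const w)
  then show ?case using gdiff.const[of I "z * w"] by simp
next
  case (add F D G D')
  then show ?case using gdiff.add[OF add.IH] by (simp add: distrib_left)
next
  case (coord i F D)
  have "(\<lambda>e c. (if e = i then z * F c else 0) + of_real (c i) * (z * D e c)) = (\<lambda>e c. z * ((if e = i then F c else 0) + of_real (c i) * D e c))"
    by (auto simp: fun_eq_iff algebra_simps)
  then show ?case using gdiff.coord[OF coord(1) coord.IH] by (simp add: mult.left_commute)
qed

lemma gdiff_mult:
  assumes "gdiff I F D" "gdiff I G D'"
  shows "gdiff I (\<lambda>c. F c * G c) (\<lambda>e c. D e c * G c + F c * D' e c)"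
  using assms(1)
proof induction
  case (const z)
  then show ?case using gdiff_scale[OF assms(2), of z] by simp
next
  case (add F D H D'')
  have "(\<lambda>e c. (D e c * G c + F c * D' e c) + (D'' e c * G c + H c * D' e c)) = (\<lambda>e c. (D e c + D'' e c) * G c + (F c + H c) * D' e c)"
    by (auto simp: fun_eq_iff algebra_simps)
  then show ?case using gdiff.add[OF add.IH] by (simp add: distrib_right)
next
  case (coord i F D)
  have "(\<lambda>e c. (if e = i then F c * G c else 0) + of_real (c i) * (D e c * G c + F c * D' e c))
      = (\<lambda>e c. ((if e = i then F c else 0) + of_real (c i) * D e c) * G c + of_real (c i) * F c * D' e c)"
    by (auto simp: fun_eq_iff algebra_simps)
  then show ?case using gdiff.coord[OF coord(1) coord.IH] by (simp add: mult.assoc)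
qed

lemma gdiff_coord: "i \<in> I \<Longrightarrow> gdiff I (\<lambda>c. of_real (c i)) (\<lambda>e c. if e = i then 1 else 0)"
  using gdiff.coord[OF _ gdiff.const[of I 1], of i] by simp

lemma gdiff_sum: "(\<And>i. i \<in> J \<Longrightarrow> gdiff I (F i) (D i)) \<Longrightarrow> gdiff I (\<lambda>c. \<Sum>i\<in>J. F i c) (\<lambda>e c. \<Sum>i\<in>J. D i e c)"
proof (induction J rule: infinite_finite_induct)
  case (insert i J)
  then show ?case using gdiff.add[of I "F i" "D i" "\<lambda>c. \<Sum>i\<in>J. F i c"] by simp
qed (use gdiff.const[of I 0] in auto)

section \<open>Gaussian self-adjoint matrices\<close>

type_synonym coords = "nat \<times> nat \<times> nat \<Rightarrow> real"

text \<open>The coordinate \<open>(l, i, j)\<close> belongs to the entries \<open>(i, j)\<close> and \<open>(j, i)\<close> of the matrix with index \<open>l\<close>.\<close>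

definition coord_set :: "nat \<Rightarrow> nat \<Rightarrow> (nat \<times> nat \<times> nat) set" where
  "coord_set n k = {..<n} \<times> {..<k} \<times> {..<k}"

lemma finite_coord_set [simp]: "finite (coord_set n k)" by (simp add: coord_set_def)

lemma card_coord_set: "card (coord_set n k) = n * k\<^sup>2"
  by (simp add: coord_set_def power2_eq_square)

definition mat_of :: "nat \<Rightarrow> coords \<Rightarrow> nat \<Rightarrow> complex mat" where
  "mat_of k c l = sa_mat_of_coords k (\<lambda>i j. c (l, i, j))"

text \<open>The entry \<open>(a, b)\<close> of the matrix with index \<open>l\<close> as a linear function of complex valued coordinates. Complex
  values are allowed because the function is also applied to the gradient of a complex function.\<close>

definition entry :: "(nat \<times> nat \<times> nat \<Rightarrow> complex) \<Rightarrow> nat \<Rightarrow> nat \<Rightarrow> nat \<Rightarrow> complex" where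
  "entry d l a b = (if a = b then d (l, a, a)
     else if a < b then (d (l, a, b) + \<i> * d (l, b, a)) / of_real (sqrt 2)
     else (d (l, b, a) - \<i> * d (l, a, b)) / of_real (sqrt 2))"

lemma mat_of_carrier [simp]: "mat_of k c l \<in> carrier_mat k k"
  by (simp add: mat_of_def sa_mat_of_coords_def)

lemma mat_of_dim [simp]: "dim_row (mat_of k c l) = k" "dim_col (mat_of k c l) = k"
  by (simp_all add: mat_of_def sa_mat_of_coords_def)

lemma mat_of_index: "a < k \<Longrightarrow> b < k \<Longrightarrow> mat_of k c l $$ (a, b) = entry (\<lambda>e. of_real (c e)) l a b"
  by (auto simp: mat_of_def sa_mat_of_coords_def entry_def complex_eq_iff)

lemma mat_of_sa: "mat_of k c l \<in> sa_mats k"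
  by (auto simp: sa_mats_iff mat_of_index entry_def)

lemma entry_linear:
  "entry (\<lambda>e. d e + d' e) l a b = entry d l a b + entry d' l a b"
  "entry (\<lambda>e. d e * z) l a b = entry d l a b * z"
  "entry (\<lambda>e. z * d e) l a b = z * entry d l a b"
  "entry (\<lambda>e. 0) l a b = 0"
  by (auto simp: entry_def add_divide_distrib diff_divide_distrib algebra_simps)

lemma entry_sum: "entry (\<lambda>e. \<Sum>i\<in>J. d i e) l a b = (\<Sum>i\<in>J. entry (d i) l a b)"
  by (induction J rule: infinite_finite_induct) (simp_all add: entry_linear)

definition unit_coord :: "'e \<Rightarrow> 'e \<Rightarrow> complex" where
  "unit_coord e e' = (if e = e' then 1 else 0)"

text \<open>Since the coordinates are orthonormal, this is the covariance of the entries \<open>(a, b)\<close> and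
  \<open>(a', b')\<close>: an entry is correlated only with its transposed entry.\<close>

lemma entry_covariance:
  "entry (\<lambda>e. entry (unit_coord e) l' a' b') l a b = (if l = l' \<and> a = b' \<and> b = a' then 1 else 0)"
proof -
  have [simp]: "complex_of_real (sqrt 2) * complex_of_real (sqrt 2) = 2" by (simp flip: of_real_mult)
  show ?thesis
  proof (cases "l = l'")
    case False
    then show ?thesis by (simp add: entry_def unit_coord_def)
  next
    case True
    show ?thesis unfolding True
      by (cases a b rule: linorder_cases; cases a' b' rule: linorder_cases)
         (auto simp: entry_def unit_coord_def field_simps)
  qed
qed

lemma gdiff_entry:
  assumes "l < n" "a < k" "b < k"
  shows "gdiff (coord_set n k) (\<lambda>c. entry (\<lambda>e. of_real (c e)) l a b) (\<lambda>e c. entry (unit_coord e) l a b)"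
proof -
  let ?I = "coord_set n k"
  have c: "gdiff ?I (\<lambda>c. of_real (c (l, i, j))) (\<lambda>e c. unit_coord e (l, i, j))" if "i < k" "j < k" for i j
    using gdiff_coord[of "(l, i, j)" ?I] that assms by (simp add: coord_set_def unit_coord_def)
  have two: "gdiff ?I (\<lambda>c. u * of_real (c (l, i, j)) + v * of_real (c (l, j, i))) (\<lambda>e c. u * unit_coord e (l, i, j) + v * unit_coord e (l, j, i))"
    if "i < k" "j < k" for i j u v
    using that by (intro gdiff.add gdiff_scale c)
  consider "a = b" | "a < b" | "b < a" by linarith
  then show ?thesis
  proof cases
    case 1
    then show ?thesis using c[OF assms(2,3)] by (simp add: entry_def)
  next
    case 2
    then show ?thesis using two[OF assms(2,3), of "1 / of_real (sqrt 2)" "\<i> / of_real (sqrt 2)"]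
      by (simp add: entry_def add_divide_distrib)
  next
    case 3
    then show ?thesis using two[OF assms(3,2), of "1 / of_real (sqrt 2)" "- \<i> / of_real (sqrt 2)"]
      by (simp add: entry_def diff_divide_distrib)
  qed
qed

text \<open>\<open>D' l\<close> is the gradient of \<open>F\<close> with respect to the matrix with index \<open>l\<close>, read as a matrix. For a polynomial
  in the entries, \<open>D' l a b\<close> is the partial derivative with respect to the entry \<open>(b, a)\<close>.\<close>

definition ediff :: "nat \<Rightarrow> nat \<Rightarrow> (coords \<Rightarrow> complex) \<Rightarrow> (nat \<Rightarrow> nat \<Rightarrow> nat \<Rightarrow> coords \<Rightarrow> complex) \<Rightarrow> bool" where
  "ediff n k F D' \<longleftrightarrow> (\<exists>D. gdiff (coord_set n k) F D \<and>
     (\<forall>l<n. \<forall>a<k. \<forall>b<k. \<forall>c. D' l a b c = entry (\<lambda>e. D e c) l a b))"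

lemma ediff_const: "ediff n k (\<lambda>_. z) (\<lambda>_ _ _ _. 0)"
  unfolding ediff_def by (rule exI[of _ "\<lambda>_ _. 0"]) (simp add: gdiff.const entry_linear)

lemma ediff_sum:
  assumes "\<And>i. i \<in> J \<Longrightarrow> ediff n k (F i) (D' i)"
  shows "ediff n k (\<lambda>c. \<Sum>i\<in>J. F i c) (\<lambda>l a b c. \<Sum>i\<in>J. D' i l a b c)"
proof -
  have "\<forall>i\<in>J. \<exists>D. gdiff (coord_set n k) (F i) D \<and>
      (\<forall>l<n. \<forall>a<k. \<forall>b<k. \<forall>c. D' i l a b c = entry (\<lambda>e. D e c) l a b)"
    using assms unfolding ediff_def by (intro ballI)
  from bchoice[OF this] obtain D where D: "\<forall>i\<in>J. gdiff (coord_set n k) (F i) (D i) \<and>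
      (\<forall>l<n. \<forall>a<k. \<forall>b<k. \<forall>c. D' i l a b c = entry (\<lambda>e. D i e c) l a b)" ..
  show ?thesis unfolding ediff_def
    by (rule exI[of _ "\<lambda>e c. \<Sum>i\<in>J. D i e c"]) (use D in \<open>auto simp: gdiff_sum entry_sum\<close>)
qed

lemma ediff_mult:
  assumes "ediff n k F D" "ediff n k G D'"
  shows "ediff n k (\<lambda>c. F c * G c) (\<lambda>l a b c. D l a b c * G c + F c * D' l a b c)"
proof -
  obtain E where E: "gdiff (coord_set n k) F E \<and>
      (\<forall>l<n. \<forall>a<k. \<forall>b<k. \<forall>c. D l a b c = entry (\<lambda>e. E e c) l a b)"
    using assms(1) unfolding ediff_def ..
  obtain E' where E': "gdiff (coord_set n k) G E' \<and>
      (\<forall>l<n. \<forall>a<k. \<forall>b<k. \<forall>c. D' l a b c = entry (\<lambda>e. E' e c) l a b)"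
    using assms(2) unfolding ediff_def ..
  show ?thesis unfolding ediff_def
    by (rule exI[of _ "\<lambda>e c. E e c * G c + F c * E' e c"]) (use E E' in \<open>auto simp: gdiff_mult entry_linear\<close>)
qed

lemma ediff_entry:
  assumes "l' < n" "a' < k" "b' < k"
  shows "ediff n k (\<lambda>c. mat_of k c l' $$ (a', b')) (\<lambda>l a b c. if l = l' \<and> a = b' \<and> b = a' then 1 else 0)"
  unfolding ediff_def
  by (rule exI[of _ "\<lambda>e c. entry (unit_coord e) l' a' b'"])
     (simp add: gdiff_entry mat_of_index assms entry_covariance)

lemma ediff_cong: "ediff n k F D \<Longrightarrow> (\<And>c. F c = G c) \<Longrightarrow>
   (\<And>l a b c. l < n \<Longrightarrow> a < k \<Longrightarrow> b < k \<Longrightarrow> D l a b c = D' l a b c) \<Longrightarrow> ediff n k G D'"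
proof -
  assume d: "ediff n k F D" and "\<And>c. F c = G c"
    and D: "\<And>l a b c. l < n \<Longrightarrow> a < k \<Longrightarrow> b < k \<Longrightarrow> D l a b c = D' l a b c"
  then have "F = G" by blast
  with d D show "ediff n k G D'" unfolding ediff_def by auto
qed

text \<open>Integration by parts in the form in which it is used for Gaussian matrices: multiplication with an
  entry becomes a derivative, at the price of the variance \<open>1 / k\<close>.\<close>

lemma ediff_stein:
  assumes k: "k > 0" and lab: "l < n" "a < k" "b < k" and d: "ediff n k F D"
  defines "P \<equiv> gauss (1 / sqrt (real k)) (coord_set n k)"
  shows "integrable P F" "integrable P (D l a b)" "integrable P (\<lambda>c. mat_of k c l $$ (a, b) * F c)"
    "(\<integral>c. mat_of k c l $$ (a, b) * F c \<partial>P) = (\<integral>c. D l a b c \<partial>P) / of_nat k"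
proof -
  obtain D0 where D0': "gdiff (coord_set n k) F D0 \<and>
      (\<forall>l<n. \<forall>a<k. \<forall>b<k. \<forall>c. D l a b c = entry (\<lambda>e. D0 e c) l a b)"
    using d unfolding ediff_def ..
  have D0: "gdiff (coord_set n k) F D0" "\<And>c. D l a b c = entry (\<lambda>e. D0 e c) l a b"
    using D0' lab by simp_all
  have s: "1 / sqrt (real k) > 0" "complex_of_real ((1 / sqrt (real k))\<^sup>2) = 1 / of_nat k"
    using k by (simp_all add: power_divide)
  have I: "(l, i, j) \<in> coord_set n k" if "i < k" "j < k" for i j using that lab by (simp add: coord_set_def)
  note st = gauss_stein[OF s(1) finite_coord_set I D0(1), folded P_def, unfolded s(2)]
  show "integrable P F" using st(1) lab by blast
  have Deq: "D l a b = (\<lambda>c. entry (\<lambda>e. D0 e c) l a b)" using D0(2) by blast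
  have Feq: "mat_of k c l $$ (a, b) * F c = entry (\<lambda>e. of_real (c e) * F c) l a b" for c
    using lab by (simp add: mat_of_index entry_linear)
  have "integrable P (\<lambda>c. entry (\<lambda>e. D0 e c) l a b) \<and> integrable P (\<lambda>c. entry (\<lambda>e. of_real (c e) * F c) l a b)
     \<and> (\<integral>c. entry (\<lambda>e. of_real (c e) * F c) l a b \<partial>P) = (\<integral>c. entry (\<lambda>e. D0 e c) l a b \<partial>P) / of_nat k"
  proof -
    consider "a = b" | "a < b" | "b < a" by linarith
    then show ?thesis
    proof cases
      case 1
      then show ?thesis using st[OF lab(2) lab(3)] by (simp add: entry_def)
    next
      case 2
      then show ?thesis using st[OF lab(2) lab(3)] st[OF lab(3) lab(2)]
        by (simp add: entry_def add_divide_distrib mult.commute)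
    next
      case 3
      then show ?thesis using st[OF lab(2) lab(3)] st[OF lab(3) lab(2)]
        by (simp add: entry_def diff_divide_distrib mult.commute)
    qed
  qed
  then show "integrable P (D l a b)" "integrable P (\<lambda>c. mat_of k c l $$ (a, b) * F c)"
    "(\<integral>c. mat_of k c l $$ (a, b) * F c \<partial>P) = (\<integral>c. D l a b c \<partial>P) / of_nat k"
    unfolding Deq Feq by auto
qed

section \<open>Schwinger--Dyson equations\<close>

text \<open>The letters \<open>Inl i\<close> stand for given matrices \<open>A i\<close> and the letters \<open>Inr l\<close> for the matrices with
  coordinates \<open>c\<close>.\<close>

definition letter_mat :: "nat \<Rightarrow> (nat \<Rightarrow> complex mat) \<Rightarrow> coords \<Rightarrow> nat + nat \<Rightarrow> complex mat" where
  "letter_mat k A c = case_sum A (mat_of k c)"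

definition wmat :: "nat \<Rightarrow> (nat \<Rightarrow> complex mat) \<Rightarrow> (nat + nat) list \<Rightarrow> coords \<Rightarrow> complex mat" where
  "wmat k A w c = mat_word k (letter_mat k A c) w"

definition wtr :: "nat \<Rightarrow> (nat \<Rightarrow> complex mat) \<Rightarrow> (nat + nat) list \<Rightarrow> coords \<Rightarrow> complex" where
  "wtr k A w c = ntrace k (wmat k A w c)"

definition nwords :: "nat \<Rightarrow> (nat + nat) list set" where
  "nwords n = {w. set w \<subseteq> Inl ` {..<n} \<union> Inr ` {..<n}}"

lemma nwords_simps [simp]: "[] \<in> nwords n" "x # w \<in> nwords n \<longleftrightarrow> x \<in> Inl ` {..<n} \<union> Inr ` {..<n} \<and> w \<in> nwords n"
  "u @ v \<in> nwords n \<longleftrightarrow> u \<in> nwords n \<and> v \<in> nwords n"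
  by (auto simp: nwords_def)

lemma nwords_take_drop [intro]: "w \<in> nwords n \<Longrightarrow> take q w \<in> nwords n" "w \<in> nwords n \<Longrightarrow> drop q w \<in> nwords n"
  by (auto simp: nwords_def dest: in_set_takeD in_set_dropD)

lemma integral_sum3:
  fixes f :: "nat \<Rightarrow> nat \<Rightarrow> nat \<Rightarrow> 'a \<Rightarrow> complex"
  assumes f: "\<And>p a b. p < k \<Longrightarrow> a < k \<Longrightarrow> b < k \<Longrightarrow> integrable M (f p a b)"
  shows "(\<integral>c. (\<Sum>p<k. \<Sum>a<k. \<Sum>b<k. f p a b c) \<partial>M) = (\<Sum>p<k. \<Sum>a<k. \<Sum>b<k. \<integral>c. f p a b c \<partial>M)"
proof -
  have i1: "integrable M (\<lambda>c. \<Sum>b<k. f p a b c)" if "p < k" "a < k" for p a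
    by (rule Bochner_Integration.integrable_sum) (use f[OF that] in simp)
  have i2: "integrable M (\<lambda>c. \<Sum>a<k. \<Sum>b<k. f p a b c)" if "p < k" for p
    by (rule Bochner_Integration.integrable_sum) (use i1[OF that] in simp)
  have "(\<integral>c. (\<Sum>p<k. \<Sum>a<k. \<Sum>b<k. f p a b c) \<partial>M) = (\<Sum>p<k. \<integral>c. (\<Sum>a<k. \<Sum>b<k. f p a b c) \<partial>M)"
    by (rule Bochner_Integration.integral_sum) (use i2 in simp)
  also have "\<dots> = (\<Sum>p<k. \<Sum>a<k. \<integral>c. (\<Sum>b<k. f p a b c) \<partial>M)"
    by (intro sum.cong refl Bochner_Integration.integral_sum) (use i1 in simp)
  also have "\<dots> = (\<Sum>p<k. \<Sum>a<k. \<Sum>b<k. \<integral>c. f p a b c \<partial>M)"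
    by (intro sum.cong refl Bochner_Integration.integral_sum) (use f in simp)
  finally show ?thesis .
qed

text \<open>Products of traces are needed because integration by parts splits a trace into two, and because the
  variance of a trace is the expectation of a product.\<close>

definition wtrs :: "nat \<Rightarrow> (nat \<Rightarrow> complex mat) \<Rightarrow> (nat + nat) list list \<Rightarrow> coords \<Rightarrow> complex" where
  "wtrs k A ws c = prod_list (map (\<lambda>w. wtr k A w c) ws)"

lemma wtrs_simps [simp]: "wtrs k A [] c = 1" "wtrs k A (w # ws) c = wtr k A w c * wtrs k A ws c"
  by (simp_all add: wtrs_def)

text \<open>The result of differentiating the product of the traces of \<open>ws\<close> with respect to the variable \<open>i\<close> and
  contracting with \<open>v\<close>: a letter \<open>Inr i\<close> is removed from one of the words, the word is cut open at this place
  and \<open>v\<close> is inserted.\<close>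

fun merges :: "nat \<Rightarrow> (nat + nat) list \<Rightarrow> (nat + nat) list list \<Rightarrow> (nat + nat) list list list" where
  "merges i v [] = []"
| "merges i v (w # ws) = map (\<lambda>q. (v @ drop (Suc q) w @ take q w) # ws) (filter (\<lambda>q. w ! q = Inr i) [0..<length w])
     @ map ((#) w) (merges i v ws)"

lemma merges_nwords: "v \<in> nwords n \<Longrightarrow> set ws \<subseteq> nwords n \<Longrightarrow> us \<in> set (merges i v ws) \<Longrightarrow> set us \<subseteq> nwords n"
  by (induction ws arbitrary: us) (auto simp: nwords_take_drop subset_iff)

lemma sum_list_filter_upt: "sum_list (map f (filter Q [0..<m])) = (\<Sum>q<m. if Q q then f q else (0::complex))"
  by (simp add: sum_list_map_filter' interv_sum_list_conv_sum_set_nat atLeast0LessThan)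

context
  fixes n k :: nat and A :: "nat \<Rightarrow> complex mat"
  assumes A: "\<And>i. i < n \<Longrightarrow> A i \<in> carrier_mat k k"
begin

lemma letter_carrier: "x \<in> Inl ` {..<n} \<union> Inr ` {..<n} \<Longrightarrow> letter_mat k A c x \<in> carrier_mat k k"
  using A by (auto simp: letter_mat_def)

lemma wmat_carrier: "w \<in> nwords n \<Longrightarrow> wmat k A w c \<in> carrier_mat k k"
  unfolding wmat_def nwords_def using letter_carrier by (intro mat_word_carrier) blast

lemma wmat_Cons_index:
  assumes "x # w \<in> nwords n" "p < k" "r < k"
  shows "wmat k A (x # w) c $$ (p, r) = (\<Sum>s<k. letter_mat k A c x $$ (p, s) * wmat k A w c $$ (s, r))"
proof -
  have "letter_mat k A c x \<in> carrier_mat k k" "mat_word k (letter_mat k A c) w \<in> carrier_mat k k"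
    using letter_carrier[of x c] wmat_carrier[of w c] assms by (auto simp: wmat_def)
  then show ?thesis unfolding wmat_def mat_word_Cons by (rule mat_mult_index) (use assms in auto)
qed

lemma wmat_append_index:
  assumes "u \<in> nwords n" "v \<in> nwords n" "p < k" "r < k"
  shows "wmat k A (u @ v) c $$ (p, r) = (\<Sum>s<k. wmat k A u c $$ (p, s) * wmat k A v c $$ (s, r))"
proof -
  have "wmat k A (u @ v) c = wmat k A u c * wmat k A v c"
    unfolding wmat_def using assms letter_carrier by (intro mat_word_append) (auto simp: nwords_def)
  then show ?thesis using mat_mult_index[OF wmat_carrier[OF assms(1)] wmat_carrier[OF assms(2)] assms(3,4)] by simp
qed

lemma wmat_Nil_index: "p < k \<Longrightarrow> r < k \<Longrightarrow> wmat k A [] c $$ (p, r) = (if p = r then 1 else 0)"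
  by (simp add: wmat_def)

text \<open>The derivative of the entry \<open>(p, r)\<close> of the word \<open>w\<close>, by the product rule.\<close>

definition dwmat :: "(nat + nat) list \<Rightarrow> nat \<Rightarrow> nat \<Rightarrow> nat \<Rightarrow> nat \<Rightarrow> nat \<Rightarrow> coords \<Rightarrow> complex" where
  "dwmat w p r l a b c = (\<Sum>q<length w. if w ! q = Inr l
      then wmat k A (take q w) c $$ (p, b) * wmat k A (drop (Suc q) w) c $$ (a, r) else 0)"

lemma ediff_wmat:
  "w \<in> nwords n \<Longrightarrow> p < k \<Longrightarrow> r < k \<Longrightarrow> ediff n k (\<lambda>c. wmat k A w c $$ (p, r)) (dwmat w p r)"
proof (induction w arbitrary: p)
  case Nil
  show ?case
    by (rule ediff_cong[OF ediff_const[of n k "if p = r then 1 else 0"]]) (use Nil in \<open>auto simp: wmat_Nil_index dwmat_def\<close>)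
next
  case (Cons x w)
  define dl where "dl = (\<lambda>(p :: nat) (s :: nat) (l :: nat) (a :: nat) (b :: nat) (c :: coords). if x = Inr l \<and> p = b \<and> s = a then 1 else (0::complex))"
  have x: "x \<in> Inl ` {..<n} \<union> Inr ` {..<n}" and w: "w \<in> nwords n" using Cons.prems by auto
  have l: "ediff n k (\<lambda>c. letter_mat k A c x $$ (p, s)) (dl p s)" if "p < k" "s < k" for p s
  proof (cases x)
    case (Inl i)
    then show ?thesis using ediff_const[of n k "A i $$ (p, s)"]
      by (elim ediff_cong) (auto simp: letter_mat_def dl_def)
  next
    case (Inr i)
    then have "i < n" using x by auto
    show ?thesis
      by (rule ediff_cong[OF ediff_entry[OF \<open>i < n\<close> that]]) (auto simp: letter_mat_def dl_def Inr)
  qed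
  have "ediff n k (\<lambda>c. \<Sum>s<k. letter_mat k A c x $$ (p, s) * wmat k A w c $$ (s, r))
     (\<lambda>l a b c. \<Sum>s<k. dl p s l a b c * wmat k A w c $$ (s, r) + letter_mat k A c x $$ (p, s) * dwmat w s r l a b c)"
    by (intro ediff_sum ediff_mult l Cons.IH) (use Cons.prems w in auto)
  then show ?case
  proof (rule ediff_cong)
    fix c show "(\<Sum>s<k. letter_mat k A c x $$ (p, s) * wmat k A w c $$ (s, r)) = wmat k A (x # w) c $$ (p, r)"
      using Cons.prems by (simp add: wmat_Cons_index)
  next
    fix l a b c assume lab: "l < n" "a < k" "b < k"
    have 1: "(\<Sum>s<k. dl p s l a b c * wmat k A w c $$ (s, r)) = (if x = Inr l then wmat k A [] c $$ (p, b) * wmat k A w c $$ (a, r) else 0)"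
    proof -
      have "(\<Sum>s<k. dl p s l a b c * wmat k A w c $$ (s, r)) = (\<Sum>s<k. if s = a then (if x = Inr l \<and> p = b then wmat k A w c $$ (a, r) else 0) else 0)"
        by (intro sum.cong) (auto simp: dl_def)
      also have "\<dots> = (if x = Inr l \<and> p = b then wmat k A w c $$ (a, r) else 0)" using lab by simp
      finally show ?thesis using lab Cons.prems by (simp add: wmat_Nil_index)
    qed
    have 2: "(\<Sum>s<k. letter_mat k A c x $$ (p, s) * dwmat w s r l a b c) = (\<Sum>q<length w. if w ! q = Inr l
       then wmat k A (x # take q w) c $$ (p, b) * wmat k A (drop (Suc q) w) c $$ (a, r) else 0)"
    proof -
      have "(\<Sum>s<k. letter_mat k A c x $$ (p, s) * dwmat w s r l a b c) =
        (\<Sum>q<length w. \<Sum>s<k. if w ! q = Inr l then letter_mat k A c x $$ (p, s) * (wmat k A (take q w) c $$ (s, b) * wmat k A (drop (Suc q) w) c $$ (a, r)) else 0)"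
        unfolding dwmat_def by (subst sum.swap) (auto simp: sum_distrib_left intro!: sum.cong)
      also have "\<dots> = (\<Sum>q<length w. if w ! q = Inr l
       then wmat k A (x # take q w) c $$ (p, b) * wmat k A (drop (Suc q) w) c $$ (a, r) else 0)"
      proof (rule sum.cong)
        fix q
        have "x # take q w \<in> nwords n" using x w by auto
        then have "wmat k A (x # take q w) c $$ (p, b) = (\<Sum>s<k. letter_mat k A c x $$ (p, s) * wmat k A (take q w) c $$ (s, b))"
          using Cons.prems lab by (intro wmat_Cons_index)
        then show "(\<Sum>s<k. if w ! q = Inr l then letter_mat k A c x $$ (p, s) * (wmat k A (take q w) c $$ (s, b) * wmat k A (drop (Suc q) w) c $$ (a, r)) else 0)
           = (if w ! q = Inr l then wmat k A (x # take q w) c $$ (p, b) * wmat k A (drop (Suc q) w) c $$ (a, r) else 0)"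
          by (simp add: sum_distrib_right mult.assoc)
      qed simp
      finally show ?thesis .
    qed
    have "dwmat (x # w) p r l a b c = (if x = Inr l then wmat k A [] c $$ (p, b) * wmat k A w c $$ (a, r) else 0)
       + (\<Sum>q<length w. if w ! q = Inr l
       then wmat k A (x # take q w) c $$ (p, b) * wmat k A (drop (Suc q) w) c $$ (a, r) else 0)"
      unfolding dwmat_def by (simp add: sum.lessThan_Suc_shift del: sum.lessThan_Suc cong: if_cong)
    then show "(\<Sum>s<k. dl p s l a b c * wmat k A w c $$ (s, r) + letter_mat k A c x $$ (p, s) * dwmat w s r l a b c) = dwmat (x # w) p r l a b c"
      using 1 2 by (simp add: sum.distrib)
  qed
qed

lemma wtr_eq: "w \<in> nwords n \<Longrightarrow> wtr k A w c = (\<Sum>p<k. wmat k A w c $$ (p, p)) / of_nat k"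
  by (simp add: wtr_def ntrace_def)

text \<open>The two factors of the derivative of a word are joined by cyclicity of the trace.\<close>

definition dwtr :: "(nat + nat) list \<Rightarrow> nat \<Rightarrow> nat \<Rightarrow> nat \<Rightarrow> coords \<Rightarrow> complex" where
  "dwtr w l a b c = (\<Sum>q<length w. if w ! q = Inr l
      then wmat k A (drop (Suc q) w @ take q w) c $$ (a, b) else 0) / of_nat k"

lemma ediff_wtr:
  assumes w: "w \<in> nwords n"
  shows "ediff n k (wtr k A w) (dwtr w)"
proof -
  have "ediff n k (\<lambda>c. (1 / of_nat k) * (\<Sum>p<k. wmat k A w c $$ (p, p)))
     (\<lambda>l a b c. 0 * (\<Sum>p<k. wmat k A w c $$ (p, p)) + (1 / of_nat k) * (\<Sum>p<k. dwmat w p p l a b c))"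
    by (intro ediff_mult ediff_const ediff_sum ediff_wmat w) auto
  then show ?thesis
  proof (rule ediff_cong)
    fix l a b c assume lab: "l < n" "a < k" "b < k"
    have "(\<Sum>p<k. dwmat w p p l a b c) = (\<Sum>q<length w. if w ! q = Inr l
      then wmat k A (drop (Suc q) w @ take q w) c $$ (a, b) else 0)"
    proof -
      have "(\<Sum>p<k. dwmat w p p l a b c) = (\<Sum>q<length w. \<Sum>p<k. if w ! q = Inr l
        then wmat k A (take q w) c $$ (p, b) * wmat k A (drop (Suc q) w) c $$ (a, p) else 0)"
        unfolding dwmat_def by (rule sum.swap)
      also have "\<dots> = (\<Sum>q<length w. if w ! q = Inr l
        then wmat k A (drop (Suc q) w @ take q w) c $$ (a, b) else 0)"
        using lab w by (intro sum.cong) (auto simp: wmat_append_index nwords_take_drop mult.commute)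
      finally show ?thesis .
    qed
    then show "0 * (\<Sum>p<k. wmat k A w c $$ (p, p)) + (1 / of_nat k) * (\<Sum>p<k. dwmat w p p l a b c) = dwtr w l a b c"
      by (simp add: dwtr_def)
  qed (simp add: wtr_eq[OF w])
qed

fun dwtrs :: "(nat + nat) list list \<Rightarrow> nat \<Rightarrow> nat \<Rightarrow> nat \<Rightarrow> coords \<Rightarrow> complex" where
  "dwtrs [] l a b c = 0"
| "dwtrs (w # ws) l a b c = dwtr w l a b c * wtrs k A ws c + wtr k A w c * dwtrs ws l a b c"

lemma ediff_wtrs: "set ws \<subseteq> nwords n \<Longrightarrow> ediff n k (wtrs k A ws) (dwtrs ws)"
proof (induction ws)
  case Nil
  show ?case by (rule ediff_cong[OF ediff_const[of n k 1]]) auto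
next
  case (Cons w ws)
  then have "ediff n k (\<lambda>c. wtr k A w c * wtrs k A ws c) (\<lambda>l a b c. dwtr w l a b c * wtrs k A ws c + wtr k A w c * dwtrs ws l a b c)"
    by (intro ediff_mult ediff_wtr) auto
  then show ?case by (rule ediff_cong) auto
qed

lemma sum_merges:
  assumes v: "v \<in> nwords n"
  shows "set ws \<subseteq> nwords n \<Longrightarrow>
    (\<Sum>a<k. \<Sum>b<k. wmat k A v c $$ (b, a) * dwtrs ws l a b c) = sum_list (map (\<lambda>us. wtrs k A us c) (merges l v ws))"
proof (induction ws)
  case (Cons w ws)
  have w: "w \<in> nwords n" using Cons.prems by simp
  have "(\<Sum>a<k. \<Sum>b<k. wmat k A v c $$ (b, a) * dwtr w l a b c) = (\<Sum>q<length w. if w ! q = Inr l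
      then wtr k A (v @ drop (Suc q) w @ take q w) c else 0)"
  proof -
    have "(\<Sum>a<k. \<Sum>b<k. wmat k A v c $$ (b, a) * dwtr w l a b c)
       = (\<Sum>a<k. \<Sum>b<k. \<Sum>q<length w. (if w ! q = Inr l then wmat k A v c $$ (b, a) * wmat k A (drop (Suc q) w @ take q w) c $$ (a, b) / of_nat k else 0))"
      unfolding dwtr_def by (auto simp: sum_distrib_left sum_divide_distrib intro!: sum.cong)
    also have "\<dots> = (\<Sum>b<k. \<Sum>a<k. \<Sum>q<length w. (if w ! q = Inr l then wmat k A v c $$ (b, a) * wmat k A (drop (Suc q) w @ take q w) c $$ (a, b) / of_nat k else 0))"
      by (rule sum.swap)
    also have "\<dots> = (\<Sum>q<length w. \<Sum>b<k. \<Sum>a<k. (if w ! q = Inr l then wmat k A v c $$ (b, a) * wmat k A (drop (Suc q) w @ take q w) c $$ (a, b) / of_nat k else 0))"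
      by (rule sum_swap3[symmetric])
    also have "\<dots> = (\<Sum>q<length w. if w ! q = Inr l then wtr k A (v @ drop (Suc q) w @ take q w) c else 0)"
    proof (intro sum.cong refl)
      fix q
      have d: "drop (Suc q) w @ take q w \<in> nwords n" using w by (simp add: nwords_take_drop)
      have "wtr k A (v @ drop (Suc q) w @ take q w) c = (\<Sum>b<k. \<Sum>a<k. wmat k A v c $$ (b, a) * wmat k A (drop (Suc q) w @ take q w) c $$ (a, b)) / of_nat k"
        using wmat_append_index[OF v d] v d by (simp add: wtr_eq)
      then show "(\<Sum>b<k. \<Sum>a<k. (if w ! q = Inr l then wmat k A v c $$ (b, a) * wmat k A (drop (Suc q) w @ take q w) c $$ (a, b) / of_nat k else 0))
        = (if w ! q = Inr l then wtr k A (v @ drop (Suc q) w @ take q w) c else 0)"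
        by (simp add: sum_divide_distrib)
    qed
    finally show ?thesis .
  qed
  then have 1: "(\<Sum>a<k. \<Sum>b<k. wmat k A v c $$ (b, a) * (dwtr w l a b c * wtrs k A ws c))
     = sum_list (map (\<lambda>us. wtrs k A us c) (map (\<lambda>q. (v @ drop (Suc q) w @ take q w) # ws) (filter (\<lambda>q. w ! q = Inr l) [0..<length w])))"
    by (simp add: comp_def sum_list_filter_upt mult.assoc[symmetric] flip: sum_distrib_right)
       (auto simp: sum_distrib_right intro!: sum.cong)
  have 2: "(\<Sum>a<k. \<Sum>b<k. wmat k A v c $$ (b, a) * (wtr k A w c * dwtrs ws l a b c))
     = sum_list (map (\<lambda>us. wtrs k A us c) (map ((#) w) (merges l v ws)))"
  proof -
    have "(\<Sum>a<k. \<Sum>b<k. wmat k A v c $$ (b, a) * (wtr k A w c * dwtrs ws l a b c))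
       = wtr k A w c * (\<Sum>a<k. \<Sum>b<k. wmat k A v c $$ (b, a) * dwtrs ws l a b c)"
      by (simp add: sum_distrib_left mult.left_commute)
    then show ?thesis using Cons by (simp add: comp_def sum_list_const_mult)
  qed
  have "(\<Sum>a<k. \<Sum>b<k. wmat k A v c $$ (b, a) * dwtrs (w # ws) l a b c)
    = (\<Sum>a<k. \<Sum>b<k. wmat k A v c $$ (b, a) * (dwtr w l a b c * wtrs k A ws c)) + (\<Sum>a<k. \<Sum>b<k. wmat k A v c $$ (b, a) * (wtr k A w c * dwtrs ws l a b c))"
    by (simp add: distrib_left sum.distrib)
  then show ?case unfolding merges.simps map_append sum_list_append 1 2 .
qed simp

abbreviation gue :: "coords measure" where
  "gue \<equiv> gauss (1 / sqrt (real k)) (coord_set n k)"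

lemma integrable_wtrs:
  assumes "k > 0" "n > 0" "set ws \<subseteq> nwords n"
  shows "integrable gue (wtrs k A ws)"
  using ediff_stein(1)[OF assms(1,2,1,1) ediff_wtrs[OF assms(3)]] .

text \<open>Integration by parts for the semicircular letter after the prefix \<open>a0\<close>. A derivative that falls on
  the same word splits its trace into a product of two traces. A derivative that falls on another trace merges
  the two words, and the normalization of the traces makes such terms smaller by the factor \<open>1 / k\<^sup>2\<close>. The
  equation is exact for each \<open>k\<close>. The prefix consists of deterministic letters, so that a derivative never falls
  on it.\<close>

lemma schwinger_dyson:
  assumes k: "k > 0" and l: "l < n" and a0: "set a0 \<subseteq> {..<n}" and w: "w \<in> nwords n" and ws: "set ws \<subseteq> nwords n"
  shows "(\<integral>c. wtrs k A ((map Inl a0 @ Inr l # w) # ws) c \<partial>gue) =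
    (\<Sum>q<length w. if w ! q = Inr l then (\<integral>c. wtrs k A (take q w # (map Inl a0 @ drop (Suc q) w) # ws) c \<partial>gue) else 0)
    + sum_list (map (\<lambda>us. \<integral>c. wtrs k A us c \<partial>gue) (merges l (w @ map Inl a0) ws)) / (of_nat k)\<^sup>2"
proof -
  define \<alpha> where "\<alpha> p a = wmat k A (map Inl a0) (\<lambda>_. 0) $$ (p, a)" for p a
  have a0w: "map Inl a0 \<in> nwords n" using a0 by (auto simp: nwords_def)
  have \<alpha>: "wmat k A (map Inl a0) c $$ (p, a) = \<alpha> p a" for c p a
  proof -
    have "mat_word k (letter_mat k A c) (map Inl a0) = mat_word k (letter_mat k A (\<lambda>_. 0)) (map Inl a0)" for a0
      by (induction a0) (simp_all add: letter_mat_def)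
    then show ?thesis by (simp add: \<alpha>_def wmat_def)
  qed
  have n0: "n > 0" using l by simp
  define D where "D a b p = (\<lambda>c. dwmat w b p l a b c * wtrs k A ws c + wmat k A w c $$ (b, p) * dwtrs ws l a b c)" for a b p
  have st: "integrable gue (D a b p)" "integrable gue (\<lambda>c. mat_of k c l $$ (a, b) * (wmat k A w c $$ (b, p) * wtrs k A ws c))"
    "(\<integral>c. mat_of k c l $$ (a, b) * (wmat k A w c $$ (b, p) * wtrs k A ws c) \<partial>gue) = (\<integral>c. D a b p c \<partial>gue) / of_nat k"
    if "a < k" "b < k" "p < k" for a b p
    using ediff_stein(2,3,4)[OF k l that(1,2) ediff_mult[OF ediff_wmat[OF w that(2,3)] ediff_wtrs[OF ws]]]
    unfolding D_def by blast+
  have lw: "Inr l # w \<in> nwords n" using l w by simp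
  have e1: "wtrs k A ((map Inl a0 @ Inr l # w) # ws) c =
     (\<Sum>p<k. \<Sum>a<k. \<Sum>b<k. \<alpha> p a * (mat_of k c l $$ (a, b) * (wmat k A w c $$ (b, p) * wtrs k A ws c))) / of_nat k" for c
  proof -
    have "wtr k A (map Inl a0 @ Inr l # w) c = (\<Sum>p<k. \<Sum>a<k. \<alpha> p a * (\<Sum>b<k. mat_of k c l $$ (a, b) * wmat k A w c $$ (b, p))) / of_nat k"
      using wmat_append_index[OF a0w lw] wmat_Cons_index[OF lw] a0w lw
      by (simp add: wtr_eq \<alpha> letter_mat_def)
    then show ?thesis by (simp add: sum_distrib_left sum_distrib_right mult.assoc)
  qed
  have "(\<integral>c. wtrs k A ((map Inl a0 @ Inr l # w) # ws) c \<partial>gue) =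
    (\<Sum>p<k. \<Sum>a<k. \<Sum>b<k. \<alpha> p a * ((\<integral>c. D a b p c \<partial>gue) / of_nat k)) / of_nat k"
    unfolding e1 by (simp add: st integral_sum3)
  also have "\<dots> = (\<integral>c. (\<Sum>p<k. \<Sum>a<k. \<Sum>b<k. \<alpha> p a * D a b p c) \<partial>gue) / (of_nat k)\<^sup>2"
    by (simp add: st integral_sum3 power2_eq_square sum_divide_distrib)
  also have "(\<lambda>c. \<Sum>p<k. \<Sum>a<k. \<Sum>b<k. \<alpha> p a * D a b p c) =
     (\<lambda>c. (of_nat k)\<^sup>2 * (\<Sum>q<length w. if w ! q = Inr l then wtrs k A (take q w # (map Inl a0 @ drop (Suc q) w) # ws) c else 0)
       + sum_list (map (\<lambda>us. wtrs k A us c) (merges l (w @ map Inl a0) ws)))"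
  proof
    fix c
    have 1: "(\<Sum>p<k. \<Sum>a<k. \<Sum>b<k. \<alpha> p a * dwmat w b p l a b c) = (of_nat k)\<^sup>2 * (\<Sum>q<length w. if w ! q = Inr l then wtr k A (take q w) c * wtr k A (map Inl a0 @ drop (Suc q) w) c else 0)"
    proof -
      have "(\<Sum>p<k. \<Sum>a<k. \<Sum>b<k. \<alpha> p a * dwmat w b p l a b c) =
        (\<Sum>p<k. \<Sum>a<k. \<Sum>q<length w. \<Sum>b<k. if w ! q = Inr l then \<alpha> p a * (wmat k A (take q w) c $$ (b, b) * wmat k A (drop (Suc q) w) c $$ (a, p)) else 0)"
      proof (rule sum.cong[OF refl], rule sum.cong[OF refl])
        fix p a
        have "(\<Sum>b<k. \<alpha> p a * dwmat w b p l a b c) = (\<Sum>b<k. \<Sum>q<length w. if w ! q = Inr l then \<alpha> p a * (wmat k A (take q w) c $$ (b, b) * wmat k A (drop (Suc q) w) c $$ (a, p)) else 0)"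
          unfolding dwmat_def sum_distrib_left by (intro sum.cong) auto
        also have "\<dots> = (\<Sum>q<length w. \<Sum>b<k. if w ! q = Inr l then \<alpha> p a * (wmat k A (take q w) c $$ (b, b) * wmat k A (drop (Suc q) w) c $$ (a, p)) else 0)"
          by (rule sum.swap)
        finally show "(\<Sum>b<k. \<alpha> p a * dwmat w b p l a b c) = (\<Sum>q<length w. \<Sum>b<k. if w ! q = Inr l then \<alpha> p a * (wmat k A (take q w) c $$ (b, b) * wmat k A (drop (Suc q) w) c $$ (a, p)) else 0)" .
      qed
      also have "\<dots> = (\<Sum>q<length w. \<Sum>p<k. \<Sum>a<k. \<Sum>b<k. if w ! q = Inr l then \<alpha> p a * (wmat k A (take q w) c $$ (b, b) * wmat k A (drop (Suc q) w) c $$ (a, p)) else 0)"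
        by (rule sum_swap3[symmetric])
      also have "\<dots> = (\<Sum>q<length w. (of_nat k)\<^sup>2 * (if w ! q = Inr l then wtr k A (take q w) c * wtr k A (map Inl a0 @ drop (Suc q) w) c else 0))"
      proof (intro sum.cong refl)
        fix q
        have t: "take q w \<in> nwords n" and d: "drop (Suc q) w \<in> nwords n" using w by (auto simp: nwords_take_drop)
        have x: "(\<Sum>b<k. wmat k A (take q w) c $$ (b, b)) = of_nat k * wtr k A (take q w) c"
          using k by (simp add: wtr_eq[OF t])
        have y: "(\<Sum>p<k. \<Sum>a<k. \<alpha> p a * wmat k A (drop (Suc q) w) c $$ (a, p)) = of_nat k * wtr k A (map Inl a0 @ drop (Suc q) w) c"
          using k wmat_append_index[OF a0w d, of _ _ c] a0w d by (simp add: wtr_eq \<alpha>)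
        have "(\<Sum>p<k. \<Sum>a<k. \<Sum>b<k. \<alpha> p a * (wmat k A (take q w) c $$ (b, b) * wmat k A (drop (Suc q) w) c $$ (a, p)))
          = (\<Sum>p<k. \<Sum>a<k. \<alpha> p a * wmat k A (drop (Suc q) w) c $$ (a, p)) * (\<Sum>b<k. wmat k A (take q w) c $$ (b, b))"
          by (simp only: sum_distrib_right) (simp add: sum_distrib_left mult_ac)
        then show "(\<Sum>p<k. \<Sum>a<k. \<Sum>b<k. if w ! q = Inr l then \<alpha> p a * (wmat k A (take q w) c $$ (b, b) * wmat k A (drop (Suc q) w) c $$ (a, p)) else 0)
          = (of_nat k)\<^sup>2 * (if w ! q = Inr l then wtr k A (take q w) c * wtr k A (map Inl a0 @ drop (Suc q) w) c else 0)"
          unfolding x y by (simp add: power2_eq_square mult_ac)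
      qed
      finally show ?thesis by (simp add: sum_distrib_left)
    qed
    have v: "w @ map Inl a0 \<in> nwords n" using w a0w by simp
    have 2: "(\<Sum>p<k. \<Sum>a<k. \<Sum>b<k. \<alpha> p a * (wmat k A w c $$ (b, p) * dwtrs ws l a b c)) = sum_list (map (\<lambda>us. wtrs k A us c) (merges l (w @ map Inl a0) ws))"
    proof -
      have "(\<Sum>p<k. \<Sum>a<k. \<Sum>b<k. \<alpha> p a * (wmat k A w c $$ (b, p) * dwtrs ws l a b c)) = (\<Sum>a<k. \<Sum>b<k. \<Sum>p<k. \<alpha> p a * (wmat k A w c $$ (b, p) * dwtrs ws l a b c))"
        by (rule sum_swap3)
      also have "\<dots> = (\<Sum>a<k. \<Sum>b<k. wmat k A (w @ map Inl a0) c $$ (b, a) * dwtrs ws l a b c)"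
        using wmat_append_index[OF w a0w, of _ _ c] by (intro sum.cong refl) (simp add: \<alpha> sum_distrib_left sum_distrib_right mult_ac)
      finally show ?thesis using sum_merges[OF v ws] by simp
    qed
    have "(\<Sum>p<k. \<Sum>a<k. \<Sum>b<k. \<alpha> p a * D a b p c) = (\<Sum>p<k. \<Sum>a<k. \<Sum>b<k. \<alpha> p a * dwmat w b p l a b c) * wtrs k A ws c
      + (\<Sum>p<k. \<Sum>a<k. \<Sum>b<k. \<alpha> p a * (wmat k A w c $$ (b, p) * dwtrs ws l a b c))"
      by (simp add: D_def distrib_left sum.distrib sum_distrib_right mult.assoc)
    then show "(\<Sum>p<k. \<Sum>a<k. \<Sum>b<k. \<alpha> p a * D a b p c) = (of_nat k)\<^sup>2 * (\<Sum>q<length w. if w ! q = Inr l then wtrs k A (take q w # (map Inl a0 @ drop (Suc q) w) # ws) c else 0)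
       + sum_list (map (\<lambda>us. wtrs k A us c) (merges l (w @ map Inl a0) ws))"
      unfolding 1 2 by (simp add: mult.assoc sum_distrib_right if_distrib[of "\<lambda>x. x * wtrs k A ws c"] cong: if_cong)
  qed
  also have "(\<integral>c. (of_nat k)\<^sup>2 * (\<Sum>q<length w. if w ! q = Inr l then wtrs k A (take q w # (map Inl a0 @ drop (Suc q) w) # ws) c else 0)
       + sum_list (map (\<lambda>us. wtrs k A us c) (merges l (w @ map Inl a0) ws)) \<partial>gue)
    = (of_nat k)\<^sup>2 * (\<Sum>q<length w. if w ! q = Inr l then (\<integral>c. wtrs k A (take q w # (map Inl a0 @ drop (Suc q) w) # ws) c \<partial>gue) else 0)
       + sum_list (map (\<lambda>us. \<integral>c. wtrs k A us c \<partial>gue) (merges l (w @ map Inl a0) ws))"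
  proof -
    have i: "integrable gue (wtrs k A (take q w # (map Inl a0 @ drop (Suc q) w) # ws))" for q
      using w a0w ws by (intro integrable_wtrs k n0) (auto simp: nwords_take_drop)
    have i1: "integrable gue (\<lambda>c. if w ! q = Inr l then wtrs k A (take q w # (map Inl a0 @ drop (Suc q) w) # ws) c else 0)" for q
      using i[of q] by (cases "w ! q = Inr l") (auto simp del: wtrs_simps)
    have e: "(\<integral>c. (if w ! q = Inr l then wtrs k A (take q w # (map Inl a0 @ drop (Suc q) w) # ws) c else 0) \<partial>gue) = (if w ! q = Inr l then (\<integral>c. wtrs k A (take q w # (map Inl a0 @ drop (Suc q) w) # ws) c \<partial>gue) else 0)" for q
      by simp
    have j: "integrable gue (wtrs k A us)" if "us \<in> set (merges l (w @ map Inl a0) ws)" for us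
      by (intro integrable_wtrs k n0) (rule merges_nwords[OF _ ws that], use w a0w in simp)
    have sl: "integrable gue (\<lambda>c. sum_list (map (\<lambda>us. wtrs k A us c) L)) \<and>
       (\<integral>c. sum_list (map (\<lambda>us. wtrs k A us c) L) \<partial>gue) = sum_list (map (\<lambda>us. \<integral>c. wtrs k A us c \<partial>gue) L)"
      if "\<And>us. us \<in> set L \<Longrightarrow> integrable gue (wtrs k A us)" for L
      using that by (induction L) auto
    have "(\<integral>c. (of_nat k)\<^sup>2 * (\<Sum>q<length w. if w ! q = Inr l then wtrs k A (take q w # (map Inl a0 @ drop (Suc q) w) # ws) c else 0) \<partial>gue)
      = (of_nat k)\<^sup>2 * (\<Sum>q<length w. if w ! q = Inr l then (\<integral>c. wtrs k A (take q w # (map Inl a0 @ drop (Suc q) w) # ws) c \<partial>gue) else 0)"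
      using i1 by (simp only: integral_mult_right_zero Bochner_Integration.integral_sum e)
    moreover have "integrable gue (\<lambda>c. (of_nat k)\<^sup>2 * (\<Sum>q<length w. if w ! q = Inr l then wtrs k A (take q w # (map Inl a0 @ drop (Suc q) w) # ws) c else 0))"
      using i1 by (intro integrable_mult_right Bochner_Integration.integrable_sum)
    ultimately show ?thesis using sl[of "merges l (w @ map Inl a0) ws"] j
      by (simp only: Bochner_Integration.integral_add)
  qed
  finally show ?thesis using k by (simp add: add_divide_distrib)
qed

end

section \<open>Asymptotic freeness of Gaussian matrices\<close>

definition semicircular_degree :: "(nat + nat) list \<Rightarrow> nat" where
  "semicircular_degree w = length (filter (\<lambda>x. \<not> isl x) w)"

lemma semicircular_degree_simps [simp]:
  "semicircular_degree [] = 0" "semicircular_degree (u @ v) = semicircular_degree u + semicircular_degree v"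
  "semicircular_degree (Inl j # w) = semicircular_degree w" "semicircular_degree (Inr j # w) = Suc (semicircular_degree w)"
  "semicircular_degree (map Inl a) = 0"
  by (simp_all add: semicircular_degree_def comp_def)

lemma semicircular_degree_take_drop:
  "q < length w \<Longrightarrow> w ! q = Inr i \<Longrightarrow> semicircular_degree w = Suc (semicircular_degree (take q w) + semicircular_degree (drop (Suc q) w))"
  by (subst id_take_nth_drop[of q w]) simp_all

text \<open>Merging removes one semicircular letter, so the terms on the right of the Schwinger--Dyson equation
  have smaller degree. The letter that is integrated by parts is not counted in \<open>v\<close>.\<close>

lemma merges_degree:
  "us \<in> set (merges i v ws) \<Longrightarrow>
    Suc (sum_list (map semicircular_degree us)) = semicircular_degree v + sum_list (map semicircular_degree ws)"
  by (induction ws arbitrary: us) (auto simp: semicircular_degree_take_drop)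

lemma pure_or_first_semicircular:
  "w \<in> nwords n \<Longrightarrow> (\<exists>a. set a \<subseteq> {..<n} \<and> w = map Inl a) \<or>
     (\<exists>a i v. set a \<subseteq> {..<n} \<and> i < n \<and> v \<in> nwords n \<and> w = map Inl a @ Inr i # v)"
proof (induction w)
  case (Cons x w)
  then have w: "w \<in> nwords n" by simp
  show ?case
  proof (cases x)
    case (Inl j)
    then have j: "j < n" using Cons.prems by auto
    from Cons.IH[OF w] show ?thesis
    proof
      assume "\<exists>a. set a \<subseteq> {..<n} \<and> w = map Inl a"
      then obtain a where "set a \<subseteq> {..<n}" "w = map Inl a" by blast
      then show ?thesis using Inl j by (intro disjI1 exI[of _ "j # a"]) simp
    next
      assume "\<exists>a i v. set a \<subseteq> {..<n} \<and> i < n \<and> v \<in> nwords n \<and> w = map Inl a @ Inr i # v"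
      then obtain a i v where "set a \<subseteq> {..<n}" "i < n" "v \<in> nwords n" "w = map Inl a @ Inr i # v" by blast
      then show ?thesis using Inl j by (intro disjI2 exI[of _ "j # a"] exI[of _ i] exI[of _ v]) simp
    qed
  next
    case (Inr i)
    then show ?thesis using Cons.prems w by (intro disjI2 exI[of _ "[]"] exI[of _ i] exI[of _ w]) auto
  qed
qed simp

text \<open>By induction on the number of semicircular letters. If there are none, the traces do not depend on
  the random matrices. Otherwise the Schwinger--Dyson equation expresses the expectation by terms with fewer
  semicircular letters; the merged terms disappear because of the factor \<open>1 / k\<^sup>2\<close>, and the others satisfy
  \<open>fock_word_recursion\<close> in the limit. That the limit of a product is the product of the limits is part of the
  induction and expresses that the traces are asymptotically constant.\<close>

theorem gue_words_converge:
  fixes K :: "nat \<Rightarrow> nat" and A :: "nat \<Rightarrow> nat \<Rightarrow> complex mat"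
  assumes K: "\<And>j. K j > 0" "filterlim K at_top sequentially"
    and A: "\<And>j i. i < n \<Longrightarrow> A j i \<in> carrier_mat (K j) (K j)"
    and t: "\<And>w. set w \<subseteq> {..<n} \<Longrightarrow> (\<lambda>j. ntrace (K j) (mat_word (K j) (A j) w)) \<longlonglongrightarrow> t w"
    and ws: "set ws \<subseteq> nwords n"
  shows "(\<lambda>j. \<integral>c. wtrs (K j) (A j) ws c \<partial>gauss (1 / sqrt (real (K j))) (coord_set n (K j))) \<longlonglongrightarrow> prod_list (map (fock_word t) ws)"
  using ws
proof (induction "sum_list (map semicircular_degree ws)" arbitrary: ws rule: less_induct)
  case (less ws)
  define E where "E = (\<lambda>j f. integral\<^sup>L (gauss (1 / sqrt (real (K j))) (coord_set n (K j))) f :: complex)"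
  have pure: "wtr (K j) (A j) (map Inl a) c = ntrace (K j) (mat_word (K j) (A j) a)" for a j c
  proof -
    have "mat_word (K j) (letter_mat (K j) (A j) c) (map Inl a) = mat_word (K j) (A j) a"
      by (induction a) (simp_all add: letter_mat_def)
    then show ?thesis by (simp add: wtr_def wmat_def)
  qed
  show ?case
  proof (cases "\<forall>w\<in>set ws. \<exists>a. set a \<subseteq> {..<n} \<and> w = map Inl a")
    case True
    then have "\<exists>as. ws = map (map Inl) as \<and> (\<forall>a\<in>set as. set a \<subseteq> {..<n})"
    proof (induction ws)
      case (Cons w ws)
      then obtain as a where "ws = map (map Inl) as" "\<forall>a\<in>set as. set a \<subseteq> {..<n}" "set a \<subseteq> {..<n}" "w = map Inl a" by auto
      then show ?case by (intro exI[of _ "a # as"]) simp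
    qed simp
    then obtain as where as: "ws = map (map Inl) as" "\<forall>a\<in>set as. set a \<subseteq> {..<n}" by blast
    have e: "wtrs (K j) (A j) ws c = prod_list (map (\<lambda>a. ntrace (K j) (mat_word (K j) (A j) a)) as)" for j c
      unfolding as(1) by (induction as) (simp_all add: pure wtrs_def)
    have "E j (wtrs (K j) (A j) ws) = prod_list (map (\<lambda>a. ntrace (K j) (mat_word (K j) (A j) a)) as)" for j
    proof -
      interpret prob_space "gauss (1 / sqrt (real (K j))) (coord_set n (K j))"
        by (rule prob_space_gauss) (use K(1) in simp)
      show ?thesis unfolding E_def e by (simp add: prob_space)
    qed
    moreover have "(\<lambda>j. prod_list (map (\<lambda>a. ntrace (K j) (mat_word (K j) (A j) a)) as)) \<longlonglongrightarrow> prod_list (map t as)"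
      using as(2) by (induction as) (auto intro!: tendsto_mult t)
    ultimately show ?thesis using as(1) by (simp add: E_def fock_word_Inl comp_def)
  next
    case False
    then obtain w0 where w0: "w0 \<in> set ws" "\<not> (\<exists>a. set a \<subseteq> {..<n} \<and> w0 = map Inl a)" by blast
    then obtain ws1 ws2 where ws12: "ws = ws1 @ w0 # ws2" by (meson split_list)
    define ws' where "ws' = ws1 @ ws2"
    obtain a i v where av: "set a \<subseteq> {..<n}" "i < n" "v \<in> nwords n" "w0 = map Inl a @ Inr i # v"
      using pure_or_first_semicircular[of w0 n] w0 less.prems by blast
    have ws': "set ws' \<subseteq> nwords n" using less.prems by (auto simp: ws'_def ws12)
    have perm: "wtrs (K j) (A j) ws = wtrs (K j) (A j) (w0 # ws')" for j
      by (rule ext) (simp add: wtrs_def ws12 ws'_def)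
    have deg: "sum_list (map semicircular_degree ws) = Suc (semicircular_degree v + sum_list (map semicircular_degree ws'))"
      by (simp add: ws12 ws'_def av(4))
    have a: "map Inl a \<in> nwords n" using av(1) by (auto simp: nwords_def)
    have sd: "E j (wtrs (K j) (A j) ws) =
       (\<Sum>q<length v. if v ! q = Inr i then E j (wtrs (K j) (A j) (take q v # (map Inl a @ drop (Suc q) v) # ws')) else 0)
        + sum_list (map (\<lambda>us. E j (wtrs (K j) (A j) us)) (merges i (v @ map Inl a) ws')) / (of_nat (K j))\<^sup>2" for j
      unfolding perm av(4) E_def using schwinger_dyson[of n "A j" "K j", OF A K(1) av(2,1,3) ws'] .
    have IH: "(\<lambda>j. E j (wtrs (K j) (A j) us)) \<longlonglongrightarrow> prod_list (map (fock_word t) us)"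
      if "sum_list (map semicircular_degree us) < sum_list (map semicircular_degree ws)" "set us \<subseteq> nwords n" for us
      unfolding E_def by (rule less.hyps[OF that])
    have 1: "(\<lambda>j. \<Sum>q<length v. if v ! q = Inr i then E j (wtrs (K j) (A j) (take q v # (map Inl a @ drop (Suc q) v) # ws')) else 0)
      \<longlonglongrightarrow> (\<Sum>q<length v. if v ! q = Inr i then fock_word t (take q v) * fock_word t (map Inl a @ drop (Suc q) v) * prod_list (map (fock_word t) ws') else 0)"
    proof (rule tendsto_sum)
      fix q assume q: "q \<in> {..<length v}"
      show "(\<lambda>j. if v ! q = Inr i then E j (wtrs (K j) (A j) (take q v # (map Inl a @ drop (Suc q) v) # ws')) else 0)
        \<longlonglongrightarrow> (if v ! q = Inr i then fock_word t (take q v) * fock_word t (map Inl a @ drop (Suc q) v) * prod_list (map (fock_word t) ws') else 0)"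
      proof (cases "v ! q = Inr i")
        case True
        have "(\<lambda>j. E j (wtrs (K j) (A j) (take q v # (map Inl a @ drop (Suc q) v) # ws'))) \<longlonglongrightarrow> prod_list (map (fock_word t) (take q v # (map Inl a @ drop (Suc q) v) # ws'))"
          using True q a av(3) ws' by (intro IH) (auto simp: deg semicircular_degree_take_drop[of q v i] nwords_take_drop)
        then show ?thesis using True by (simp add: mult.assoc)
      qed simp
    qed
    have m: "(\<lambda>j. sum_list (map (\<lambda>us. E j (wtrs (K j) (A j) us)) L)) \<longlonglongrightarrow> sum_list (map (\<lambda>us. prod_list (map (fock_word t) us)) L)"
      if "\<And>us. us \<in> set L \<Longrightarrow> (\<lambda>j. E j (wtrs (K j) (A j) us)) \<longlonglongrightarrow> prod_list (map (fock_word t) us)" for L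
      using that by (induction L) (auto intro!: tendsto_add)
    have 2: "(\<lambda>j. sum_list (map (\<lambda>us. E j (wtrs (K j) (A j) us)) (merges i (v @ map Inl a) ws')) / (of_nat (K j))\<^sup>2) \<longlonglongrightarrow> 0"
    proof -
      have "(\<lambda>j. sum_list (map (\<lambda>us. E j (wtrs (K j) (A j) us)) (merges i (v @ map Inl a) ws'))) \<longlonglongrightarrow>
         sum_list (map (\<lambda>us. prod_list (map (fock_word t) us)) (merges i (v @ map Inl a) ws'))"
      proof (intro m IH)
        fix us assume us: "us \<in> set (merges i (v @ map Inl a) ws')"
        show "set us \<subseteq> nwords n" by (rule merges_nwords[OF _ ws' us]) (use av a in simp)
        show "sum_list (map semicircular_degree us) < sum_list (map semicircular_degree ws)"
          using merges_degree[OF us] by (simp add: deg)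
      qed
      moreover have "(\<lambda>j. 1 / (of_nat (K j) :: complex)\<^sup>2) \<longlonglongrightarrow> 0"
      proof -
        have "(\<lambda>j. 1 / (of_nat (K j) :: complex)) \<longlonglongrightarrow> 0"
          using filterlim_compose[OF lim_1_over_n K(2)] by simp
        from tendsto_power[OF this, of 2] show ?thesis by (simp add: power_divide)
      qed
      ultimately show ?thesis using tendsto_mult by fastforce
    qed
    have "prod_list (map (fock_word t) ws) = (\<Sum>q<length v. if v ! q = Inr i then fock_word t (take q v) * fock_word t (map Inl a @ drop (Suc q) v) * prod_list (map (fock_word t) ws') else 0) + 0"
    proof -
      have "prod_list (map (fock_word t) ws) = fock_word t w0 * prod_list (map (fock_word t) ws')"
        by (simp add: ws12 ws'_def)
      then show ?thesis unfolding av(4) fock_word_recursion sum_distrib_right by (auto intro!: sum.cong)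
    qed
    then have "(\<lambda>j. E j (wtrs (K j) (A j) ws)) \<longlonglongrightarrow> prod_list (map (fock_word t) ws)"
      using tendsto_add[OF 1 2] by (simp only: sd)
    then show ?thesis by (simp only: E_def)
  qed
qed

section \<open>Numerical radius\<close>

text \<open>The standard inner product, conjugate linear in the first argument.\<close>

definition cip :: "complex vec \<Rightarrow> complex vec \<Rightarrow> complex" where
  "cip x y = (\<Sum>a<dim_vec x. cnj (x $ a) * y $ a)"

lemma cip_bound:
  assumes "x \<in> carrier_vec k" "y \<in> carrier_vec k"
  shows "cmod (cip x y) \<le> vec_l2norm x * vec_l2norm y"
proof -
  have "cmod (cip x y) \<le> (\<Sum>a<k. \<bar>cmod (x $ a)\<bar> * \<bar>cmod (y $ a)\<bar>)"
  proof -
    have d: "dim_vec x = k" using assms by simp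
    show ?thesis unfolding cip_def d by (rule sum_norm_le) (simp add: norm_mult)
  qed
  also have "\<dots> \<le> L2_set (\<lambda>a. cmod (x $ a)) {..<k} * L2_set (\<lambda>a. cmod (y $ a)) {..<k}"
    by (rule L2_set_mult_ineq)
  finally show ?thesis using assms by (simp add: vec_l2norm_def)
qed

lemma vec_l2norm_square: "(vec_l2norm x)\<^sup>2 = (\<Sum>a<dim_vec x. (cmod (x $ a))\<^sup>2)"
  by (simp add: vec_l2norm_def L2_set_def sum_nonneg)

lemma cip_self: "cip x x = of_real ((vec_l2norm x)\<^sup>2)"
  unfolding vec_l2norm_square cip_def of_real_sum
  by (intro sum.cong refl) (metis complex_norm_square mult.commute)

lemma cip_add:
  assumes "x \<in> carrier_vec k" "y \<in> carrier_vec k" "z \<in> carrier_vec k"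
  shows "cip (x + y) z = cip x z + cip y z" "cip x (y + z) = cip x y + cip x z"
    "cip (x - y) z = cip x z - cip y z" "cip x (y - z) = cip x y - cip x z"
proof -
  have d: "dim_vec x = k" "dim_vec y = k" "dim_vec z = k" using assms by auto
  show "cip (x + y) z = cip x z + cip y z" "cip x (y + z) = cip x y + cip x z"
    "cip (x - y) z = cip x z - cip y z" "cip x (y - z) = cip x y - cip x z"
    unfolding cip_def by (simp_all add: d sum.distrib sum_subtractf algebra_simps cong: sum.cong_simp)
qed

lemma cip_smult: "x \<in> carrier_vec k \<Longrightarrow> y \<in> carrier_vec k \<Longrightarrow> cip (c \<cdot>\<^sub>v x) y = cnj c * cip x y"
  by (simp add: cip_def sum_distrib_left mult_ac)

lemma cip_smult_right: "x \<in> carrier_vec k \<Longrightarrow> y \<in> carrier_vec k \<Longrightarrow> cip x (c \<cdot>\<^sub>v y) = c * cip x y"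
  by (simp add: cip_def sum_distrib_left mult_ac cong: sum.cong_simp)

lemma mat_vec_index:
  assumes "S \<in> carrier_mat k k" "v \<in> carrier_vec k" "a < k"
  shows "(S *\<^sub>v v) $ a = (\<Sum>b<k. S $$ (a, b) * v $ b)"
  using assms by (simp add: scalar_prod_def atLeast0LessThan)

lemma cip_hermitian:
  assumes S: "S \<in> sa_mats k" and x: "x \<in> carrier_vec k" and y: "y \<in> carrier_vec k"
  shows "cip x (S *\<^sub>v y) = cnj (cip y (S *\<^sub>v x))"
proof -
  have c: "S \<in> carrier_mat k k" using S by (rule sa_mats_carrier)
  have "cip x (S *\<^sub>v y) = (\<Sum>a<k. \<Sum>b<k. cnj (x $ a) * (S $$ (a, b) * y $ b))"
    using x y by (simp add: cip_def mat_vec_index[OF c y] sum_distrib_left)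
  also have "\<dots> = (\<Sum>b<k. \<Sum>a<k. cnj (x $ a) * (S $$ (a, b) * y $ b))" by (rule sum.swap)
  also have "\<dots> = (\<Sum>b<k. \<Sum>a<k. cnj (cnj (y $ b) * (S $$ (b, a) * x $ a)))"
    using sa_mats_index[OF S] by (intro sum.cong refl) (simp add: mult_ac)
  also have "\<dots> = cnj (cip y (S *\<^sub>v x))"
    using x y by (simp add: cip_def mat_vec_index[OF c x] sum_distrib_left)
  finally show ?thesis .
qed

text \<open>For self-adjoint \<open>S\<close> polarization between \<open>u\<close> and the normalized vector \<open>w\<close> in the direction of \<open>S u\<close>
  expresses the norm of \<open>S u\<close> by two values of the quadratic form, and the parallelogram law bounds these.\<close>

lemma numerical_radius_opnorm:
  assumes S: "S \<in> sa_mats k"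
    and q: "\<And>v. v \<in> carrier_vec k \<Longrightarrow> vec_l2norm v \<le> 1 \<Longrightarrow> cmod (cip v (S *\<^sub>v v)) \<le> q"
  shows "opnorm S \<le> q"
proof (rule opnorm_least)
  have c [simp]: "S \<in> carrier_mat k k" using S by (rule sa_mats_carrier)
  show "S \<in> carrier_mat k k" by simp
  have Sv [simp]: "S *\<^sub>v v \<in> carrier_vec k" if "v \<in> carrier_vec k" for v using c that by (rule mult_mat_vec_carrier)
  have q0: "0 \<le> q" using order_trans[OF norm_ge_zero q[of "0\<^sub>v k"]] by simp
  have qq: "cmod (cip v (S *\<^sub>v v)) \<le> q * (vec_l2norm v)\<^sup>2" if v: "v \<in> carrier_vec k" for v
  proof (cases "vec_l2norm v = 0")
    case True
    then have "cip v (S *\<^sub>v v) = 0" using cip_bound[OF v Sv[OF v]] by simp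
    then show ?thesis using True by simp
  next
    case False
    define r where "r = vec_l2norm v"
    have r: "r > 0" using False vec_l2norm_nonneg[of v] unfolding r_def by linarith
    define w where "w = complex_of_real (1 / r) \<cdot>\<^sub>v v"
    have w: "w \<in> carrier_vec k" "vec_l2norm w \<le> 1" using v r by (simp_all add: w_def vec_l2norm_smult norm_divide r_def[symmetric])
    have "v = complex_of_real r \<cdot>\<^sub>v w" using v r by (intro eq_vecI) (auto simp: w_def)
    then have "cip v (S *\<^sub>v v) = cip (complex_of_real r \<cdot>\<^sub>v w) (complex_of_real r \<cdot>\<^sub>v (S *\<^sub>v w))"
      using mult_mat_vec[OF c w(1), of "complex_of_real r"] by simp
    also have "\<dots> = of_real (r\<^sup>2) * cip w (S *\<^sub>v w)"
      using w by (simp add: cip_smult[of _ k] cip_smult_right[of _ k] power2_eq_square)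
    finally have "cmod (cip v (S *\<^sub>v v)) = r\<^sup>2 * cmod (cip w (S *\<^sub>v w))" by (simp add: norm_mult norm_power)
    also have "\<dots> \<le> r\<^sup>2 * q" using q[OF w] by (intro mult_left_mono) auto
    finally show ?thesis by (simp add: r_def mult.commute)
  qed
  fix u :: "complex vec" assume u: "u \<in> carrier_vec k" "vec_l2norm u \<le> 1"
  define r where "r = vec_l2norm (S *\<^sub>v u)"
  show "vec_l2norm (S *\<^sub>v u) \<le> q"
  proof (cases "r = 0")
    case True
    then show ?thesis using q0 by (simp add: r_def)
  next
    case False
    then have r: "r > 0" using vec_l2norm_nonneg[of "S *\<^sub>v u"] unfolding r_def by linarith
    define w where "w = complex_of_real (1 / r) \<cdot>\<^sub>v (S *\<^sub>v u)"
    have w: "w \<in> carrier_vec k" "vec_l2norm w = 1"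
      using u r by (simp_all add: w_def vec_l2norm_smult norm_divide r_def[symmetric])
    have "cip w (S *\<^sub>v u) = of_real (1 / r) * cip (S *\<^sub>v u) (S *\<^sub>v u)"
      using u by (simp add: w_def cip_smult[of _ k])
    also have "\<dots> = of_real r" using r by (simp add: cip_self r_def[symmetric] power2_eq_square)
    finally have wr: "cip w (S *\<^sub>v u) = of_real r" .
    have ur: "cip u (S *\<^sub>v w) = of_real r" using cip_hermitian[OF S u(1) w(1)] wr by simp
    have Sadd: "S *\<^sub>v (u + w) = S *\<^sub>v u + S *\<^sub>v w" "S *\<^sub>v (u - w) = S *\<^sub>v u - S *\<^sub>v w"
      by (rule mult_add_distrib_mat_vec[OF c u(1) w(1)], rule mult_minus_distrib_mat_vec[OF c u(1) w(1)])
    \<comment> \<open>Polarization; the mixed terms are real because \<open>S\<close> is self-adjoint.\<close>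
    have "cip (u + w) (S *\<^sub>v (u + w)) - cip (u - w) (S *\<^sub>v (u - w)) = of_real (4 * r)"
      unfolding Sadd using u(1) w(1) by (simp add: cip_add[of _ k] wr ur)
    then have "4 * r = cmod (cip (u + w) (S *\<^sub>v (u + w)) - cip (u - w) (S *\<^sub>v (u - w)))"
      using r by simp
    also have "\<dots> \<le> q * (vec_l2norm (u + w))\<^sup>2 + q * (vec_l2norm (u - w))\<^sup>2"
      using u(1) w(1) by (intro order_trans[OF norm_triangle_ineq4] add_mono qq) auto
    also have "\<dots> = 2 * q * ((vec_l2norm u)\<^sup>2 + (vec_l2norm w)\<^sup>2)"
    proof -
      have "complex_of_real ((vec_l2norm (u + w))\<^sup>2 + (vec_l2norm (u - w))\<^sup>2) = of_real (2 * ((vec_l2norm u)\<^sup>2 + (vec_l2norm w)\<^sup>2))"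
        using u(1) w(1) unfolding of_real_add of_real_mult cip_self[symmetric] by (simp add: cip_add[of _ k])
      then have "(vec_l2norm (u + w))\<^sup>2 + (vec_l2norm (u - w))\<^sup>2 = 2 * ((vec_l2norm u)\<^sup>2 + (vec_l2norm w)\<^sup>2)"
        by (simp only: of_real_eq_iff)
      then show ?thesis unfolding distrib_left[symmetric] by simp
    qed
    also have "\<dots> \<le> 2 * q * (1 + 1)"
      using u(2) w(2) q0 by (intro mult_left_mono add_mono) (auto simp: power_le_one)
    finally show ?thesis by (simp add: r_def)
  qed
qed

text \<open>Replacing a vector by the nearest point of the net changes the quadratic form by at most twice
  \<open>1 / 4\<close> of the norm, and half of the norm can be absorbed.\<close>

lemma opnorm_le_net:
  assumes S: "S \<in> sa_mats k" and V: "V \<subseteq> carrier_vec k" "\<And>v. v \<in> V \<Longrightarrow> vec_l2norm v \<le> 1"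
    and net: "\<And>u. u \<in> carrier_vec k \<Longrightarrow> vec_l2norm u \<le> 1 \<Longrightarrow> \<exists>v\<in>V. vec_l2norm (u - v) \<le> 1 / 4"
    and T: "\<And>v. v \<in> V \<Longrightarrow> cmod (cip v (S *\<^sub>v v)) \<le> T"
  shows "opnorm S \<le> 2 * T"
proof -
  have c: "S \<in> carrier_mat k k" using S by (rule sa_mats_carrier)
  have "opnorm S \<le> T + opnorm S / 2"
  proof (rule numerical_radius_opnorm[OF S])
    fix u :: "complex vec" assume u: "u \<in> carrier_vec k" "vec_l2norm u \<le> 1"
    obtain v where v: "v \<in> V" "vec_l2norm (u - v) \<le> 1 / 4" using net[OF u] by blast
    have vc: "v \<in> carrier_vec k" "vec_l2norm v \<le> 1" using V v by auto
    have Sc: "S *\<^sub>v x \<in> carrier_vec k" if "x \<in> carrier_vec k" for x using c that by (rule mult_mat_vec_carrier)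
    have duv: "u - v \<in> carrier_vec k" using u vc by simp
    \<comment> \<open>The form is changed in one argument after the other.\<close>
    have e: "cip u (S *\<^sub>v u) = cip v (S *\<^sub>v v) + cip (u - v) (S *\<^sub>v u) + cip v (S *\<^sub>v (u - v))"
      using u vc c by (simp add: mult_minus_distrib_mat_vec cip_add[of _ k] Sc)
    have S1: "vec_l2norm (S *\<^sub>v u) \<le> opnorm S" using opnorm_upper1[OF c u] .
    have "cmod (cip (u - v) (S *\<^sub>v u)) \<le> vec_l2norm (u - v) * vec_l2norm (S *\<^sub>v u)"
      using u vc by (intro cip_bound[of _ k] Sc) auto
    also have "\<dots> \<le> 1 / 4 * opnorm S" using v(2) S1 by (intro mult_mono) auto
    finally have 1: "cmod (cip (u - v) (S *\<^sub>v u)) \<le> opnorm S / 4" by simp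
    have "cmod (cip v (S *\<^sub>v (u - v))) \<le> vec_l2norm v * vec_l2norm (S *\<^sub>v (u - v))"
      using u vc by (intro cip_bound[of _ k] Sc) auto
    also have "\<dots> \<le> 1 * (opnorm S * vec_l2norm (u - v))"
      using vc(2) opnorm_upper[OF c duv] by (intro mult_mono) auto
    also have "\<dots> \<le> 1 * (opnorm S * (1 / 4))"
      using v(2) opnorm_nonneg[OF c] by (intro mult_left_mono) auto
    finally have 2: "cmod (cip v (S *\<^sub>v (u - v))) \<le> opnorm S / 4" by simp
    have "cmod (cip u (S *\<^sub>v u)) \<le> cmod (cip v (S *\<^sub>v v)) + cmod (cip (u - v) (S *\<^sub>v u)) + cmod (cip v (S *\<^sub>v (u - v)))"
      unfolding e by (intro order_trans[OF norm_triangle_ineq] add_mono norm_triangle_ineq order_refl)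
    then show "cmod (cip u (S *\<^sub>v u)) \<le> T + opnorm S / 2" using T[OF v(1)] 1 2 by linarith
  qed
  then show ?thesis by simp
qed

section \<open>A finite net in the unit ball\<close>

definition net_index :: "nat \<Rightarrow> (nat \<times> bool) set" where "net_index k = {..<k} \<times> UNIV"

text \<open>Integer vectors of dimension \<open>2 * k\<close>, for the real and imaginary parts of a vector in dimension \<open>k\<close>. The
  bound \<open>8 * k\<close> for the sum of the absolute values is what the Cauchy--Schwarz inequality gives for a vector
  of the unit ball measured in steps of length \<open>1 / (4 * sqrt (2 * k))\<close>; the bound for the single components
  follows from it.\<close>

definition net_codes :: "nat \<Rightarrow> (nat \<times> bool \<Rightarrow> int) set" where
  "net_codes k = {z \<in> PiE (net_index k) (\<lambda>_. {- int (8 * k)..int (8 * k)}). (\<Sum>j\<in>net_index k. \<bar>z j\<bar>) \<le> int (8 * k)}"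

lemma finite_net_codes: "finite (net_codes k)"
proof -
  have "finite (PiE (net_index k) (\<lambda>_. {- int (8 * k)..int (8 * k)}))"
    by (rule finite_PiE) (simp_all add: net_index_def)
  then show ?thesis unfolding net_codes_def by (rule rev_finite_subset) blast
qed

lemma sum_half_powers: "(\<Sum>m\<in>{- int M..int M}. (1 / 2) ^ nat \<bar>m\<bar>) \<le> (3 :: real)"
proof -
  have "(\<Sum>m\<in>{- int M..int M}. (1 / 2) ^ nat \<bar>m\<bar>) = 3 - 2 * (1 / 2 :: real) ^ M"
  proof (induction M)
    case (Suc M)
    have "{- int (Suc M)..int (Suc M)} = insert (- int (Suc M)) (insert (int (Suc M)) {- int M..int M})" by auto
    then have "(\<Sum>m\<in>{- int (Suc M)..int (Suc M)}. (1 / 2) ^ nat \<bar>m\<bar>) = (1 / 2) ^ Suc M + ((1 / 2) ^ Suc M + (\<Sum>m\<in>{- int M..int M}. (1 / 2 :: real) ^ nat \<bar>m\<bar>))"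
      by (simp add: nat_add_distrib)
    then show ?case using Suc by simp
  qed simp
  then show ?thesis by simp
qed

text \<open>Every code is weighted with \<open>2\<close> to the power minus the sum of its absolute values, which is at least
  \<open>2\<close> to the power \<open>- 8 * k\<close>. The weights of all integer vectors sum to at most \<open>3\<close> to the power \<open>2 * k\<close>,
  and \<open>2304 = 3\<^sup>2 * 2\<^sup>8\<close>.\<close>

lemma card_net_codes: "real (card (net_codes k)) \<le> 2304 ^ k"
proof -
  let ?J = "net_index k" and ?R = "{- int (8 * k)..int (8 * k)}"
  have fJ: "finite ?J" and cJ: "card ?J = 2 * k" by (simp_all add: net_index_def)
  have "real (card (net_codes k)) * (1 / 2) ^ (8 * k) = (\<Sum>z\<in>net_codes k. (1 / 2) ^ (8 * k))" by simp
  also have "\<dots> \<le> (\<Sum>z\<in>net_codes k. \<Prod>j\<in>?J. (1 / 2) ^ nat \<bar>z j\<bar>)"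
  proof (rule sum_mono)
    fix z assume "z \<in> net_codes k"
    then have "(\<Sum>j\<in>?J. \<bar>z j\<bar>) \<le> int (8 * k)" by (simp add: net_codes_def)
    moreover have "int (\<Sum>j\<in>?J. nat \<bar>z j\<bar>) = (\<Sum>j\<in>?J. \<bar>z j\<bar>)" by simp
    ultimately have "(\<Sum>j\<in>?J. nat \<bar>z j\<bar>) \<le> 8 * k" by linarith
    then show "(1 / 2 :: real) ^ (8 * k) \<le> (\<Prod>j\<in>?J. (1 / 2) ^ nat \<bar>z j\<bar>)"
      unfolding power_sum[symmetric] by (intro power_decreasing) auto
  qed
  also have "\<dots> \<le> (\<Sum>z\<in>PiE ?J (\<lambda>_. ?R). \<Prod>j\<in>?J. (1 / 2) ^ nat \<bar>z j\<bar>)"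
    using fJ by (intro sum_mono2 finite_PiE prod_nonneg) (auto simp: net_codes_def)
  also have "\<dots> = (\<Prod>j\<in>?J. \<Sum>m\<in>?R. (1 / 2) ^ nat \<bar>m\<bar>)"
    using fJ by (subst prod_sum_PiE) auto
  also have "\<dots> \<le> 3 ^ (2 * k)"
    using sum_half_powers[of "8 * k"] by (simp add: cJ power_mono sum_nonneg)
  finally have "real (card (net_codes k)) \<le> 3 ^ (2 * k) * 2 ^ (8 * k)" by (simp add: power_one_over field_simps)
  also have "\<dots> = (3 ^ 2 * 2 ^ 8) ^ k" by (simp only: power_mult power_mult_distrib)
  finally show ?thesis by simp
qed

definition net_vec :: "nat \<Rightarrow> (nat \<times> bool \<Rightarrow> int) \<Rightarrow> complex vec" where
  "net_vec k z = vec k (\<lambda>a. of_real (1 / (4 * sqrt (2 * real k))) * Complex (of_int (z (a, False))) (of_int (z (a, True))))"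

lemma round_to_zero:
  fixes r :: real
  obtains m :: int where "\<bar>of_int m\<bar> \<le> \<bar>r\<bar>" "\<bar>r - of_int m\<bar> \<le> 1"
proof (cases "r \<ge> 0")
  case True
  then have "0 \<le> real_of_int \<lfloor>r\<rfloor>" by simp
  moreover have "real_of_int \<lfloor>r\<rfloor> \<le> r" "r < real_of_int \<lfloor>r\<rfloor> + 1" by linarith+
  ultimately show ?thesis using that[of "\<lfloor>r\<rfloor>"] by linarith
next
  case False
  then have "real_of_int \<lceil>r\<rceil> \<le> 0" by simp
  moreover have "r \<le> real_of_int \<lceil>r\<rceil>" "real_of_int \<lceil>r\<rceil> < r + 1" by linarith+
  ultimately show ?thesis using that[of "\<lceil>r\<rceil>"] by linarith
qed

text \<open>Real and imaginary parts are rounded towards zero to multiples of the step \<open>1 / (4 * sqrt (2 * k))\<close>. The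
  direction of rounding keeps the point in the unit ball, and \<open>2 * k\<close> errors of at most one step each have the
  Euclidean norm \<open>1 / 4\<close> or less.\<close>

lemma net_vec_dense:
  assumes k: "k > 0" and u: "u \<in> carrier_vec k" "vec_l2norm u \<le> 1"
  shows "\<exists>z\<in>net_codes k. vec_l2norm (net_vec k z) \<le> 1 \<and> vec_l2norm (u - net_vec k z) \<le> 1 / 4"
proof -
  \<comment> \<open>The step of the lattice, as in \<open>net_vec\<close>.\<close>
  define h where "h = 1 / (4 * sqrt (2 * real k))"
  have h: "h > 0" using k by (simp add: h_def)
  have h2: "2 * real k * h\<^sup>2 = 1 / 16" using k by (simp add: h_def power_divide power_mult_distrib)
  define r where "r j = (if snd j then Im (u $ fst j) else Re (u $ fst j)) / h" for j :: "nat \<times> bool"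
  have "\<forall>j. \<exists>m::int. \<bar>of_int m\<bar> \<le> \<bar>r j\<bar> \<and> \<bar>r j - of_int m\<bar> \<le> 1"
    using round_to_zero by metis
  then obtain m :: "nat \<times> bool \<Rightarrow> int" where m: "\<And>j. \<bar>of_int (m j)\<bar> \<le> \<bar>r j\<bar>" "\<And>j. \<bar>r j - of_int (m j)\<bar> \<le> 1" by metis
  define z where "z = restrict m (net_index k)"
  have J: "finite (net_index k)" "card (net_index k) = 2 * k" by (simp_all add: net_index_def)
  have sumJ: "(\<Sum>j\<in>net_index k. f j) = (\<Sum>a<k. f (a, False) + f (a, True))" for f :: "nat \<times> bool \<Rightarrow> real"
  proof -
    have "(\<Sum>j\<in>net_index k. f j) = (\<Sum>a<k. \<Sum>b\<in>UNIV. f (a, b))"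
      by (simp add: net_index_def sum.cartesian_product)
    then show ?thesis by (simp add: UNIV_bool)
  qed
  have ur: "Re (u $ a) = h * r (a, False)" "Im (u $ a) = h * r (a, True)" for a using h by (simp_all add: r_def)
  have dim: "dim_vec u = k" using u by simp
  have "h\<^sup>2 * (\<Sum>j\<in>net_index k. (r j)\<^sup>2) = (vec_l2norm u)\<^sup>2"
    unfolding vec_l2norm_square sumJ dim cmod_power2 ur by (simp add: sum_distrib_left power_mult_distrib distrib_left)
  also have "\<dots> \<le> 1" using u(2) by (simp add: power_le_one)
  finally have r2: "h\<^sup>2 * (\<Sum>j\<in>net_index k. (r j)\<^sup>2) \<le> 1" .
  have "(\<Sum>j\<in>net_index k. \<bar>real_of_int (m j)\<bar>) \<le> (\<Sum>j\<in>net_index k. \<bar>r j\<bar>)" by (intro sum_mono m)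
  also have "\<dots> = (\<Sum>j\<in>net_index k. \<bar>1\<bar> * \<bar>r j\<bar>)" by simp
  also have "\<dots> \<le> L2_set (\<lambda>_. 1) (net_index k) * L2_set r (net_index k)" by (rule L2_set_mult_ineq)
  also have "L2_set (\<lambda>_. 1) (net_index k) = sqrt (2 * real k)" by (simp add: L2_set_constant J)
  also have "L2_set r (net_index k) \<le> 1 / h"
    unfolding L2_set_def using r2 h by (intro real_le_lsqrt) (auto simp: field_simps power_divide sum_nonneg)
  finally have "(\<Sum>j\<in>net_index k. \<bar>real_of_int (m j)\<bar>) \<le> sqrt (2 * real k) * (1 / h)" by (simp add: mult_left_mono)
  also have "\<dots> = real (8 * k)" using k by (simp add: h_def)
  finally have sm_real: "(\<Sum>j\<in>net_index k. \<bar>real_of_int (m j)\<bar>) \<le> real (8 * k)" .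
  have "real_of_int (\<Sum>j\<in>net_index k. \<bar>m j\<bar>) = (\<Sum>j\<in>net_index k. \<bar>real_of_int (m j)\<bar>)" by simp
  with sm_real have "real_of_int (\<Sum>j\<in>net_index k. \<bar>m j\<bar>) \<le> real_of_int (int (8 * k))" by simp
  then have sm: "(\<Sum>j\<in>net_index k. \<bar>m j\<bar>) \<le> int (8 * k)" unfolding of_int_le_iff .
  have zm: "z j = m j" if "j \<in> net_index k" for j using that by (simp add: z_def)
  have bnd: "- int (8 * k) \<le> m j \<and> m j \<le> int (8 * k)" if "j \<in> net_index k" for j
    using member_le_sum[of j "net_index k" "\<lambda>j. \<bar>m j\<bar>"] J(1) that sm by linarith
  have mem: "z \<in> net_codes k"
    using sm bnd unfolding net_codes_def by (simp add: z_def PiE_iff)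
  have zi: "net_vec k z $ a = of_real h * Complex (of_int (m (a, False))) (of_int (m (a, True)))" if "a < k" for a
    using that zm[of "(a, False)"] zm[of "(a, True)"] by (simp add: net_vec_def h_def net_index_def)
  have "(vec_l2norm (net_vec k z))\<^sup>2 = h\<^sup>2 * (\<Sum>j\<in>net_index k. (of_int (m j))\<^sup>2)"
  proof -
    have d: "dim_vec (net_vec k z) = k" by (simp add: net_vec_def)
    show ?thesis unfolding vec_l2norm_square sumJ d sum_distrib_left
      by (intro sum.cong refl) (simp add: zi cmod_power2 power_mult_distrib distrib_left)
  qed
  also have "\<dots> \<le> h\<^sup>2 * (\<Sum>j\<in>net_index k. (r j)\<^sup>2)"
    using m(1) by (intro mult_left_mono sum_mono) (auto simp: abs_le_square_iff)
  finally have "(vec_l2norm (net_vec k z))\<^sup>2 \<le> 1\<^sup>2" using r2 by simp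
  then have le1: "vec_l2norm (net_vec k z) \<le> 1" by (rule power2_le_imp_le) simp
  have "(vec_l2norm (u - net_vec k z))\<^sup>2 \<le> (1 / 4)\<^sup>2"
  proof -
    have d: "dim_vec (u - net_vec k z) = k" by (simp add: net_vec_def)
    have "(vec_l2norm (u - net_vec k z))\<^sup>2 = h\<^sup>2 * (\<Sum>j\<in>net_index k. (r j - of_int (m j))\<^sup>2)"
      unfolding vec_l2norm_square sumJ d sum_distrib_left
    proof (intro sum.cong refl)
      fix a assume "a \<in> {..<k}"
      then have a: "a < k" by simp
      have "(u - net_vec k z) $ a = u $ a - net_vec k z $ a" using a u by (simp add: net_vec_def)
      then have "Re ((u - net_vec k z) $ a) = h * (r (a, False) - of_int (m (a, False)))" "Im ((u - net_vec k z) $ a) = h * (r (a, True) - of_int (m (a, True)))"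
        unfolding zi[OF a] by (simp_all add: ur right_diff_distrib)
      then show "(cmod ((u - net_vec k z) $ a))\<^sup>2 = h\<^sup>2 * ((r (a, False) - of_int (m (a, False)))\<^sup>2 + (r (a, True) - of_int (m (a, True)))\<^sup>2)"
        unfolding cmod_power2 by (simp add: power_mult_distrib distrib_left)
    qed
    also have "\<dots> \<le> h\<^sup>2 * (\<Sum>j\<in>net_index k. 1)"
      using m(2) by (intro mult_left_mono sum_mono) (auto simp: abs_square_le_1)
    also have "\<dots> = (1 / 4)\<^sup>2" using h2 by (simp add: J power2_eq_square mult_ac)
    finally show ?thesis .
  qed
  then have "vec_l2norm (u - net_vec k z) \<le> 1 / 4" by (rule power2_le_imp_le) simp
  with mem le1 show ?thesis by blast
qed

section \<open>Operator norms of Gaussian matrices\<close>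

lemma gauss1_exp:
  assumes "\<sigma> > 0"
  shows "integrable (gauss1 \<sigma>) (\<lambda>x. exp (s * x))" "(\<integral>x. exp (s * x) \<partial>gauss1 \<sigma>) = exp (s\<^sup>2 * \<sigma>\<^sup>2 / 2)"
proof -
  have e: "normal_density 0 \<sigma> x * exp (s * x) = exp (s\<^sup>2 * \<sigma>\<^sup>2 / 2) * normal_density (\<sigma>\<^sup>2 * s) \<sigma> x" for x
  proof -
    have "- (x - 0)\<^sup>2 / (2 * \<sigma>\<^sup>2) + s * x = s\<^sup>2 * \<sigma>\<^sup>2 / 2 + - (x - \<sigma>\<^sup>2 * s)\<^sup>2 / (2 * \<sigma>\<^sup>2)"
      using assms by (simp add: field_simps power2_eq_square)
    then show ?thesis unfolding normal_density_def
      by (simp only: mult.assoc mult.left_commute[of "exp (s\<^sup>2 * \<sigma>\<^sup>2 / 2)"] flip: exp_add)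
  qed
  show "integrable (gauss1 \<sigma>) (\<lambda>x. exp (s * x))"
    unfolding gauss1_def using assms by (subst integrable_density) (auto simp: normal_density_nonneg e integrable_normal_density)
  show "(\<integral>x. exp (s * x) \<partial>gauss1 \<sigma>) = exp (s\<^sup>2 * \<sigma>\<^sup>2 / 2)"
    unfolding gauss1_def using assms by (subst integral_density) (auto simp: normal_density_nonneg e integral_normal_density)
qed

lemma gauss_linear_measurable: "(\<lambda>c. \<Sum>i\<in>I. g i * c i) \<in> borel_measurable (gauss \<sigma> I)"
proof (rule borel_measurable_sum)
  fix i assume i: "i \<in> I"
  have "(\<lambda>c. c i) \<in> measurable (gauss \<sigma> I) (gauss1 \<sigma>)"
    unfolding gauss_def using i by (rule measurable_component_singleton)
  also have "measurable (gauss \<sigma> I) (gauss1 \<sigma>) = borel_measurable (gauss \<sigma> I)"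
    by (rule measurable_cong_sets) auto
  finally show "(\<lambda>c. g i * c i) \<in> borel_measurable (gauss \<sigma> I)" by (rule borel_measurable_times[OF borel_measurable_const])
qed

text \<open>The exponential Markov inequality, with the optimal exponent \<open>T / \<sigma>\<^sup>2\<close>.\<close>

lemma gauss_linear_tail:
  assumes \<sigma>: "\<sigma> > 0" and I: "finite I" and g: "(\<Sum>i\<in>I. (g i)\<^sup>2) \<le> 1" and T: "T > 0"
  shows "measure (gauss \<sigma> I) {c \<in> space (gauss \<sigma> I). T \<le> (\<Sum>i\<in>I. g i * c i)} \<le> exp (- T\<^sup>2 / (2 * \<sigma>\<^sup>2))"
proof -
  interpret G1: prob_space "gauss1 \<sigma>" by (rule prob_space_gauss1) fact
  interpret product_sigma_finite "\<lambda>_. gauss1 \<sigma>" ..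
  define s where "s = T / \<sigma>\<^sup>2"
  have s: "s > 0" using T \<sigma> by (simp add: s_def)
  let ?X = "\<lambda>c. \<Sum>i\<in>I. g i * c i"
  have e: "exp (s * ?X c) = (\<Prod>i\<in>I. exp (s * g i * c i))" for c
    by (simp add: sum_distrib_left exp_sum I mult.assoc)
  have int: "integrable (gauss \<sigma> I) (\<lambda>c. exp (s * ?X c))"
    unfolding e gauss_def by (intro product_integrable_prod gauss1_exp I \<sigma>)
  have "(\<integral>c. exp (s * ?X c) \<partial>gauss \<sigma> I) = (\<Prod>i\<in>I. exp ((s * g i)\<^sup>2 * \<sigma>\<^sup>2 / 2))"
    unfolding e gauss_def by (subst product_integral_prod) (auto intro!: gauss1_exp I \<sigma> simp: gauss1_exp[OF \<sigma>])
  also have "\<dots> = exp (s\<^sup>2 * \<sigma>\<^sup>2 / 2 * (\<Sum>i\<in>I. (g i)\<^sup>2))"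
    by (simp add: exp_sum[OF I, symmetric] sum_distrib_left power_mult_distrib mult_ac)
  also have "\<dots> \<le> exp (s\<^sup>2 * \<sigma>\<^sup>2 / 2 * 1)"
    unfolding exp_le_cancel_iff using g by (intro mult_left_mono) auto
  finally have E: "(\<integral>c. exp (s * ?X c) \<partial>gauss \<sigma> I) \<le> exp (s\<^sup>2 * \<sigma>\<^sup>2 / 2)" by simp
  have "{c \<in> space (gauss \<sigma> I). T \<le> ?X c} = {c \<in> space (gauss \<sigma> I). exp (s * T) \<le> exp (s * ?X c)}"
    using s by auto
  also have "measure (gauss \<sigma> I) \<dots> \<le> (\<integral>c. exp (s * ?X c) \<partial>gauss \<sigma> I) / exp (s * T)"
    by (rule integral_Markov_inequality_measure[OF int, of "{}"]) auto
  also have "\<dots> \<le> exp (s\<^sup>2 * \<sigma>\<^sup>2 / 2) / exp (s * T)" using E by (intro divide_right_mono) auto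
  also have "\<dots> = exp (- T\<^sup>2 / (2 * \<sigma>\<^sup>2))"
    using \<sigma> by (simp add: exp_diff[symmetric] s_def field_simps power2_eq_square)
  finally show ?thesis .
qed

text \<open>The coefficients of the quadratic form of a self-adjoint matrix as a linear function of its coordinates.\<close>

definition qform :: "complex vec \<Rightarrow> nat \<Rightarrow> nat \<Rightarrow> real" where
  "qform v a b = (if a = b then (cmod (v $ a))\<^sup>2
     else if a < b then sqrt 2 * Re (cnj (v $ a) * v $ b) else - sqrt 2 * Im (cnj (v $ b) * v $ a))"

lemma sum_symmetrize:
  fixes f g :: "nat \<Rightarrow> nat \<Rightarrow> 'a::field_char_0"
  assumes "\<And>a b. a \<le> b \<Longrightarrow> f a b + f b a = g a b + g b a"
  shows "(\<Sum>a<k. \<Sum>b<k. f a b) = (\<Sum>a<k. \<Sum>b<k. g a b)"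
proof -
  have all: "f a b + f b a = g a b + g b a" for a b
    using assms[of a b] assms[of b a] by (cases "a \<le> b") (simp_all add: add.commute)
  have "2 * (\<Sum>a<k. \<Sum>b<k. h a b) = (\<Sum>a<k. \<Sum>b<k. h a b + h b a)" for h :: "nat \<Rightarrow> nat \<Rightarrow> 'a"
  proof -
    have "(\<Sum>a<k. \<Sum>b<k. h b a) = (\<Sum>a<k. \<Sum>b<k. h a b)" by (rule sum.swap)
    then show ?thesis by (simp add: sum.distrib)
  qed
  from this[of f] this[of g] have "2 * (\<Sum>a<k. \<Sum>b<k. f a b) = 2 * (\<Sum>a<k. \<Sum>b<k. g a b)" by (simp add: all)
  then show ?thesis by simp
qed

lemma cip_mat_of:
  assumes v: "v \<in> carrier_vec k"
  shows "cip v (mat_of k c l *\<^sub>v v) = of_real (\<Sum>a<k. \<Sum>b<k. qform v a b * c (l, a, b))"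
proof -
  have d: "x / sqrt 2 = sqrt 2 * x / 2" for x :: real
    by (simp add: field_simps)
  have "cip v (mat_of k c l *\<^sub>v v) = (\<Sum>a<k. \<Sum>b<k. cnj (v $ a) * (entry (\<lambda>e. of_real (c e)) l a b * v $ b))"
    using v by (simp add: cip_def mat_vec_index[of _ k] mat_of_index sum_distrib_left del: index_mult_mat_vec cong: sum.cong_simp)
  also have "\<dots> = (\<Sum>a<k. \<Sum>b<k. of_real (qform v a b * c (l, a, b)))"
  proof (rule sum_symmetrize)
    fix a b :: nat assume "a \<le> b"
    show "cnj (v $ a) * (entry (\<lambda>e. of_real (c e)) l a b * v $ b) + cnj (v $ b) * (entry (\<lambda>e. of_real (c e)) l b a * v $ a)
      = of_real (qform v a b * c (l, a, b)) + of_real (qform v b a * c (l, b, a))"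
    proof (cases "a = b")
      case True
      then show ?thesis using complex_norm_square[of "v $ b"] by (simp add: entry_def qform_def mult_ac)
    next
      case False
      then have "a < b" using \<open>a \<le> b\<close> by simp
      then show ?thesis
        by (simp add: entry_def qform_def complex_eq_iff d Re_divide Im_divide) (simp add: field_simps)
    qed
  qed
  finally show ?thesis by simp
qed

text \<open>The quadratic form at \<open>v\<close> is the Hilbert--Schmidt inner product with the rank one matrix of \<open>v\<close>, whose
  Hilbert--Schmidt norm is the square of the norm of \<open>v\<close>.\<close>

lemma sum_qform_square:
  assumes v: "v \<in> carrier_vec k"
  shows "(\<Sum>a<k. \<Sum>b<k. (qform v a b)\<^sup>2) = (vec_l2norm v) ^ 4"
proof -
  have "(\<Sum>a<k. \<Sum>b<k. (qform v a b)\<^sup>2) = (\<Sum>a<k. \<Sum>b<k. (cmod (v $ a))\<^sup>2 * (cmod (v $ b))\<^sup>2)"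
  proof (rule sum_symmetrize)
    fix a b :: nat assume "a \<le> b"
    show "(qform v a b)\<^sup>2 + (qform v b a)\<^sup>2 = (cmod (v $ a))\<^sup>2 * (cmod (v $ b))\<^sup>2 + (cmod (v $ b))\<^sup>2 * (cmod (v $ a))\<^sup>2"
    proof (cases "a = b")
      case False
      then have "(qform v a b)\<^sup>2 + (qform v b a)\<^sup>2 = 2 * (cmod (cnj (v $ a) * v $ b))\<^sup>2"
        using \<open>a \<le> b\<close> unfolding cmod_power2 by (simp add: qform_def power_mult_distrib)
      then show ?thesis by (simp add: norm_mult power_mult_distrib)
    qed (simp add: qform_def power2_eq_square)
  qed
  also have "\<dots> = (\<Sum>a<k. (cmod (v $ a))\<^sup>2) * (\<Sum>b<k. (cmod (v $ b))\<^sup>2)" by (simp add: sum_product)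
  also have "\<dots> = (vec_l2norm v) ^ 4" using v vec_l2norm_square[of v] by (simp add: power4_eq_xxxx power2_eq_square)
  finally show ?thesis .
qed

text \<open>At each point of the net the quadratic form is a Gaussian variable of variance at most \<open>1 / k\<close>, so
  it exceeds \<open>6\<close> in modulus with probability at most \<open>2 * exp (- 18 * k)\<close>. The net has at most \<open>2304 ^ k\<close>
  points, and \<open>2304 / 2 ^ 18\<close> is less than \<open>1 / 2\<close>. The bound \<open>12\<close> is twice \<open>6\<close>, by
  \<open>opnorm_le_net\<close>.\<close>

theorem gue_opnorm_tail:
  assumes k: "k > 0" and l: "l < n"
  defines "P \<equiv> gauss (1 / sqrt (real k)) (coord_set n k)"
  shows "\<exists>B\<in>sets P. measure P B \<le> 2 * (1 / 2) ^ k \<and> (\<forall>c\<in>space P - B. opnorm (mat_of k c l) \<le> 12)"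
proof -
  have \<sigma>: "1 / sqrt (real k) > 0" using k by simp
  interpret prob_space P unfolding P_def by (rule prob_space_gauss[OF \<sigma>])
  define Z where "Z = {z \<in> net_codes k. vec_l2norm (net_vec k z) \<le> 1}"
  \<comment> \<open>The sign \<open>\<epsilon>\<close> covers both tails of the quadratic form.\<close>
  define g where "g \<epsilon> z e = (if fst e = l then \<epsilon> * qform (net_vec k z) (fst (snd e)) (snd (snd e)) else 0)" for \<epsilon> :: real and z and e :: "nat \<times> nat \<times> nat"
  have nv: "net_vec k z \<in> carrier_vec k" for z by (simp add: net_vec_def)
  have sumI: "(\<Sum>e\<in>coord_set n k. if fst e = l then f (fst (snd e)) (snd (snd e)) else 0) = (\<Sum>a<k. \<Sum>b<k. f a b)" for f :: "nat \<Rightarrow> nat \<Rightarrow> real"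
  proof -
    have "(\<Sum>e\<in>coord_set n k. if fst e = l then f (fst (snd e)) (snd (snd e)) else 0) = (\<Sum>l'<n. \<Sum>ab\<in>{..<k} \<times> {..<k}. if l' = l then f (fst ab) (snd ab) else 0)"
      unfolding coord_set_def by (subst sum.cartesian_product) (auto intro!: sum.cong)
    also have "\<dots> = (\<Sum>l'<n. if l' = l then (\<Sum>ab\<in>{..<k} \<times> {..<k}. f (fst ab) (snd ab)) else 0)"
      by (intro sum.cong) auto
    also have "\<dots> = (\<Sum>ab\<in>{..<k} \<times> {..<k}. f (fst ab) (snd ab))" using l by simp
    also have "\<dots> = (\<Sum>a<k. \<Sum>b<k. f a b)" by (subst sum.cartesian_product) (auto simp: split_beta)
    finally show ?thesis .
  qed
  have lin: "(\<Sum>e\<in>coord_set n k. g \<epsilon> z e * c e) = \<epsilon> * (\<Sum>a<k. \<Sum>b<k. qform (net_vec k z) a b * c (l, a, b))" for \<epsilon> z c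
  proof -
    have "(\<Sum>e\<in>coord_set n k. g \<epsilon> z e * c e) = (\<Sum>e\<in>coord_set n k. if fst e = l then \<epsilon> * (qform (net_vec k z) (fst (snd e)) (snd (snd e)) * c (l, fst (snd e), snd (snd e))) else 0)"
      by (intro sum.cong) (auto simp: g_def)
    also have "\<dots> = \<epsilon> * (\<Sum>a<k. \<Sum>b<k. qform (net_vec k z) a b * c (l, a, b))"
      using sumI[of "\<lambda>a b. \<epsilon> * (qform (net_vec k z) a b * c (l, a, b))"] by (simp add: sum_distrib_left)
    finally show ?thesis .
  qed
  have g2: "(\<Sum>e\<in>coord_set n k. (g \<epsilon> z e)\<^sup>2) \<le> 1" if "z \<in> Z" "\<bar>\<epsilon>\<bar> = 1" for \<epsilon> z
  proof -
    have "\<epsilon>\<^sup>2 = 1" using that(2) by (metis one_power2 power2_abs)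
    then have "(\<Sum>e\<in>coord_set n k. (g \<epsilon> z e)\<^sup>2) = (\<Sum>e\<in>coord_set n k. if fst e = l then (qform (net_vec k z) (fst (snd e)) (snd (snd e)))\<^sup>2 else 0)"
      by (intro sum.cong) (auto simp: g_def power_mult_distrib)
    also have "\<dots> = (vec_l2norm (net_vec k z)) ^ 4"
      using sumI[of "\<lambda>a b. (qform (net_vec k z) a b)\<^sup>2"] sum_qform_square[OF nv, of z] by simp
    also have "\<dots> \<le> 1" using that by (simp add: Z_def power_le_one)
    finally show ?thesis .
  qed
  define B1 where "B1 \<epsilon> z = {c \<in> space P. 6 \<le> (\<Sum>e\<in>coord_set n k. g \<epsilon> z e * c e)}" for \<epsilon> z
  have mB1: "B1 \<epsilon> z \<in> sets P" for \<epsilon> z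
    unfolding B1_def P_def by (rule borel_measurable_le[OF borel_measurable_const gauss_linear_measurable])
  have pB1: "measure P (B1 \<epsilon> z) \<le> (1 / 2) ^ (18 * k)" if "z \<in> Z" "\<bar>\<epsilon>\<bar> = 1" for \<epsilon> z
  proof -
    have "measure P (B1 \<epsilon> z) \<le> exp (- 6\<^sup>2 / (2 * (1 / sqrt (real k))\<^sup>2))"
      unfolding B1_def P_def by (rule gauss_linear_tail[OF \<sigma> finite_coord_set g2[OF that]]) simp
    also have "- 6\<^sup>2 / (2 * (1 / sqrt (real k))\<^sup>2) = real (18 * k) * (- 1)" using k by (simp add: power_divide)
    also have "exp \<dots> = exp (- 1) ^ (18 * k)" by (rule exp_of_nat_mult)
    also have "\<dots> \<le> (1 / 2) ^ (18 * k)"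
    proof (rule power_mono)
      have "(2 :: real) \<le> exp 1" using exp_ge_add_one_self[of "1 :: real"] by simp
      then show "exp (- 1) \<le> (1 / 2 :: real)" by (simp add: exp_minus field_simps)
    qed simp
    finally show ?thesis .
  qed
  define B where "B = (\<Union>z\<in>Z. B1 1 z \<union> B1 (- 1) z)"
  have fZ: "finite Z" using finite_net_codes by (simp add: Z_def)
  have "measure P B \<le> (\<Sum>z\<in>Z. measure P (B1 1 z \<union> B1 (- 1) z))"
    unfolding B_def using mB1 by (intro finite_measure_subadditive_finite fZ) auto
  also have "\<dots> \<le> (\<Sum>z\<in>Z. 2 * (1 / 2) ^ (18 * k))"
  proof (rule sum_mono)
    fix z assume z: "z \<in> Z"
    have "measure P (B1 1 z \<union> B1 (- 1) z) \<le> measure P (B1 1 z) + measure P (B1 (- 1) z)"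
      using mB1 by (intro measure_Un_le)
    then show "measure P (B1 1 z \<union> B1 (- 1) z) \<le> 2 * (1 / 2) ^ (18 * k)"
      using pB1[OF z, of 1] pB1[OF z, of "- 1"] by simp
  qed
  also have "\<dots> = real (card Z) * (2 * (1 / 2) ^ (18 * k))" by simp
  also have "\<dots> \<le> 2304 ^ k * (2 * (1 / 2) ^ (18 * k))"
  proof (intro mult_right_mono)
    have "card Z \<le> card (net_codes k)" using finite_net_codes by (intro card_mono) (auto simp: Z_def)
    then show "real (card Z) \<le> 2304 ^ k" using card_net_codes[of k] by linarith
  qed simp
  also have "\<dots> = 2 * (2304 * (1 / 2) ^ 18) ^ k" by (simp only: power_mult power_mult_distrib)
  also have "\<dots> \<le> 2 * (1 / 2) ^ k" by (intro mult_left_mono power_mono) (auto simp: power_divide)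
  finally have pB: "measure P B \<le> 2 * (1 / 2) ^ k" .
  have "opnorm (mat_of k c l) \<le> 2 * 6" if c: "c \<in> space P - B" for c
  proof (rule opnorm_le_net[OF mat_of_sa, of "net_vec k ` Z"])
    fix v assume "v \<in> net_vec k ` Z"
    then obtain z where z: "z \<in> Z" "v = net_vec k z" by blast
    have "\<bar>\<Sum>a<k. \<Sum>b<k. qform v a b * c (l, a, b)\<bar> \<le> 6"
      using c z(1) lin[of 1 z c] lin[of "- 1" z c] unfolding B_def B1_def z(2) by (auto simp: not_le)
    then show "cmod (cip v (mat_of k c l *\<^sub>v v)) \<le> 6"
      unfolding cip_mat_of[OF nv[of z, folded z(2)]] norm_of_real .
  next
    fix u :: "complex vec" assume "u \<in> carrier_vec k" "vec_l2norm u \<le> 1"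
    then show "\<exists>v\<in>net_vec k ` Z. vec_l2norm (u - v) \<le> 1 / 4"
      using net_vec_dense[OF k] by (auto simp: Z_def)
  qed (auto simp: nv Z_def)
  moreover have "B \<in> sets P" unfolding B_def using mB1 fZ by (intro sets.finite_UN) auto
  ultimately show ?thesis using pB by (intro bexI[of _ B]) auto
qed

section \<open>Topology and Lebesgue measure in matrix coordinates\<close>

definition coord_lborel :: "nat \<Rightarrow> nat \<Rightarrow> coords measure" where
  "coord_lborel n k = PiM (coord_set n k) (\<lambda>_. lborel)"

text \<open>The product sigma-algebra is compared with the Borel sets of the product topology on all functions, so
  that closed and compact sets of coordinates are measurable.\<close>

lemma PiM_lborel_id_measurable:
  "(\<lambda>c. c) \<in> borel_measurable (PiM (I :: 'i::countable set) (\<lambda>_. lborel :: real measure))"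
proof (rule measurable_coordinatewise_then_product)
  fix e :: 'i
  show "(\<lambda>c. c e) \<in> borel_measurable (PiM I (\<lambda>_. lborel :: real measure))"
  proof (cases "e \<in> I")
    case True
    have "(\<lambda>c. c e) \<in> measurable (PiM I (\<lambda>_. lborel)) (lborel :: real measure)"
      using True by (rule measurable_component_singleton)
    also have "measurable (PiM I (\<lambda>_. lborel)) (lborel :: real measure) = borel_measurable (PiM I (\<lambda>_. lborel))"
      by (rule measurable_cong_sets) auto
    finally show ?thesis .
  next
    case False
    have "(\<lambda>c. c e) \<in> borel_measurable (PiM I (\<lambda>_. lborel :: real measure)) \<longleftrightarrow>
      (\<lambda>c. undefined :: real) \<in> borel_measurable (PiM I (\<lambda>_. lborel :: real measure))"
      by (rule measurable_cong) (use False in \<open>auto simp: space_PiM PiE_iff extensional_def\<close>)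
    then show ?thesis by simp
  qed
qed

lemma coord_lborel_borel_set:
  "S \<in> sets borel \<Longrightarrow> {c \<in> space (coord_lborel n k). c \<in> S} \<in> sets (coord_lborel n k)"
  using measurable_sets[OF PiM_lborel_id_measurable[of "coord_set n k"], of S]
  by (simp add: coord_lborel_def vimage_def Int_def conj_commute)

lemma sets_gauss: "sets (gauss \<sigma> I) = sets (PiM I (\<lambda>_. lborel))"
  unfolding gauss_def by (rule sets_PiM_cong) auto

lemma space_gauss: "space (gauss \<sigma> I) = space (PiM I (\<lambda>_. lborel))"
  by (rule sets_eq_imp_space_eq[OF sets_gauss])

lemma continuous_entry:
  "continuous_on UNIV (\<lambda>c :: coords. entry (\<lambda>e. of_real (c e)) l a b)"
proof -
  have c: "continuous_on UNIV (\<lambda>c :: coords. complex_of_real (c e))" for e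
    by (intro continuous_intros) simp
  consider "a = b" | "a < b" | "b < a" by linarith
  then show ?thesis
    by cases (simp_all add: entry_def c continuous_on_add continuous_on_diff continuous_on_divide continuous_on_mult_left)
qed

lemma continuous_mat_of: "a < k \<Longrightarrow> b < k \<Longrightarrow> continuous_on UNIV (\<lambda>c. mat_of k c l $$ (a, b))"
  by (simp add: mat_of_index continuous_entry)

lemma continuous_mat_word:
  fixes M :: "'c::topological_space \<Rightarrow> 'v \<Rightarrow> complex mat"
  assumes "\<And>c x. x \<in> set w \<Longrightarrow> M c x \<in> carrier_mat k k"
    and "\<And>x a b. x \<in> set w \<Longrightarrow> a < k \<Longrightarrow> b < k \<Longrightarrow> continuous_on UNIV (\<lambda>c. M c x $$ (a, b))"
  shows "a < k \<Longrightarrow> b < k \<Longrightarrow> continuous_on UNIV (\<lambda>c. mat_word k (M c) w $$ (a, b))"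
  using assms
proof (induction w arbitrary: a)
  case (Cons x w)
  have "mat_word k (M c) (x # w) $$ (a, b) = (\<Sum>s<k. M c x $$ (a, s) * mat_word k (M c) w $$ (s, b))" for c
  proof -
    have "mat_word k (M c) w \<in> carrier_mat k k" by (rule mat_word_carrier) (use Cons.prems in auto)
    moreover have "M c x \<in> carrier_mat k k" using Cons.prems by simp
    ultimately show ?thesis unfolding mat_word_Cons using Cons.prems(1,2) by (intro mat_mult_index)
  qed
  moreover have "continuous_on UNIV (\<lambda>c. \<Sum>s<k. M c x $$ (a, s) * mat_word k (M c) w $$ (s, b))"
    using Cons by (intro continuous_on_sum continuous_on_mult) auto
  ultimately show ?case by simp
qed simp

lemma continuous_ntrace_mat_word:
  fixes M :: "'c::topological_space \<Rightarrow> 'v \<Rightarrow> complex mat"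
  assumes "\<And>c x. x \<in> set w \<Longrightarrow> M c x \<in> carrier_mat k k"
    and "\<And>x a b. x \<in> set w \<Longrightarrow> a < k \<Longrightarrow> b < k \<Longrightarrow> continuous_on UNIV (\<lambda>c. M c x $$ (a, b))"
  shows "continuous_on UNIV (\<lambda>c. ntrace k (mat_word k (M c) w))"
proof (cases "k = 0")
  case False
  have "continuous_on UNIV (\<lambda>c. \<Sum>i<k. mat_word k (M c) w $$ (i, i))"
    by (rule continuous_on_sum) (rule continuous_mat_word[OF assms], auto)
  then show ?thesis unfolding ntrace_def using False by (intro continuous_on_divide) auto
qed (simp add: ntrace_def)

lemma closed_opnorm_le:
  fixes F :: "'c::topological_space \<Rightarrow> complex mat"
  assumes F: "\<And>c. F c \<in> carrier_mat k k"
    and c: "\<And>a b. a < k \<Longrightarrow> b < k \<Longrightarrow> continuous_on UNIV (\<lambda>c. F c $$ (a, b))"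
  shows "closed {c. opnorm (F c) \<le> R}"
proof -
  define V where "V = {v :: complex vec. v \<in> carrier_vec k \<and> vec_l2norm v \<le> 1}"
  have "{c. opnorm (F c) \<le> R} = (\<Inter>v\<in>V. {c. vec_l2norm (F c *\<^sub>v v) \<le> R})"
    using opnorm_le_iff[OF F] by (auto simp: V_def)
  moreover have "closed {c. vec_l2norm (F c *\<^sub>v v) \<le> R}" if v: "v \<in> V" for v
  proof (rule closed_Collect_le)
    have "vec_l2norm (F c *\<^sub>v v) = sqrt (\<Sum>i<k. (cmod (\<Sum>j<k. F c $$ (i, j) * v $ j))\<^sup>2)" for c
    proof -
      have d: "dim_vec (F c *\<^sub>v v) = k" using F[of c] by simp
      have "(F c *\<^sub>v v) $ i = (\<Sum>j<k. F c $$ (i, j) * v $ j)" if "i < k" for i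
      proof -
        have "v \<in> carrier_vec k" using v by (simp add: V_def)
        then show ?thesis using F[of c] that by (simp add: scalar_prod_def atLeast0LessThan)
      qed
      then show ?thesis unfolding vec_l2norm_def L2_set_def d by simp
    qed
    moreover have "continuous_on UNIV (\<lambda>c. sqrt (\<Sum>i<k. (cmod (\<Sum>j<k. F c $$ (i, j) * v $ j))\<^sup>2))"
      by (intro continuous_on_real_sqrt continuous_on_sum continuous_on_power continuous_on_norm continuous_on_mult_right c) auto
    ultimately show "continuous_on UNIV (\<lambda>c. vec_l2norm (F c *\<^sub>v v))" by simp
  qed simp
  ultimately show ?thesis by (simp add: closed_INT)
qed

definition coords_of :: "nat \<Rightarrow> nat \<Rightarrow> (nat \<Rightarrow> complex mat) \<Rightarrow> coords" where
  "coords_of n k A = (\<lambda>(l, i, j)\<in>coord_set n k. if i = j then Re (A l $$ (i, i))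
     else if i < j then sqrt 2 * Re (A l $$ (i, j)) else sqrt 2 * Im (A l $$ (j, i)))"

lemma coords_of_extensional: "coords_of n k A \<in> extensional (coord_set n k)"
  by (simp add: coords_of_def)

lemma mat_of_coords_of:
  assumes "A l \<in> sa_mats k" "l < n"
  shows "mat_of k (coords_of n k A) l = A l"
proof (rule eq_matI)
  have c: "A l \<in> carrier_mat k k" using assms by (intro sa_mats_carrier)
  show "dim_row (mat_of k (coords_of n k A) l) = dim_row (A l)" "dim_col (mat_of k (coords_of n k A) l) = dim_col (A l)"
    using c by auto
  fix a b assume "a < dim_row (A l)" "b < dim_col (A l)"
  then have ab: "a < k" "b < k" using c by auto
  have s: "cnj (A l $$ (a, b)) = A l $$ (b, a)" by (rule sa_mats_index[OF assms(1) ab])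
  have d: "cnj (A l $$ (a, a)) = A l $$ (a, a)" by (rule sa_mats_index[OF assms(1) ab(1) ab(1)])
  consider "a = b" | "a < b" | "b < a" by linarith
  then show "mat_of k (coords_of n k A) l $$ (a, b) = A l $$ (a, b)"
  proof cases
    case 1
    then show ?thesis using ab assms(2) d
      by (simp add: mat_of_index entry_def coords_of_def coord_set_def complex_eq_iff)
  next
    case 2
    then show ?thesis using ab assms(2)
      by (simp add: mat_of_index entry_def coords_of_def coord_set_def complex_eq_iff Re_divide Im_divide)
  next
    case 3
    have "sqrt 2 * y * sqrt 2 = y * (sqrt 2 * sqrt 2)" for y :: real by (simp only: mult_ac)
    then have q: "sqrt 2 * y * sqrt 2 / 2 = y" for y :: real by simp
    show ?thesis using 3 ab assms(2) s
      by (auto simp: mat_of_index entry_def coords_of_def coord_set_def complex_eq_iff Re_divide Im_divide)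
         (use q[of "Im (A l $$ (b, a))"] in linarith)
  qed
qed

lemma mat_of_inj:
  assumes "mat_of k c l = mat_of k c' l" "i < k" "j < k"
  shows "c (l, i, j) = c' (l, i, j)"
proof -
  have e: "entry (\<lambda>e. of_real (c e)) l a b = entry (\<lambda>e. of_real (c' e)) l a b" if "a < k" "b < k" for a b
    using assms(1) that by (metis mat_of_index)
  consider "i = j" | "i < j" | "j < i" by linarith
  then show ?thesis
  proof cases
    case 1
    then show ?thesis using e[OF assms(2) assms(2)] by (simp add: entry_def)
  next
    case 2
    then show ?thesis using e[OF assms(2,3)] by (simp add: entry_def complex_eq_iff)
  next
    case 3
    then show ?thesis using e[OF assms(3,2)] by (simp add: entry_def complex_eq_iff)
  qed
qed

lemma mat_of_cong: "(\<And>i j. i < k \<Longrightarrow> j < k \<Longrightarrow> c (l, i, j) = c' (l, i, j)) \<Longrightarrow> mat_of k c l = mat_of k c' l"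
  by (rule eq_matI) (auto simp: mat_of_index entry_def)

text \<open>The factor \<open>2\<close> is a convenient bound for the factor \<open>sqrt 2\<close> of the off-diagonal coordinates.\<close>

lemma abs_coord_le:
  assumes "opnorm (mat_of k c l) \<le> R" "i < k" "j < k"
  shows "\<bar>c (l, i, j)\<bar> \<le> 2 * R"
proof -
  have b: "cmod (entry (\<lambda>e. of_real (c e)) l a b) \<le> R" if "a < k" "b < k" for a b
    using index_le_opnorm[OF mat_of_carrier that, of c l] assms(1) that by (simp add: mat_of_index)
  have R: "0 \<le> R" using order_trans[OF norm_ge_zero b[OF assms(2,2)]] .
  have s: "x / sqrt 2 \<le> R \<Longrightarrow> x \<le> 2 * R" if "0 \<le> x" for x
  proof -
    assume "x / sqrt 2 \<le> R"
    then have "x \<le> sqrt 2 * R" by (simp add: field_simps)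
    also have "\<dots> \<le> 2 * R" using R by (intro mult_right_mono) (auto simp: real_le_lsqrt)
    finally show ?thesis .
  qed
  consider "i = j" | "i < j" | "j < i" by linarith
  then show ?thesis
  proof cases
    case 1
    then show ?thesis using b[OF assms(2,2)] R by (simp add: entry_def)
  next
    case 2
    have "\<bar>c (l, i, j)\<bar> / sqrt 2 \<le> R"
      using abs_Re_le_cmod[of "entry (\<lambda>e. of_real (c e)) l i j"] b[OF assms(2,3)] 2 by (simp add: entry_def)
    then show ?thesis by (rule s[rotated]) simp
  next
    case 3
    have "\<bar>c (l, i, j)\<bar> / sqrt 2 \<le> R"
      using abs_Im_le_cmod[of "entry (\<lambda>e. of_real (c e)) l j i"] b[OF assms(3,2)] 3 by (simp add: entry_def)
    then show ?thesis by (rule s[rotated]) simp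
  qed
qed

section \<open>Measurability of projected microstate sets\<close>

lemma finite_index_words: "finite {w :: nat list. set w \<subseteq> {..<N} \<and> length w \<le> m}"
  using finite_lists_length_le[of "{..<N}" m] by (simp add: conj_commute)

definition coord_tuple :: "nat \<Rightarrow> nat \<Rightarrow> coords \<Rightarrow> nat \<Rightarrow> complex mat" where
  "coord_tuple n k c = (\<lambda>l\<in>{..<n}. mat_of k c l)"

lemma sa_volume_eq: "sa_volume n k S = emeasure (coord_lborel n k) {c \<in> space (coord_lborel n k). coord_tuple n k c \<in> S}"
  by (simp add: sa_volume_def coord_lborel_def coord_set_def coord_tuple_def mat_of_def Let_def)

lemma mat_word_coord_tuple:
  "set w \<subseteq> {..<n} \<Longrightarrow> mat_word k (coord_tuple n k c) w = mat_word k (mat_of k c) w"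
  by (induction w) (simp_all add: coord_tuple_def)

lemma coord_tuple_microstates:
  "coord_tuple N k c \<in> microstates \<phi> N z R k m \<epsilon> \<longleftrightarrow>
    (\<forall>i<N. opnorm (mat_of k c i) \<le> R)
     \<and> (\<forall>w. set w \<subseteq> {..<N} \<and> 1 \<le> length w \<and> length w \<le> m \<longrightarrow>
          cmod (ntrace k (mat_word k (mat_of k c) w) - \<phi> (prod_list (map z w))) < \<epsilon>)"
proof -
  have "coord_tuple N k c \<in> sa_tuples N k" by (auto simp: sa_tuples_def coord_tuple_def mat_of_sa)
  then show ?thesis by (auto simp: microstates_def mat_word_coord_tuple) (auto simp: coord_tuple_def)
qed

text \<open>A projection of a measurable set need not be a Borel set, but here the projected set is a countable union of
  compact sets: the strict inequalities for the moments are exhausted by weak ones, and the bound for the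
  operator norms makes the resulting closed sets bounded. The projection of a compact set is compact.\<close>

lemma rel_microstates_measurable:
  fixes \<phi> :: "'b::monoid_mult \<Rightarrow> complex"
  shows "{c \<in> space (coord_lborel n k). coord_tuple n k c \<in> rel_microstates \<phi> n z q w R k m \<epsilon>} \<in> sets (coord_lborel n k)"
proof -
  define N where "N = n + q"
  define zz where "zz = (\<lambda>i. if i < n then z i else w (i - n))"
  define W where "W = {w :: nat list. set w \<subseteq> {..<N} \<and> 1 \<le> length w \<and> length w \<le> m}"
  define f where "f v c = cmod (ntrace k (mat_word k (mat_of k c) v) - \<phi> (prod_list (map zz v)))" for v c
  have fW: "finite W" unfolding W_def by (rule finite_subset[OF _ finite_index_words[of N m]]) auto
  \<comment> \<open>Outside the finitely many coordinates the functions have the default value, so this is a product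
  of compact sets.\<close>
  define box where "box = PiE UNIV (\<lambda>e. if e \<in> coord_set N k then {- (2 * R)..2 * R} else {undefined :: real})"
  \<comment> \<open>Closed conditions which exhaust the strict inequalities.\<close>
  define E where "E j = {c. \<forall>i<N. opnorm (mat_of k c i) \<le> R} \<inter> {c. \<forall>v\<in>W. f v c \<le> \<epsilon> - 1 / real (Suc j)}" for j
  define rs where "rs c = restrict c (coord_set n k)" for c :: coords
  have "compact box"
  proof -
    have "compactin (product_topology (\<lambda>i. euclidean) UNIV) box"
      unfolding box_def compactin_PiE by simp
    then show ?thesis by (simp add: euclidean_product_topology)
  qed
  moreover have "closed (E j)" for j
  proof -
    have "closed {c. opnorm (mat_of k c i) \<le> R}" for i
      by (rule closed_opnorm_le[OF mat_of_carrier continuous_mat_of])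
    moreover have "closed {c. f v c \<le> \<epsilon> - 1 / real (Suc j)}" for v
      unfolding f_def
      by (intro closed_Collect_le continuous_on_norm continuous_on_diff continuous_ntrace_mat_word continuous_on_const) (auto intro: continuous_mat_of)
    ultimately have "closed ((\<Inter>i\<in>{..<N}. {c. opnorm (mat_of k c i) \<le> R}) \<inter> (\<Inter>v\<in>W. {c. f v c \<le> \<epsilon> - 1 / real (Suc j)}))"
      by (intro closed_Int closed_INT) auto
    moreover have "(\<Inter>i\<in>{..<N}. {c. opnorm (mat_of k c i) \<le> R}) \<inter> (\<Inter>v\<in>W. {c. f v c \<le> \<epsilon> - 1 / real (Suc j)}) = E j"
      by (auto simp: E_def)
    ultimately show ?thesis by simp
  qed
  ultimately have "compact (box \<inter> E j)" for j by (rule compact_Int_closed)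
  moreover have "continuous_on UNIV rs"
  proof (rule continuous_on_coordinatewise_then_product)
    fix e show "continuous_on UNIV (\<lambda>c. rs c e)" by (cases "e \<in> coord_set n k") (simp_all add: rs_def)
  qed
  ultimately have "compact (rs ` (box \<inter> E j))" for j
    by (intro compact_continuous_image) (auto intro: continuous_on_subset)
  then have "rs ` (box \<inter> E j) \<in> sets borel" for j by (intro borel_closed compact_imp_closed)
  then have meas: "{c \<in> space (coord_lborel n k). c \<in> rs ` (box \<inter> E j)} \<in> sets (coord_lborel n k)" for j
    by (rule coord_lborel_borel_set)
  have "{c \<in> space (coord_lborel n k). coord_tuple n k c \<in> rel_microstates \<phi> n z q w R k m \<epsilon>} =
     (\<Union>j. {c \<in> space (coord_lborel n k). c \<in> rs ` (box \<inter> E j)})"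
  proof (intro equalityI subsetI)
    fix c assume c: "c \<in> {c \<in> space (coord_lborel n k). coord_tuple n k c \<in> rel_microstates \<phi> n z q w R k m \<epsilon>}"
    then obtain A where A: "A \<in> microstates \<phi> N zz R k m \<epsilon>" "coord_tuple n k c = restrict A {..<n}"
      unfolding rel_microstates_def N_def zz_def by auto
    define d where "d = coords_of N k A"
    have Asa: "A \<in> sa_tuples N k" using A(1) by (simp add: microstates_def)
    then have mo: "mat_of k d l = A l" if "l < N" for l
      unfolding d_def using that by (intro mat_of_coords_of) (auto simp: sa_tuples_def)
    have "coord_tuple N k d = A"
      using Asa mo by (intro extensionalityI[of _ "{..<N}"]) (auto simp: coord_tuple_def sa_tuples_def PiE_iff)
    then have "coord_tuple N k d \<in> microstates \<phi> N zz R k m \<epsilon>" using A(1) by simp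
    then have d1: "\<forall>i<N. opnorm (mat_of k d i) \<le> R" and d2: "\<forall>v\<in>W. f v d < \<epsilon>"
      unfolding coord_tuple_microstates W_def f_def by auto
    have "\<forall>\<^sub>F j in sequentially. \<forall>v\<in>W. f v d \<le> \<epsilon> - 1 / real (Suc j)"
    proof (rule eventually_ball_finite[OF fW], rule ballI)
      fix v assume "v \<in> W"
      then have p: "\<epsilon> - f v d > 0" using d2 by simp
      have "(\<lambda>j. 1 / real (Suc j)) \<longlonglongrightarrow> 0" by (rule LIMSEQ_Suc[OF lim_1_over_n])
      from order_tendstoD(2)[OF this p] show "\<forall>\<^sub>F j in sequentially. f v d \<le> \<epsilon> - 1 / real (Suc j)"
        by eventually_elim simp
    qed
    then obtain j where "\<forall>v\<in>W. f v d \<le> \<epsilon> - 1 / real (Suc j)" using eventually_happens'[OF sequentially_bot] by blast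
    then have dE: "d \<in> E j" using d1 by (simp add: E_def)
    have "d e \<in> (if e \<in> coord_set N k then {- (2 * R)..2 * R} else {undefined})" for e
    proof (cases "e \<in> coord_set N k")
      case True
      then obtain l i j where e: "e = (l, i, j)" "l < N" "i < k" "j < k" by (auto simp: coord_set_def)
      have "\<bar>d (l, i, j)\<bar> \<le> 2 * R" using d1 e by (intro abs_coord_le[of k d l]) auto
      then show ?thesis using True e by (auto simp: abs_le_iff)
    next
      case False
      then show ?thesis using extensional_arb[OF coords_of_extensional False] by (simp add: d_def)
    qed
    then have dbox: "d \<in> box" by (simp add: box_def PiE_iff)
    have "c = rs d"
    proof
      fix e show "c e = rs d e"
      proof (cases "e \<in> coord_set n k")
        case True
        then obtain l i j where e: "e = (l, i, j)" "l < n" "i < k" "j < k" by (auto simp: coord_set_def)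
        have "mat_of k c l = A l" using A(2) e(2) by (metis coord_tuple_def lessThan_iff restrict_apply')
        also have "\<dots> = mat_of k d l" using mo[of l] e(2) by (simp add: N_def)
        finally show ?thesis using mat_of_inj[of k c l d i j] e True by (simp add: rs_def)
      next
        case False
        moreover have "c \<in> extensional (coord_set n k)" using c by (simp add: coord_lborel_def space_PiM PiE_def)
        ultimately show ?thesis using extensional_arb[of c "coord_set n k" e] by (simp add: rs_def)
      qed
    qed
    then show "c \<in> (\<Union>j. {c \<in> space (coord_lborel n k). c \<in> rs ` (box \<inter> E j)})" using c dE dbox by auto
  next
    fix c assume "c \<in> (\<Union>j. {c \<in> space (coord_lborel n k). c \<in> rs ` (box \<inter> E j)})"
    then obtain j d where c: "c \<in> space (coord_lborel n k)" "c = rs d" "d \<in> E j" by auto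
    have "f v d < \<epsilon>" if "v \<in> W" for v
    proof -
      have "f v d \<le> \<epsilon> - 1 / real (Suc j)" using c(3) that by (simp add: E_def)
      moreover have "1 / real (Suc j) > 0" by simp
      ultimately show ?thesis by linarith
    qed
    then have "coord_tuple N k d \<in> microstates \<phi> N zz R k m \<epsilon>"
      unfolding coord_tuple_microstates using c(3) by (auto simp: E_def W_def f_def)
    moreover have "coord_tuple n k c = restrict (coord_tuple N k d) {..<n}"
    proof
      fix l
      have "mat_of k c l = mat_of k d l" if "l < n"
        using that c(2) by (intro mat_of_cong) (simp add: rs_def coord_set_def)
      then show "coord_tuple n k c l = restrict (coord_tuple N k d) {..<n} l" by (simp add: coord_tuple_def N_def)
    qed
    ultimately have "coord_tuple n k c \<in> rel_microstates \<phi> n z q w R k m \<epsilon>"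
      unfolding rel_microstates_def N_def zz_def by blast
    then show "c \<in> {c \<in> space (coord_lborel n k). coord_tuple n k c \<in> rel_microstates \<phi> n z q w R k m \<epsilon>}" using c(1) by simp
  qed
  then show ?thesis using meas by simp
qed

section \<open>Volumes and Gaussian measures\<close>

lemma emeasure_lborel_affine:
  fixes B :: "real set"
  assumes "s > 0" "B \<in> sets borel"
  shows "emeasure lborel {x. (x - t) / s \<in> B} = ennreal s * emeasure lborel B"
proof -
  have m: "{x. (x - t) / s \<in> B} \<in> sets borel"
    using measurable_sets[of "\<lambda>x. (x - t) / s" borel borel B] assms by (simp add: vimage_def)
  have "emeasure lborel {x. (x - t) / s \<in> B} = (\<integral>\<^sup>+ x. indicator {x. (x - t) / s \<in> B} x \<partial>lborel)"
    using m by simp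
  also have "\<dots> = \<bar>s\<bar> * (\<integral>\<^sup>+ x. indicator {x. (x - t) / s \<in> B} (t + s * x) \<partial>lborel)"
    by (rule nn_integral_real_affine) (use m assms in auto)
  also have "(\<lambda>x. indicator {x. (x - t) / s \<in> B} (t + s * x) :: ennreal) = indicator B"
    using assms by (auto simp: fun_eq_iff indicator_def)
  finally show ?thesis using assms by simp
qed

text \<open>By uniqueness of product measures it is enough to compare boxes.\<close>

lemma PiM_lborel_affine:
  fixes a :: "'i \<Rightarrow> real"
  assumes I: "finite I" and s: "s > 0" and G: "G \<in> sets (PiM I (\<lambda>_. lborel))"
  defines "T \<equiv> (\<lambda>b. \<lambda>e\<in>I. (b e - a e) / s)"
  shows "{b \<in> space (PiM I (\<lambda>_. lborel)). T b \<in> G} \<in> sets (PiM I (\<lambda>_. lborel))"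
    "emeasure (PiM I (\<lambda>_. lborel)) {b \<in> space (PiM I (\<lambda>_. lborel)). T b \<in> G} = ennreal (s ^ card I) * emeasure (PiM I (\<lambda>_. lborel)) G"
proof -
  interpret product_sigma_finite "\<lambda>_ :: 'i. lborel :: real measure" ..
  let ?M = "PiM I (\<lambda>_. lborel :: real measure)"
  have T: "T \<in> measurable ?M ?M"
    unfolding T_def
  proof (rule measurable_restrict)
    fix e assume "e \<in> I"
    then have "(\<lambda>b. b e) \<in> measurable ?M lborel" by (rule measurable_component_singleton)
    from measurable_compose[OF this, of "\<lambda>x. (x - a e) / s" lborel]
    show "(\<lambda>b. (b e - a e) / s) \<in> measurable ?M lborel" by simp
  qed
  have vi: "T -` G \<inter> space ?M = {b \<in> space ?M. T b \<in> G}" for G by auto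
  show "{b \<in> space ?M. T b \<in> G} \<in> sets ?M" using measurable_sets[OF T G] unfolding vi .
  define P where "P = scale_measure (ennreal (1 / s ^ card I)) (distr ?M ?M T)"
  have "P = ?M"
  proof (rule PiM_eqI[OF I])
    show "sets P = sets ?M" by (simp add: P_def)
    fix A :: "'i \<Rightarrow> real set" assume A: "\<And>i. i \<in> I \<Longrightarrow> A i \<in> sets lborel"
    have A': "{x. (x - a e) / s \<in> A e} \<in> sets lborel" if "e \<in> I" for e
      using measurable_sets[of "\<lambda>x. (x - a e) / s" borel borel "A e"] A[OF that] by (simp add: vimage_def)
    have "T -` PiE I A \<inter> space ?M = PiE I (\<lambda>e. {x. (x - a e) / s \<in> A e})"
      by (auto simp: T_def space_PiM PiE_iff)
    moreover have "PiE I A \<in> sets ?M" using A by (intro sets_PiM_I_finite I) auto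
    ultimately have "emeasure (distr ?M ?M T) (PiE I A) = emeasure ?M (PiE I (\<lambda>e. {x. (x - a e) / s \<in> A e}))"
      using T by (simp add: emeasure_distr)
    also have "\<dots> = (\<Prod>e\<in>I. emeasure lborel {x. (x - a e) / s \<in> A e})"
      using A' by (intro emeasure_PiM I)
    also have "\<dots> = (\<Prod>e\<in>I. ennreal s * emeasure lborel (A e))"
      using A by (intro prod.cong refl emeasure_lborel_affine s) simp
    also have "\<dots> = ennreal (s ^ card I) * (\<Prod>e\<in>I. emeasure lborel (A e))"
      using s by (simp add: prod.distrib ennreal_power)
    finally have "emeasure P (PiE I A) = ennreal (1 / s ^ card I) * (ennreal (s ^ card I) * (\<Prod>e\<in>I. emeasure lborel (A e)))"
      by (simp add: P_def)
    also have "\<dots> = (\<Prod>e\<in>I. emeasure lborel (A e))"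
      using s by (simp add: mult.assoc[symmetric] flip: ennreal_mult)
    finally show "emeasure P (PiE I A) = (\<Prod>e\<in>I. emeasure lborel (A e))" .
  qed
  then have "ennreal (s ^ card I) * emeasure ?M G = ennreal (s ^ card I) * emeasure P G" by simp
  also have "\<dots> = emeasure (distr ?M ?M T) G"
    using s by (simp add: P_def mult.assoc[symmetric] flip: ennreal_mult)
  also have "\<dots> = emeasure ?M {b \<in> space ?M. T b \<in> G}"
    using T G by (simp add: emeasure_distr vi)
  finally show "emeasure ?M {b \<in> space ?M. T b \<in> G} = ennreal (s ^ card I) * emeasure ?M G" by simp
qed

lemma gauss_density:
  assumes I: "finite I" and \<sigma>: "\<sigma> > 0"
  shows "gauss \<sigma> I = density (PiM I (\<lambda>_. lborel)) (\<lambda>c. \<Prod>e\<in>I. ennreal (normal_density 0 \<sigma> (c e)))"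
proof -
  interpret L: product_sigma_finite "\<lambda>_. lborel :: real measure" ..
  interpret G1: prob_space "gauss1 \<sigma>" by (rule prob_space_gauss1) fact
  interpret product_sigma_finite "\<lambda>_. gauss1 \<sigma>" ..
  let ?M = "PiM I (\<lambda>_. lborel :: real measure)"
  let ?f = "\<lambda>c. \<Prod>e\<in>I. ennreal (normal_density 0 \<sigma> (c e))"
  have f: "?f \<in> borel_measurable ?M" by measurable
  have "density ?M ?f = PiM I (\<lambda>_. gauss1 \<sigma>)"
  proof (rule PiM_eqI[OF I])
    show "sets (density ?M ?f) = sets (PiM I (\<lambda>_. gauss1 \<sigma>))"
      by (simp add: sets_gauss[unfolded gauss_def])
    fix A assume A: "\<And>i. i \<in> I \<Longrightarrow> A i \<in> sets (gauss1 \<sigma>)"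
    have P: "PiE I A \<in> sets ?M" using A by (intro sets_PiM_I_finite I) auto
    have "emeasure (density ?M ?f) (PiE I A) = (\<integral>\<^sup>+ c. ?f c * indicator (PiE I A) c \<partial>?M)"
      by (rule emeasure_density[OF f P])
    also have "\<dots> = (\<integral>\<^sup>+ c. (\<Prod>e\<in>I. ennreal (normal_density 0 \<sigma> (c e)) * indicator (A e) (c e)) \<partial>?M)"
    proof (rule nn_integral_cong)
      fix c assume c: "c \<in> space ?M"
      show "?f c * indicator (PiE I A) c = (\<Prod>e\<in>I. ennreal (normal_density 0 \<sigma> (c e)) * indicator (A e) (c e))"
      proof (cases "c \<in> PiE I A")
        case True
        then show ?thesis by (auto simp: indicator_def PiE_iff intro!: prod.cong)
      next
        case False
        then obtain e where "e \<in> I" "c e \<notin> A e" using c by (auto simp: PiE_iff space_PiM)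
        then show ?thesis using False I by (auto simp: indicator_def intro!: prod_zero[symmetric])
      qed
    qed
    also have "\<dots> = (\<Prod>e\<in>I. \<integral>\<^sup>+ x. ennreal (normal_density 0 \<sigma> x) * indicator (A e) x \<partial>lborel)"
      using A by (intro L.product_nn_integral_prod[OF I]) (auto intro!: borel_measurable_times_ennreal borel_measurable_indicator)
    also have "\<dots> = (\<Prod>e\<in>I. emeasure (gauss1 \<sigma>) (A e))"
      using A by (intro prod.cong refl) (simp add: gauss1_def emeasure_density)
    finally show "emeasure (density ?M ?f) (PiE I A) = (\<Prod>e\<in>I. emeasure (gauss1 \<sigma>) (A e))" .
  qed
  then show ?thesis by (simp add: gauss_def)
qed

text \<open>The normal density is at most \<open>1 / (\<sigma> * sqrt (2 * pi))\<close>, which is less than \<open>1 / \<sigma>\<close>.\<close>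

lemma gauss_le_lborel:
  assumes I: "finite I" and \<sigma>: "\<sigma> > 0" and G: "G \<in> sets (PiM I (\<lambda>_. lborel))"
  shows "emeasure (gauss \<sigma> I) G \<le> ennreal ((1 / \<sigma>) ^ card I) * emeasure (PiM I (\<lambda>_. lborel)) G"
proof -
  let ?M = "PiM I (\<lambda>_. lborel :: real measure)"
  have b: "normal_density 0 \<sigma> x \<le> 1 / \<sigma>" for x
  proof -
    have "\<sigma> * 1 \<le> \<sigma> * sqrt (2 * pi)" using \<sigma> pi_gt3 by (intro mult_left_mono) auto
    then have "\<sigma> \<le> sqrt (2 * pi * \<sigma>\<^sup>2)" using \<sigma> by (simp add: real_sqrt_mult mult.commute)
    then have "1 / sqrt (2 * pi * \<sigma>\<^sup>2) * exp (- (x - 0)\<^sup>2 / (2 * \<sigma>\<^sup>2)) \<le> 1 / \<sigma> * 1"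
      using \<sigma> by (intro mult_mono frac_le) auto
    then show ?thesis by (simp add: normal_density_def)
  qed
  have f: "(\<lambda>c. \<Prod>e\<in>I. ennreal (normal_density 0 \<sigma> (c e))) \<in> borel_measurable ?M" by measurable
  have "emeasure (gauss \<sigma> I) G = (\<integral>\<^sup>+ c. (\<Prod>e\<in>I. ennreal (normal_density 0 \<sigma> (c e))) * indicator G c \<partial>?M)"
    unfolding gauss_density[OF I \<sigma>] by (rule emeasure_density[OF f G])
  also have "\<dots> \<le> (\<integral>\<^sup>+ c. ennreal ((1 / \<sigma>) ^ card I) * indicator G c \<partial>?M)"
  proof (rule nn_integral_mono)
    fix c
    have "(\<Prod>e\<in>I. ennreal (normal_density 0 \<sigma> (c e))) = ennreal (\<Prod>e\<in>I. normal_density 0 \<sigma> (c e))"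
      by (rule prod_ennreal) (simp add: normal_density_nonneg)
    also have "\<dots> \<le> ennreal (\<Prod>e\<in>I. 1 / \<sigma>)"
      using b by (intro ennreal_leI prod_mono) (simp add: normal_density_nonneg)
    finally show "(\<Prod>e\<in>I. ennreal (normal_density 0 \<sigma> (c e))) * indicator G c \<le> ennreal ((1 / \<sigma>) ^ card I) * indicator G c"
      by (intro mult_right_mono) auto
  qed
  also have "\<dots> = ennreal ((1 / \<sigma>) ^ card I) * emeasure ?M G" using G by (rule nn_integral_cmult_indicator)
  finally show ?thesis .
qed

section \<open>Gaussian perturbations of topological microstates\<close>

text \<open>The values of \<open>fock_word t\<close> are the joint moments of a tuple with moments \<open>t\<close> and a free semicircular family.
  So the matrices with good coordinates look, jointly with \<open>A\<close>, like such a family. The bound \<open>12\<close> is the one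
  of \<open>gue_opnorm_tail\<close>.\<close>

definition good_coords :: "(nat list \<Rightarrow> complex) \<Rightarrow> nat \<Rightarrow> nat \<Rightarrow> (nat \<Rightarrow> complex mat) \<Rightarrow> nat \<Rightarrow> real \<Rightarrow> coords set" where
  "good_coords t n k A m d = {c \<in> space (coord_lborel n k). (\<forall>l<n. opnorm (mat_of k c l) \<le> 12)
     \<and> (\<forall>w\<in>nwords n. length w \<le> m \<longrightarrow> cmod (wtr k A w c - fock_word t w) < d)}"

lemma finite_nwords: "finite {w \<in> nwords n. length w \<le> m}"
  using finite_lists_length_le[of "Inl ` {..<n} \<union> Inr ` {..<n}" m] by (simp add: nwords_def)

lemma continuous_wtr:
  assumes A: "\<And>i. i < n \<Longrightarrow> A i \<in> carrier_mat k k" and w: "w \<in> nwords n"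
  shows "continuous_on UNIV (wtr k A w)"
  unfolding wtr_def[abs_def] wmat_def
proof (rule continuous_ntrace_mat_word)
  fix c x assume "x \<in> set w"
  then show "letter_mat k A c x \<in> carrier_mat k k"
    using letter_carrier[of n A k x c] A w by (auto simp: nwords_def)
next
  fix x a b assume x: "x \<in> set w" "a < k" "b < k"
  show "continuous_on UNIV (\<lambda>c. letter_mat k A c x $$ (a, b))"
    by (cases x) (use x in \<open>simp_all add: letter_mat_def continuous_mat_of\<close>)
qed

lemma space_coord_lborel: "space (coord_lborel n k) = space (gauss \<sigma> (coord_set n k))"
  by (simp add: coord_lborel_def space_gauss)

lemma sets_coord_lborel: "sets (coord_lborel n k) = sets (gauss \<sigma> (coord_set n k))"
  by (simp add: coord_lborel_def sets_gauss)

lemma good_coords_measurable: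
  assumes A: "\<And>i. i < n \<Longrightarrow> A i \<in> carrier_mat k k"
  shows "good_coords t n k A m d \<in> sets (coord_lborel n k)"
proof -
  define S1 where "S1 = (\<Inter>l\<in>{..<n}. {c. opnorm (mat_of k c l) \<le> 12})"
  define S2 where "S2 = (\<Inter>w\<in>{w \<in> nwords n. length w \<le> m}. {c. cmod (wtr k A w c - fock_word t w) < d})"
  have "closed S1" unfolding S1_def by (intro closed_INT ballI closed_opnorm_le[OF mat_of_carrier continuous_mat_of])
  moreover have "open S2"
    unfolding S2_def
    by (intro open_INT finite_nwords ballI open_Collect_less continuous_on_norm continuous_on_diff continuous_on_const)
       (use continuous_wtr[of n A k, OF A] in auto)
  ultimately have "S1 \<inter> S2 \<in> sets borel" by (intro sets.Int borel_closed borel_open)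
  moreover have "good_coords t n k A m d = {c \<in> space (coord_lborel n k). c \<in> S1 \<inter> S2}"
    by (auto simp: good_coords_def S1_def S2_def)
  ultimately show ?thesis using coord_lborel_borel_set[of "S1 \<inter> S2" n k] by simp
qed

lemma wtr_rev:
  assumes A: "\<And>i. i < n \<Longrightarrow> A i \<in> sa_mats k" and w: "w \<in> nwords n"
  shows "wtr k A (rev w) c = cnj (wtr k A w c)"
  unfolding wtr_def wmat_def
proof (rule ntrace_mat_word_rev)
  fix x assume "x \<in> set w"
  then show "letter_mat k A c x \<in> sa_mats k"
    using A w by (cases x) (auto simp: letter_mat_def nwords_def mat_of_sa)
qed

lemma top_microstates_sa: "A \<in> top_microstates P n x R k \<epsilon> r \<Longrightarrow> i < n \<Longrightarrow> A i \<in> sa_mats k"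
  by (auto simp: top_microstates_def sa_tuples_def)

text \<open>The tolerance and the number of polynomials do not depend on the microstate \<open>A\<close>. If no choice of
  them works, there are microstates of sizes tending to infinity with tolerances tending to zero for which the
  good set has probability less than \<open>1 / 2\<close>. By \<open>tracial_limit\<close> and the uniqueness of the tracial state the
  moments of a subsequence converge to those of \<open>x\<close>. Then \<open>gue_words_converge\<close> applies to the words and to the
  products of a word with its adjoint, so the mean square deviation of each trace tends to zero. Chebyshev's
  inequality and \<open>gue_opnorm_tail\<close> contradict the choice of the microstates.\<close>

theorem good_coords_probable:
  fixes x :: "nat \<Rightarrow> 'a::cstar_algebra_1"
  assumes sa: "\<And>i. i < n \<Longrightarrow> selfadjoint (x i)" and gen: "cstar_subalgebra hull (x ` {..<n}) = UNIV"
    and P: "range P = rat_ncpolys n" and n: "n > 0"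
    and \<tau>: "\<And>\<tau>'. \<tau>' \<in> tracial_states \<Longrightarrow> \<tau>' = \<tau>" and d: "d > 0"
  defines "t \<equiv> (\<lambda>a. \<tau> (prod_list (map x a)))"
  shows "\<exists>\<epsilon>>0. \<exists>r\<ge>1. \<forall>\<^sub>F k in sequentially. \<forall>A\<in>top_microstates P n x R k \<epsilon> r.
     measure (gauss (1 / sqrt (real k)) (coord_set n k)) (good_coords t n k A m d) \<ge> 1 / 2"
proof (rule ccontr)
  let ?G = "\<lambda>k. gauss (1 / sqrt (real k)) (coord_set n k)"
  assume neg: "\<not> ?thesis"
  have "\<exists>k A. k \<ge> Suc j \<and> A \<in> top_microstates P n x R k (1 / real (Suc j)) (Suc j)
      \<and> measure (?G k) (good_coords t n k A m d) < 1 / 2" for j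
  proof -
    have "\<not> (\<forall>\<^sub>F k in sequentially. \<forall>A\<in>top_microstates P n x R k (1 / real (Suc j)) (Suc j).
     measure (?G k) (good_coords t n k A m d) \<ge> 1 / 2)"
    proof
      assume *: "\<forall>\<^sub>F k in sequentially. \<forall>A\<in>top_microstates P n x R k (1 / real (Suc j)) (Suc j).
        measure (?G k) (good_coords t n k A m d) \<ge> 1 / 2"
      have "1 / real (Suc j) > 0" "Suc j \<ge> 1" by simp_all
      with * neg show False by blast
    qed
    then have "\<not> (\<forall>k\<ge>Suc j. \<forall>A\<in>top_microstates P n x R k (1 / real (Suc j)) (Suc j).
     measure (?G k) (good_coords t n k A m d) \<ge> 1 / 2)"
      unfolding eventually_sequentially by blast
    then show ?thesis by (auto simp: not_le)
  qed
  then have "\<forall>j. \<exists>kA. fst kA \<ge> Suc j \<and> snd kA \<in> top_microstates P n x R (fst kA) (1 / real (Suc j)) (Suc j)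
      \<and> measure (?G (fst kA)) (good_coords t n (fst kA) (snd kA) m d) < 1 / 2" by simp
  from choice[OF this] obtain KA where KA: "\<forall>j. fst (KA j) \<ge> Suc j \<and> snd (KA j) \<in> top_microstates P n x R (fst (KA j)) (1 / real (Suc j)) (Suc j)
      \<and> measure (?G (fst (KA j))) (good_coords t n (fst (KA j)) (snd (KA j)) m d) < 1 / 2" ..
  define K0 where "K0 j = fst (KA j)" for j
  define A0 where "A0 j = snd (KA j)" for j
  have K0: "K0 j \<ge> Suc j" and A0: "A0 j \<in> top_microstates P n x R (K0 j) (1 / real (Suc j)) (Suc j)"
    and bad0: "measure (?G (K0 j)) (good_coords t n (K0 j) (A0 j) m d) < 1 / 2" for j
    using KA unfolding K0_def A0_def by blast+
  have "\<exists>s \<tau>. strict_mono s \<and> \<tau> \<in> tracial_states \<and>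
    (\<forall>w. set w \<subseteq> {..<n} \<longrightarrow>
      (\<lambda>j. ntrace (K0 (s j)) (mat_word (K0 (s j)) (A0 (s j)) w)) \<longlonglongrightarrow> \<tau> (prod_list (map x w)))"
  proof (rule tracial_limit[OF sa gen P])
    show "1 \<le> K0 j" for j using K0[of j] by simp
    show "A0 j \<in> sa_tuples n (K0 j)" for j using A0[of j] by (simp add: top_microstates_def)
    show "\<bar>opnorm (mat_nc_eval (K0 j) (A0 j) (P i)) - norm (nc_eval x (P i))\<bar> \<le> 1 / real (Suc j)" if "i < j" for i j
      using A0[of j] that by (simp add: top_microstates_def)
  qed
  then obtain s \<tau>' where s: "strict_mono s" and "\<tau>' \<in> tracial_states"
    and "\<forall>w. set w \<subseteq> {..<n} \<longrightarrow>
      (\<lambda>j. ntrace (K0 (s j)) (mat_word (K0 (s j)) (A0 (s j)) w)) \<longlonglongrightarrow> \<tau>' (prod_list (map x w))" by blast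
  then have lim: "(\<lambda>j. ntrace (K0 (s j)) (mat_word (K0 (s j)) (A0 (s j)) w)) \<longlonglongrightarrow> t w" if "set w \<subseteq> {..<n}" for w
    using \<tau>[of \<tau>'] that by (simp add: t_def)
  define K where "K j = K0 (s j)" for j
  define A where "A j = A0 (s j)" for j
  have Kj: "K j \<ge> Suc j" for j using K0[of "s j"] seq_suble[OF s, of j] by (simp add: K_def)
  have Kpos: "K j > 0" for j using Kj[of j] by simp
  have Klim: "filterlim K at_top sequentially"
    unfolding filterlim_at_top eventually_sequentially using Kj by (metis Suc_leD order_trans)
  have Asa: "A j i \<in> sa_mats (K j)" if "i < n" for i j
    using top_microstates_sa[OF A0 that] by (simp add: A_def K_def)
  have Ac: "A j i \<in> carrier_mat (K j) (K j)" if "i < n" for i j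
    using Asa[OF that] by (rule sa_mats_carrier)
  have conv: "(\<lambda>j. \<integral>c. wtrs (K j) (A j) ws c \<partial>?G (K j)) \<longlonglongrightarrow> prod_list (map (fock_word t) ws)"
    if "set ws \<subseteq> nwords n" for ws
    by (rule gue_words_converge[OF Kpos Klim Ac _ that]) (simp_all add: K_def A_def lim)
  have int: "integrable (?G (K j)) (wtrs (K j) (A j) ws)" if "set ws \<subseteq> nwords n" for ws j
    by (rule integrable_wtrs[OF Ac Kpos n that])
  define dev where "dev w j = (\<integral>c. (cmod (wtr (K j) (A j) w c - fock_word t w))\<^sup>2 \<partial>?G (K j))" for w j
  have dev: "integrable (?G (K j)) (\<lambda>c. (cmod (wtr (K j) (A j) w c - fock_word t w))\<^sup>2)" "dev w \<longlonglongrightarrow> 0"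
    if w: "w \<in> nwords n" for w j
  proof -
    have rw: "rev w \<in> nwords n" using w by (simp add: nwords_def)
    \<comment> \<open>The square is a product of two traces because the adjoint of a word is the reversed word.\<close>
    let ?\<mu> = "fock_word t w"
    have e: "complex_of_real ((cmod (wtr (K j) (A j) w c - ?\<mu>))\<^sup>2) =
      wtrs (K j) (A j) [w, rev w] c - cnj ?\<mu> * wtrs (K j) (A j) [w] c - ?\<mu> * wtrs (K j) (A j) [rev w] c + ?\<mu> * cnj ?\<mu>" for j c
      unfolding complex_norm_square by (simp add: wtr_rev[OF Asa w] algebra_simps)
    interpret prob_space "?G (K j)" for j by (rule prob_space_gauss) (use Kpos in simp)
    have i: "integrable (?G (K j)) (\<lambda>c. complex_of_real ((cmod (wtr (K j) (A j) w c - ?\<mu>))\<^sup>2))" for j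
      unfolding e using w rw
      by (intro Bochner_Integration.integrable_add Bochner_Integration.integrable_diff integrable_mult_right int integrable_const) auto
    show "integrable (?G (K j)) (\<lambda>c. (cmod (wtr (K j) (A j) w c - ?\<mu>))\<^sup>2)"
      using integrable_Re[OF i[of j]] by simp
    have dv: "complex_of_real (dev w j) = (\<integral>c. wtrs (K j) (A j) [w, rev w] c \<partial>?G (K j)) - cnj ?\<mu> * (\<integral>c. wtrs (K j) (A j) [w] c \<partial>?G (K j))
        - ?\<mu> * (\<integral>c. wtrs (K j) (A j) [rev w] c \<partial>?G (K j)) + ?\<mu> * cnj ?\<mu>" for j
    proof -
      have i3: "integrable (?G (K j)) (wtrs (K j) (A j) [w, rev w])" "integrable (?G (K j)) (wtrs (K j) (A j) [w])" "integrable (?G (K j)) (wtrs (K j) (A j) [rev w])"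
        using w rw by (intro int; simp)+
      have "complex_of_real (dev w j) = (\<integral>c. complex_of_real ((cmod (wtr (K j) (A j) w c - ?\<mu>))\<^sup>2) \<partial>?G (K j))"
        unfolding dev_def by (rule integral_complex_of_real[symmetric])
      also have "\<dots> = (\<integral>c. (wtrs (K j) (A j) [w, rev w] c - cnj ?\<mu> * wtrs (K j) (A j) [w] c - ?\<mu> * wtrs (K j) (A j) [rev w] c) + ?\<mu> * cnj ?\<mu> \<partial>?G (K j))"
        unfolding e ..
      also have "\<dots> = (\<integral>c. wtrs (K j) (A j) [w, rev w] c - cnj ?\<mu> * wtrs (K j) (A j) [w] c - ?\<mu> * wtrs (K j) (A j) [rev w] c \<partial>?G (K j)) + ?\<mu> * cnj ?\<mu>"
        using i3 by (subst Bochner_Integration.integral_add) (simp_all add: prob_space del: wtrs_simps)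
      also have "(\<integral>c. wtrs (K j) (A j) [w, rev w] c - cnj ?\<mu> * wtrs (K j) (A j) [w] c - ?\<mu> * wtrs (K j) (A j) [rev w] c \<partial>?G (K j))
         = (\<integral>c. wtrs (K j) (A j) [w, rev w] c \<partial>?G (K j)) - cnj ?\<mu> * (\<integral>c. wtrs (K j) (A j) [w] c \<partial>?G (K j)) - ?\<mu> * (\<integral>c. wtrs (K j) (A j) [rev w] c \<partial>?G (K j))"
        using i3 by (simp del: wtrs_simps)
      finally show ?thesis .
    qed
    have revlim: "fock_word t (rev w) = cnj ?\<mu>"
    proof (rule LIMSEQ_unique)
      show "(\<lambda>j. \<integral>c. wtrs (K j) (A j) [rev w] c \<partial>?G (K j)) \<longlonglongrightarrow> fock_word t (rev w)"
        using conv[of "[rev w]"] rw by (simp del: wtrs_simps)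
      have "wtrs (K j) (A j) [rev w] c = cnj (wtrs (K j) (A j) [w] c)" for j c by (simp add: wtr_rev[OF Asa w])
      then have "(\<integral>c. wtrs (K j) (A j) [rev w] c \<partial>?G (K j)) = cnj (\<integral>c. wtrs (K j) (A j) [w] c \<partial>?G (K j))" for j
        using integral_bounded_linear[OF bounded_linear_cnj int[of "[w]" j]] w by (simp del: wtrs_simps)
      moreover have "(\<lambda>j. cnj (\<integral>c. wtrs (K j) (A j) [w] c \<partial>?G (K j))) \<longlonglongrightarrow> cnj ?\<mu>"
        using conv[of "[w]"] w by (intro tendsto_cnj) (simp del: wtrs_simps)
      ultimately show "(\<lambda>j. \<integral>c. wtrs (K j) (A j) [rev w] c \<partial>?G (K j)) \<longlonglongrightarrow> cnj ?\<mu>" by (simp only:)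
    qed
    have "(\<lambda>j. complex_of_real (dev w j)) \<longlonglongrightarrow> ?\<mu> * (cnj ?\<mu> * 1) - cnj ?\<mu> * (?\<mu> * 1) - ?\<mu> * (cnj ?\<mu> * 1) + ?\<mu> * cnj ?\<mu>"
      unfolding dv using conv[of "[w, rev w]"] conv[of "[w]"] conv[of "[rev w]"] w rw
      by (intro tendsto_intros) (simp_all add: revlim del: wtrs_simps)
    then have "(\<lambda>j. complex_of_real (dev w j)) \<longlonglongrightarrow> of_real 0" by (simp add: mult.commute)
    then show "dev w \<longlonglongrightarrow> 0" unfolding tendsto_of_real_iff .
  qed
  define W where "W = {w \<in> nwords n. length w \<le> m}"
  \<comment> \<open>The bound for the probability of the complement of the good set.\<close>
  define b where "b j = (\<Sum>w\<in>W. dev w j / d\<^sup>2) + (\<Sum>l<n. 2 * (1 / 2) ^ K j)" for j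
  have "b \<longlonglongrightarrow> (\<Sum>w\<in>W. 0 / d\<^sup>2) + (\<Sum>l<n. 2 * 0)"
  proof -
    have "(\<lambda>j. (1 / 2 :: real) ^ K j) \<longlonglongrightarrow> 0"
      by (rule filterlim_compose[OF LIMSEQ_realpow_zero Klim]) auto
    then show ?thesis unfolding b_def
      by (intro tendsto_intros) (use dev(2) d in \<open>auto simp: W_def\<close>)
  qed
  then have "b \<longlonglongrightarrow> 0" by simp
  then have "\<forall>\<^sub>F j in sequentially. b j < 1 / 2" by (rule order_tendstoD) simp
  then obtain j where j: "b j < 1 / 2" using eventually_happens'[OF sequentially_bot] by blast
  interpret prob_space "?G (K j)" by (rule prob_space_gauss) (use Kpos in simp)
  let ?M = "?G (K j)"
  have "\<forall>l. \<exists>B. l < n \<longrightarrow> B\<in>sets ?M \<and> measure ?M B \<le> 2 * (1 / 2) ^ K j \<and> (\<forall>c\<in>space ?M - B. opnorm (mat_of (K j) c l) \<le> 12)"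
    using gue_opnorm_tail[OF Kpos] by blast
  from choice[OF this] obtain B where B: "\<forall>l. l < n \<longrightarrow> B l\<in>sets ?M \<and> measure ?M (B l) \<le> 2 * (1 / 2) ^ K j \<and> (\<forall>c\<in>space ?M - B l. opnorm (mat_of (K j) c l) \<le> 12)" ..
  define C where "C w = {c \<in> space ?M. d\<^sup>2 \<le> (cmod (wtr (K j) (A j) w c - fock_word t w))\<^sup>2}" for w
  have C: "C w \<in> sets ?M" "measure ?M (C w) \<le> dev w j / d\<^sup>2" if "w \<in> W" for w
  proof -
    have w: "w \<in> nwords n" using that by (simp add: W_def)
    have mb: "(\<lambda>c. (cmod (wtr (K j) (A j) w c - fock_word t w))\<^sup>2) \<in> borel_measurable ?M"
      using dev(1)[OF w, of j] by (rule borel_measurable_integrable)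
    show "C w \<in> sets ?M" unfolding C_def by (rule borel_measurable_le[OF borel_measurable_const mb])
    show "measure ?M (C w) \<le> dev w j / d\<^sup>2"
      unfolding C_def dev_def using d by (intro integral_Markov_inequality_measure[OF dev(1)[OF w], of "{}"]) auto
  qed
  define Bad where "Bad = (\<Union>w\<in>W. C w) \<union> (\<Union>l\<in>{..<n}. B l)"
  have fW: "finite W" unfolding W_def by (rule finite_nwords)
  have Bad: "Bad \<in> sets ?M" unfolding Bad_def using C B fW by (intro sets.Un sets.finite_UN) auto
  have "measure ?M Bad \<le> measure ?M (\<Union>w\<in>W. C w) + measure ?M (\<Union>l\<in>{..<n}. B l)"
    unfolding Bad_def using C B fW by (intro measure_Un_le sets.finite_UN) auto
  also have "\<dots> \<le> (\<Sum>w\<in>W. measure ?M (C w)) + (\<Sum>l<n. measure ?M (B l))"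
    using C B fW by (intro add_mono finite_measure_subadditive_finite) auto
  also have "\<dots> \<le> b j" unfolding b_def using C(2) B by (intro add_mono sum_mono) auto
  finally have "measure ?M Bad < 1 / 2" using j by simp
  then have "measure ?M (space ?M - Bad) > 1 / 2" using prob_compl[OF Bad] by simp
  moreover have "space ?M - Bad \<subseteq> good_coords t n (K j) (A j) m d"
  proof
    fix c assume c: "c \<in> space ?M - Bad"
    have "cmod (wtr (K j) (A j) w c - fock_word t w) < d" if "w \<in> W" for w
    proof -
      have "c \<notin> C w" using c that by (auto simp: Bad_def)
      then have "(cmod (wtr (K j) (A j) w c - fock_word t w))\<^sup>2 < d\<^sup>2" using c by (simp add: C_def)
      then show ?thesis by (rule power2_less_imp_less) (use d in simp)
    qed
    moreover have "opnorm (mat_of (K j) c l) \<le> 12" if "l < n" for l using B that c by (auto simp: Bad_def)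
    ultimately show "c \<in> good_coords t n (K j) (A j) m d"
      using c by (auto simp: good_coords_def W_def space_coord_lborel[of n "K j" "1 / sqrt (real (K j))"])
  qed
  then have "measure ?M (space ?M - Bad) \<le> measure ?M (good_coords t n (K j) (A j) m d)"
    using good_coords_measurable[of n "A j" "K j" t m d, OF Ac] sets_coord_lborel[of n "K j" "1 / sqrt (real (K j))"]
    by (intro finite_measure_mono) auto
  ultimately show False using bad0[of "s j"] by (simp add: K_def A_def)
qed

section \<open>Perturbations are relative microstates\<close>

text \<open>The variables of the relative microstates in one list: first the perturbed ones, then the semicircular
  ones.\<close>

definition pert_var :: "nat \<Rightarrow> real \<Rightarrow> nat \<Rightarrow> (nat + nat) ncpoly" where
  "pert_var n \<epsilon> i = (if i < n then nc_var (Inl i) + nc_const (complex_of_real \<epsilon>) * nc_var (Inr i) else nc_var (Inr (i - n)))"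

lemma single_times_var: "Poly_Mapping.single (Word u) (1::complex) * nc_var x = Poly_Mapping.single (Word (u @ [x])) 1"
  by (simp add: nc_var_def mult_single plus_word_def)

lemma ntrace_mult_add:
  assumes "X \<in> carrier_mat k k" "Y \<in> carrier_mat k k" "Z \<in> carrier_mat k k"
  shows "ntrace k ((X + c \<cdot>\<^sub>m Y) * Z) = ntrace k (X * Z) + c * ntrace k (Y * Z)"
proof -
  have "((X + c \<cdot>\<^sub>m Y) * Z) $$ (i, i) = (X * Z) $$ (i, i) + c * (Y * Z) $$ (i, i)" if "i < k" for i
    using assms that mat_mult_index[of X k k Z k i i] mat_mult_index[of Y k k Z k i i] mat_mult_index[of "X + c \<cdot>\<^sub>m Y" k k Z k i i]
    by (simp add: sum_distrib_left sum.distrib algebra_simps)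
  then show ?thesis by (simp add: ntrace_def sum.distrib sum_distrib_left add_divide_distrib)
qed

text \<open>A word in the perturbed tuple is expanded from the left, where \<open>u\<close> is the part already expanded. Each
  letter is replaced by at most two letters, with coefficients at most one, which gives the factor \<open>2\<close> for
  each letter.\<close>

lemma perturbed_moments:
  assumes A: "\<And>i. i < n \<Longrightarrow> A i \<in> carrier_mat k k" and \<epsilon>: "0 \<le> \<epsilon>" "\<epsilon> \<le> 1"
    and B: "\<And>l. l < n \<Longrightarrow> B l = A l + complex_of_real \<epsilon> \<cdot>\<^sub>m mat_of k c l" "\<And>l. l < n \<Longrightarrow> B (n + l) = mat_of k c l"
    and lin: "\<And>p q. \<mu> (p + q) = \<mu> p + \<mu> q" "\<And>z p. \<mu> (nc_const z * p) = z * \<mu> p"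
    and close: "\<And>u. u \<in> nwords n \<Longrightarrow> length u \<le> m \<Longrightarrow> cmod (wtr k A u c - \<mu> (Poly_Mapping.single (Word u) 1)) < d"
    and w: "set w \<subseteq> {..<n + n}" "length w \<le> m"
  shows "cmod (ntrace k (mat_word k B w) - \<mu> (prod_list (map (pert_var n \<epsilon>) w))) \<le> 2 ^ length w * d"
proof -
  have Bc: "B l \<in> carrier_mat k k" if "l < n + n" for l
  proof (cases "l < n")
    case True
    then show ?thesis using B(1) A by simp
  next
    case False
    then show ?thesis using B(2)[of "l - n"] that by simp
  qed
  have snoc: "wmat k A (u @ [x]) c = wmat k A u c * letter_mat k A c x" if "u \<in> nwords n" "x \<in> Inl ` {..<n} \<union> Inr ` {..<n}" for u x
  proof -
    have l: "letter_mat k A c x \<in> carrier_mat k k" by (rule letter_carrier[OF A that(2)])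
    have "mat_word k (letter_mat k A c) (u @ [x]) = mat_word k (letter_mat k A c) u * mat_word k (letter_mat k A c) [x]"
      using letter_carrier[of n A k, OF A] that by (intro mat_word_append) (auto simp: nwords_def)
    then show ?thesis using l by (simp add: wmat_def right_mult_one_mat)
  qed
  have wc: "wmat k A u c \<in> carrier_mat k k" if "u \<in> nwords n" for u by (rule wmat_carrier[OF A that])
  have bc: "mat_word k B v \<in> carrier_mat k k" if "set v \<subseteq> {..<n + n}" for v
    using that Bc by (intro mat_word_carrier) auto
  have "cmod (ntrace k (wmat k A u c * mat_word k B v) - \<mu> (Poly_Mapping.single (Word u) 1 * prod_list (map (pert_var n \<epsilon>) v))) \<le> 2 ^ length v * d"
    if "u \<in> nwords n" "set v \<subseteq> {..<n + n}" "length u + length v \<le> m" for u v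
    using that
  proof (induction v arbitrary: u)
    case Nil
    have "wmat k A u c * 1\<^sub>m k = wmat k A u c" using wc[OF Nil(1)] by (rule right_mult_one_mat)
    then show ?case using close[of u] Nil by (simp add: wtr_def less_imp_le)
  next
    case (Cons l v)
    have v: "set v \<subseteq> {..<n + n}" and l: "l < n + n" using Cons.prems(2) by auto
    have IH: "cmod (ntrace k (wmat k A (u @ [x]) c * mat_word k B v) - \<mu> (Poly_Mapping.single (Word (u @ [x])) 1 * prod_list (map (pert_var n \<epsilon>) v))) \<le> 2 ^ length v * d"
      if "x \<in> Inl ` {..<n} \<union> Inr ` {..<n}" for x
      by (rule Cons.IH) (use Cons.prems that v in auto)
    have d0: "0 \<le> 2 ^ length v * d" using order_trans[OF norm_ge_zero close[of "[]", THEN less_imp_le]] by simp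
    have as: "wmat k A u c * mat_word k B (l # v) = (wmat k A u c * B l) * mat_word k B v"
      using wc[OF Cons.prems(1)] Bc[OF l] bc[OF v] by (simp add: assoc_mult_mat[of _ k k _ k _ k])
    show ?case
    proof (cases "l < n")
      case True
      define X where "X = wmat k A (u @ [Inl l]) c"
      define Y where "Y = wmat k A (u @ [Inr l]) c"
      define p where "p = Poly_Mapping.single (Word (u @ [Inl l])) (1::complex) * prod_list (map (pert_var n \<epsilon>) v)"
      define q where "q = Poly_Mapping.single (Word (u @ [Inr l])) (1::complex) * prod_list (map (pert_var n \<epsilon>) v)"
      have xy: "Inl l \<in> Inl ` {..<n} \<union> Inr ` {..<n}" "Inr l \<in> Inl ` {..<n} \<union> Inr ` {..<n}" using True by auto
      have XY: "X \<in> carrier_mat k k" "Y \<in> carrier_mat k k"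
        unfolding X_def Y_def using Cons.prems(1) xy by (intro wc; simp)+
      have "wmat k A u c * B l = X + complex_of_real \<epsilon> \<cdot>\<^sub>m Y"
      proof -
        have "wmat k A u c * (A l + complex_of_real \<epsilon> \<cdot>\<^sub>m mat_of k c l) = wmat k A u c * A l + wmat k A u c * (complex_of_real \<epsilon> \<cdot>\<^sub>m mat_of k c l)"
          using wc[OF Cons.prems(1)] A[OF True] by (intro mult_add_distrib_mat[of _ k k]) auto
        also have "wmat k A u c * (complex_of_real \<epsilon> \<cdot>\<^sub>m mat_of k c l) = complex_of_real \<epsilon> \<cdot>\<^sub>m (wmat k A u c * mat_of k c l)"
          using wc[OF Cons.prems(1)] by (intro mult_smult_distrib[of _ k k _ k]) auto
        finally show ?thesis using snoc[OF Cons.prems(1) xy(1)] snoc[OF Cons.prems(1) xy(2)]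
          unfolding B(1)[OF True] X_def Y_def by (simp add: letter_mat_def)
      qed
      then have 1: "ntrace k (wmat k A u c * mat_word k B (l # v)) = ntrace k (X * mat_word k B v) + complex_of_real \<epsilon> * ntrace k (Y * mat_word k B v)"
        unfolding as by (simp add: ntrace_mult_add XY bc[OF v])
      have "Poly_Mapping.single (Word u) 1 * prod_list (map (pert_var n \<epsilon>) (l # v)) = p + nc_const (complex_of_real \<epsilon>) * q"
      proof -
        have "Poly_Mapping.single (Word u) (1::complex) * (nc_const (complex_of_real \<epsilon>) * nc_var (Inr l)) = nc_const (complex_of_real \<epsilon>) * Poly_Mapping.single (Word (u @ [Inr l])) 1"
          by (simp add: single_times_var[symmetric] nc_const_commute mult.assoc)
        then show ?thesis using True unfolding p_def q_def
          by (simp add: pert_var_def distrib_left distrib_right single_times_var mult.assoc[symmetric])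
      qed
      then have 2: "\<mu> (Poly_Mapping.single (Word u) 1 * prod_list (map (pert_var n \<epsilon>) (l # v))) = \<mu> p + complex_of_real \<epsilon> * \<mu> q"
        by (simp only: lin)
      have "cmod (ntrace k (wmat k A u c * mat_word k B (l # v)) - \<mu> (Poly_Mapping.single (Word u) 1 * prod_list (map (pert_var n \<epsilon>) (l # v))))
        = cmod ((ntrace k (X * mat_word k B v) - \<mu> p) + complex_of_real \<epsilon> * (ntrace k (Y * mat_word k B v) - \<mu> q))"
        unfolding 1 2 by (simp add: algebra_simps)
      also have "\<dots> \<le> cmod (ntrace k (X * mat_word k B v) - \<mu> p) + \<epsilon> * cmod (ntrace k (Y * mat_word k B v) - \<mu> q)"
        using \<epsilon> by (intro order_trans[OF norm_triangle_ineq]) (simp add: norm_mult)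
      also have "\<dots> \<le> 2 ^ length v * d + 1 * (2 ^ length v * d)"
        using IH[OF xy(1)] IH[OF xy(2)] \<epsilon> d0 unfolding X_def Y_def p_def q_def by (intro add_mono mult_mono) auto
      finally show ?thesis by (simp add: mult_ac)
    next
      case False
      define l' where "l' = l - n"
      have l': "l' < n" "l = n + l'" using False l by (auto simp: l'_def)
      have x: "Inr l' \<in> Inl ` {..<n} \<union> Inr ` {..<n}" using l' by auto
      have "wmat k A u c * B l = wmat k A (u @ [Inr l']) c"
        using snoc[OF Cons.prems(1) x] B(2)[OF l'(1)] l'(2) by (simp add: letter_mat_def)
      moreover have "Poly_Mapping.single (Word u) 1 * prod_list (map (pert_var n \<epsilon>) (l # v)) = Poly_Mapping.single (Word (u @ [Inr l'])) 1 * prod_list (map (pert_var n \<epsilon>) v)"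
        using False by (simp add: pert_var_def l'_def single_times_var[symmetric] mult.assoc)
      ultimately show ?thesis using IH[OF x] d0 unfolding as by simp
    qed
  qed
  from this[of "[]" w] show ?thesis
    using w left_mult_one_mat[OF bc[OF w(1)]] by (simp add: wmat_def flip: zero_word_def)
qed

text \<open>The coordinates of \<open>(B - A) / \<epsilon>\<close>, where \<open>b\<close> are the coordinates of \<open>B\<close>.\<close>

definition shift_coords :: "nat \<Rightarrow> nat \<Rightarrow> (nat \<Rightarrow> complex mat) \<Rightarrow> real \<Rightarrow> coords \<Rightarrow> coords" where
  "shift_coords n k A \<epsilon> b = (\<lambda>e\<in>coord_set n k. (b e - coords_of n k A e) / \<epsilon>)"

lemma mat_of_shift:
  assumes A: "\<And>i. i < n \<Longrightarrow> A i \<in> sa_mats k" and \<epsilon>: "\<epsilon> > 0" and l: "l < n"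
  shows "mat_of k b l = A l + complex_of_real \<epsilon> \<cdot>\<^sub>m mat_of k (shift_coords n k A \<epsilon> b) l"
proof (rule eq_matI)
  have c: "A l \<in> carrier_mat k k" using A[OF l] by (rule sa_mats_carrier)
  show "dim_row (mat_of k b l) = dim_row (A l + complex_of_real \<epsilon> \<cdot>\<^sub>m mat_of k (shift_coords n k A \<epsilon> b) l)"
    "dim_col (mat_of k b l) = dim_col (A l + complex_of_real \<epsilon> \<cdot>\<^sub>m mat_of k (shift_coords n k A \<epsilon> b) l)" by simp_all
  fix i j assume "i < dim_row (A l + complex_of_real \<epsilon> \<cdot>\<^sub>m mat_of k (shift_coords n k A \<epsilon> b) l)" "j < dim_col (A l + complex_of_real \<epsilon> \<cdot>\<^sub>m mat_of k (shift_coords n k A \<epsilon> b) l)"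
  then have ij: "i < k" "j < k" by simp_all
  have "A l $$ (i, j) = entry (\<lambda>e. of_real (coords_of n k A e)) l i j"
    using mat_of_coords_of[where A = A, OF A[OF l] l] mat_of_index[OF ij, of "coords_of n k A" l] by simp
  then have "(A l + complex_of_real \<epsilon> \<cdot>\<^sub>m mat_of k (shift_coords n k A \<epsilon> b) l) $$ (i, j)
     = entry (\<lambda>e. of_real (coords_of n k A e) + of_real \<epsilon> * of_real (shift_coords n k A \<epsilon> b e)) l i j"
    using c ij by (simp add: mat_of_index entry_linear)
  also have "\<dots> = entry (\<lambda>e. of_real (b e)) l i j"
    using \<epsilon> l ij unfolding entry_def shift_coords_def coord_set_def by (simp flip: of_real_mult of_real_add)
  finally show "mat_of k b l $$ (i, j) = (A l + complex_of_real \<epsilon> \<cdot>\<^sub>m mat_of k (shift_coords n k A \<epsilon> b) l) $$ (i, j)"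
    using ij by (simp add: mat_of_index)
qed

lemma good_coords_rel_microstates:
  assumes A: "\<And>i. i < n \<Longrightarrow> A i \<in> sa_mats k" and R: "R > 0" "\<And>i. i < n \<Longrightarrow> opnorm (A i) \<le> R" and \<epsilon>: "0 < \<epsilon>" "\<epsilon> \<le> 1"
    and lin: "\<And>p q. \<mu> (p + q) = \<mu> p + \<mu> q" "\<And>z p. \<mu> (nc_const z * p) = z * \<mu> p"
    and law: "\<And>u. u \<in> nwords n \<Longrightarrow> \<mu> (Poly_Mapping.single (Word u) 1) = fock_word t u"
    and d: "2 ^ m * d < \<eta>" "d > 0"
    and b: "shift_coords n k A \<epsilon> b \<in> good_coords t n k A m d"
  shows "coord_tuple n k b \<in> rel_microstates \<mu> n (\<lambda>i. nc_var (Inl i) + nc_const (complex_of_real \<epsilon>) * nc_var (Inr i)) n (\<lambda>i. nc_var (Inr i)) (R + 12) k m \<eta>"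
proof -
  define c where "c = shift_coords n k A \<epsilon> b"
  define B where "B = (\<lambda>l\<in>{..<n + n}. if l < n then mat_of k b l else mat_of k c (l - n))"
  have Ac: "A i \<in> carrier_mat k k" if "i < n" for i using A[OF that] by (rule sa_mats_carrier)
  have B1: "B l = A l + complex_of_real \<epsilon> \<cdot>\<^sub>m mat_of k c l" if "l < n" for l
    using mat_of_shift[where A = A and b = b, OF A \<epsilon>(1) that] that by (simp add: B_def c_def)
  have B2: "B (n + l) = mat_of k c l" if "l < n" for l using that by (simp add: B_def)
  have good: "opnorm (mat_of k c l) \<le> 12" if "l < n" for l using b that by (simp add: good_coords_def c_def)
  have "B \<in> microstates \<mu> (n + n) (pert_var n \<epsilon>) (R + 12) k m \<eta>"
    unfolding microstates_def
  proof (intro CollectI conjI allI impI)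
    show "B \<in> sa_tuples (n + n) k" by (auto simp: sa_tuples_def B_def mat_of_sa)
    fix i assume i: "i < n + n"
    show "opnorm (B i) \<le> R + 12"
    proof (cases "i < n")
      case True
      have "opnorm (B i) \<le> opnorm (A i) + opnorm (complex_of_real \<epsilon> \<cdot>\<^sub>m mat_of k c i)"
        unfolding B1[OF True] using Ac[OF True] by (intro opnorm_add) auto
      also have "opnorm (complex_of_real \<epsilon> \<cdot>\<^sub>m mat_of k c i) \<le> \<epsilon> * opnorm (mat_of k c i)"
        using opnorm_smult[OF mat_of_carrier, of "complex_of_real \<epsilon>" k c i] \<epsilon> by simp
      also have "\<dots> \<le> 1 * 12" using \<epsilon> good[OF True] opnorm_nonneg[OF mat_of_carrier] by (intro mult_mono) auto
      finally show ?thesis using R(2)[OF True] by simp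
    next
      case False
      then have l: "i - n < n" using i by linarith
      show ?thesis using B2[OF l] good[OF l] False R(1) by simp
    qed
  next
    fix w assume w: "set w \<subseteq> {..<n + n} \<and> 1 \<le> length w \<and> length w \<le> m"
    have "cmod (ntrace k (mat_word k B w) - \<mu> (prod_list (map (pert_var n \<epsilon>) w))) \<le> 2 ^ length w * d"
    proof (rule perturbed_moments[OF Ac _ \<epsilon>(2) B1 B2 lin])
      show "cmod (wtr k A u c - \<mu> (Poly_Mapping.single (Word u) 1)) < d" if "u \<in> nwords n" "length u \<le> m" for u
        using b that law[OF that(1)] by (simp add: good_coords_def c_def)
    qed (use w \<epsilon> in auto)
    also have "\<dots> \<le> 2 ^ m * d" using w d by (intro mult_right_mono power_increasing) auto
    finally show "cmod (ntrace k (mat_word k B w) - \<mu> (prod_list (map (pert_var n \<epsilon>) w))) < \<eta>" using d by simp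
  qed
  moreover have "coord_tuple n k b = restrict B {..<n}"
    by (auto simp: coord_tuple_def B_def fun_eq_iff)
  moreover have "pert_var n \<epsilon> = (\<lambda>i. if i < n then nc_var (Inl i) + nc_const (complex_of_real \<epsilon>) * nc_var (Inr i) else nc_var (Inr (i - n)))"
    by (simp add: fun_eq_iff pert_var_def)
  ultimately show ?thesis unfolding rel_microstates_def by auto
qed

section \<open>Packing and volume\<close>

text \<open>A maximal separated set is the set of centres of a cover. If there are arbitrarily large separated
  sets, then \<open>v\<close> is infinite.\<close>

lemma covering_number_le_packing:
  assumes refl: "\<And>x. x \<in> S \<Longrightarrow> d x x < \<omega>" and sym: "\<And>x y. x \<in> S \<Longrightarrow> y \<in> S \<Longrightarrow> d x y = d y x" and a: "a > 0"
    and pack: "\<And>F. finite F \<Longrightarrow> F \<subseteq> S \<Longrightarrow> (\<And>x y. x \<in> F \<Longrightarrow> y \<in> F \<Longrightarrow> x \<noteq> y \<Longrightarrow> \<omega> \<le> d x y) \<Longrightarrow> of_nat (card F) * ennreal a \<le> v"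
  shows "covering_number d S \<omega> * ennreal a \<le> v"
proof -
  define Sep where "Sep F \<longleftrightarrow> finite F \<and> F \<subseteq> S \<and> (\<forall>x\<in>F. \<forall>y\<in>F. x \<noteq> y \<longrightarrow> \<omega> \<le> d x y)" for F
  have pack': "of_nat (card F) * ennreal a \<le> v" if "Sep F" for F
    using that by (intro pack) (auto simp: Sep_def)
  show ?thesis
  proof (cases "\<exists>M. \<forall>F. Sep F \<longrightarrow> card F \<le> M")
    case True
    then obtain M where M: "\<forall>F. Sep F \<longrightarrow> card F \<le> M" by blast
    have "Sep {}" by (simp add: Sep_def)
    then obtain F where F: "Sep F" "\<forall>G. Sep G \<longrightarrow> card G \<le> card F"
      using ex_has_greatest_nat[of Sep "{}" card "Suc M"] M by (auto simp: less_Suc_eq_le)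
    have "\<exists>c\<in>F. d x c < \<omega>" if x: "x \<in> S" for x
    proof (rule ccontr)
      assume *: "\<not> (\<exists>c\<in>F. d x c < \<omega>)"
      then have "x \<notin> F" using refl[OF x] by blast
      have "Sep (insert x F)"
        using F(1) * x sym by (auto simp: Sep_def not_less) (metis subsetD)
      then have "card (insert x F) \<le> card F" using F(2) by blast
      then show False using \<open>x \<notin> F\<close> F(1) by (simp add: Sep_def)
    qed
    then have "covering_number d S \<omega> \<le> of_nat (card F)"
      unfolding covering_number_def using F(1) by (intro INF_lower) (auto simp: Sep_def)
    then have "covering_number d S \<omega> * ennreal a \<le> of_nat (card F) * ennreal a" by (rule mult_right_mono) simp
    also have "\<dots> \<le> v" by (rule pack'[OF F(1)])
    finally show ?thesis .
  next
    case False
    have "v = \<infinity>"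
    proof (rule ccontr)
      assume "v \<noteq> \<infinity>"
      then obtain v0 where v0: "v = ennreal v0" "v0 \<ge> 0" by (cases v) auto
      obtain N :: nat where N: "v0 < real N * a" using reals_Archimedean3[OF a] by blast
      obtain F where F: "Sep F" "card F > N" using False by (auto simp: not_le)
      have "ennreal (real (card F) * a) \<le> ennreal v0"
        using pack'[OF F(1)] a by (simp add: v0 ennreal_mult ennreal_of_nat_eq_real_of_nat)
      then have "real (card F) * a \<le> v0" using v0(2) by (simp add: ennreal_le_iff)
      moreover have "real N * a \<le> real (card F) * a" using F(2) a by (intro mult_right_mono) auto
      ultimately show False using N by linarith
    qed
    then show ?thesis by simp
  qed
qed

lemma opnorm_minus_commute:
  assumes "A \<in> carrier_mat k k" "B \<in> carrier_mat k k"
  shows "opnorm (A - B) = opnorm (B - A)"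
proof -
  have le: "opnorm (A - B) \<le> opnorm (B - A)" if "A \<in> carrier_mat k k" "B \<in> carrier_mat k k" for A B :: "complex mat"
  proof -
    have "A - B = (- 1) \<cdot>\<^sub>m (B - A)" using that by (intro eq_matI) auto
    moreover have "B - A \<in> carrier_mat k k" using that by (intro minus_carrier_mat)
    ultimately show ?thesis using opnorm_smult[of "B - A" k k "- 1"] by simp
  qed
  show ?thesis using le[OF assms] le[OF assms(2,1)] by simp
qed

lemma opnorm_zero: "opnorm (0\<^sub>m k k) \<le> 0"
proof (rule opnorm_least[of _ k k])
  fix v :: "complex vec" assume "v \<in> carrier_vec k"
  then have "0\<^sub>m k k *\<^sub>v v = 0\<^sub>v k" by (intro eq_vecI) auto
  then show "vec_l2norm (0\<^sub>m k k *\<^sub>v v) \<le> 0" by simp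
qed simp

text \<open>For every \<open>A\<close> the perturbations of \<open>A\<close> by \<open>\<epsilon>\<close> times a good tuple are relative microstates. Their volume is
  \<open>\<epsilon>\<close> to the power of the dimension \<open>n * k\<^sup>2\<close> times the volume of the good set, and the latter is at least the
  Gaussian probability \<open>1 / 2\<close> divided by the bound for the Gaussian density. Good tuples have norms at
  most \<open>12\<close>, so a common perturbation of \<open>A\<close> and \<open>B\<close> forces their distance to be at most \<open>24 * \<epsilon>\<close>. Therefore
  a separation by \<open>25 * \<epsilon>\<close> makes the sets disjoint.\<close>

lemma rel_volume_lower:
  fixes \<mu> :: "(nat + nat) ncpoly \<Rightarrow> complex"
  assumes n: "n > 0" and k: "k > 0" and R: "R > 0" and \<epsilon>: "0 < \<epsilon>" "\<epsilon> \<le> 1"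
    and lin: "\<And>p q. \<mu> (p + q) = \<mu> p + \<mu> q" "\<And>z p. \<mu> (nc_const z * p) = z * \<mu> p"
    and law: "\<And>u. u \<in> nwords n \<Longrightarrow> \<mu> (Poly_Mapping.single (Word u) 1) = fock_word t u"
    and d: "2 ^ m * d < \<eta>" "d > 0"
    and F: "finite F" "\<And>A i. A \<in> F \<Longrightarrow> i < n \<Longrightarrow> A i \<in> sa_mats k" "\<And>A i. A \<in> F \<Longrightarrow> i < n \<Longrightarrow> opnorm (A i) \<le> R"
    and prob: "\<And>A. A \<in> F \<Longrightarrow> measure (gauss (1 / sqrt (real k)) (coord_set n k)) (good_coords t n k A m d) \<ge> 1 / 2"
    and sep: "\<And>A B. A \<in> F \<Longrightarrow> B \<in> F \<Longrightarrow> A \<noteq> B \<Longrightarrow> 25 * \<epsilon> \<le> tuple_dist n A B"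
  shows "of_nat (card F) * ennreal (\<epsilon> ^ (n * k\<^sup>2) / (2 * sqrt (real k) ^ (n * k\<^sup>2)))
    \<le> sa_volume n k (rel_microstates \<mu> n (\<lambda>i. nc_var (Inl i) + nc_const (complex_of_real \<epsilon>) * nc_var (Inr i)) n (\<lambda>i. nc_var (Inr i)) (R + 12) k m \<eta>)"
proof -
  define N where "N = n * k\<^sup>2"
  let ?I = "coord_set n k" and ?M = "coord_lborel n k" and ?P = "gauss (1 / sqrt (real k)) (coord_set n k)"
  let ?G = "\<lambda>A. good_coords t n k A m d"
  define Q where "Q = {c \<in> space ?M. coord_tuple n k c \<in> rel_microstates \<mu> n (\<lambda>i. nc_var (Inl i) + nc_const (complex_of_real \<epsilon>) * nc_var (Inr i)) n (\<lambda>i. nc_var (Inr i)) (R + 12) k m \<eta>}"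
  have Q: "Q \<in> sets ?M" unfolding Q_def by (rule rel_microstates_measurable)
  have G: "?G A \<in> sets ?M" if "A \<in> F" for A
    by (rule good_coords_measurable) (use F(2)[OF that] sa_mats_carrier in blast)
  \<comment> \<open>The coordinates of the perturbations of \<open>A\<close> by \<open>\<epsilon>\<close> times a good tuple.\<close>
  define X where "X A = {b \<in> space ?M. shift_coords n k A \<epsilon> b \<in> ?G A}" for A
  have \<sigma>: "1 / sqrt (real k) > 0" using k by simp
  interpret prob_space ?P by (rule prob_space_gauss[OF \<sigma>])
  have X: "X A \<in> sets ?M" "ennreal (\<epsilon> ^ N / (2 * sqrt (real k) ^ N)) \<le> emeasure ?M (X A)" if A: "A \<in> F" for A
  proof -
    have G': "?G A \<in> sets (PiM ?I (\<lambda>_. lborel))" using G[OF A] by (simp add: coord_lborel_def)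
    note aff = PiM_lborel_affine[OF finite_coord_set \<epsilon>(1) G', of "coords_of n k A", folded coord_lborel_def shift_coords_def]
    show "X A \<in> sets ?M" unfolding X_def using aff(1) .
    have eX: "emeasure ?M (X A) = ennreal (\<epsilon> ^ N) * emeasure ?M (?G A)"
      unfolding X_def using aff(2) by (simp add: card_coord_set N_def)
    have "ennreal (1 / 2) \<le> emeasure ?P (?G A)"
      unfolding emeasure_eq_measure using prob[OF A] by (intro ennreal_leI)
    also have "\<dots> \<le> ennreal (sqrt (real k) ^ N) * emeasure ?M (?G A)"
      using gauss_le_lborel[OF finite_coord_set \<sigma> G'] by (simp add: card_coord_set N_def coord_lborel_def)
    finally have h: "ennreal (1 / 2) \<le> ennreal (sqrt (real k) ^ N) * emeasure ?M (?G A)" .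
    have sk: "sqrt (real k) ^ N > 0" using k by simp
    have "ennreal (\<epsilon> ^ N / (2 * sqrt (real k) ^ N)) = ennreal (\<epsilon> ^ N / sqrt (real k) ^ N) * ennreal (1 / 2)"
      using \<epsilon> sk by (subst ennreal_mult[symmetric]) auto
    also have "\<dots> \<le> ennreal (\<epsilon> ^ N / sqrt (real k) ^ N) * (ennreal (sqrt (real k) ^ N) * emeasure ?M (?G A))"
      using h by (rule mult_left_mono) simp
    also have "\<dots> = ennreal (\<epsilon> ^ N) * emeasure ?M (?G A)"
    proof -
      have "ennreal (\<epsilon> ^ N / sqrt (real k) ^ N) * ennreal (sqrt (real k) ^ N) = ennreal (\<epsilon> ^ N)"
        using \<epsilon> sk k by (subst ennreal_mult[symmetric]) auto
      then show ?thesis by (simp add: mult.assoc[symmetric])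
    qed
    finally show "ennreal (\<epsilon> ^ N / (2 * sqrt (real k) ^ N)) \<le> emeasure ?M (X A)" unfolding eX .
  qed
  have XQ: "X A \<subseteq> Q" if A: "A \<in> F" for A
  proof
    fix b assume "b \<in> X A"
    then have b: "b \<in> space ?M" "shift_coords n k A \<epsilon> b \<in> ?G A" by (auto simp: X_def)
    have "coord_tuple n k b \<in> rel_microstates \<mu> n (\<lambda>i. nc_var (Inl i) + nc_const (complex_of_real \<epsilon>) * nc_var (Inr i)) n (\<lambda>i. nc_var (Inr i)) (R + 12) k m \<eta>"
      by (rule good_coords_rel_microstates[where A = A and t = t and d = d]) (use F(2,3)[OF A] R \<epsilon> lin law d b in auto)
    then show "b \<in> Q" using b(1) by (simp add: Q_def)
  qed
  have disj: "disjoint_family_on X F"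
    unfolding disjoint_family_on_def
  proof (intro ballI impI)
    fix A B assume AB: "A \<in> F" "B \<in> F" "A \<noteq> B"
    show "X A \<inter> X B = {}"
    proof (rule ccontr)
      assume "X A \<inter> X B \<noteq> {}"
      then obtain b where "b \<in> X A" "b \<in> X B" by blast
      then have g: "shift_coords n k A \<epsilon> b \<in> ?G A" "shift_coords n k B \<epsilon> b \<in> ?G B" by (simp_all add: X_def)
      define S where "S = mat_of k (shift_coords n k A \<epsilon> b)"
      define T where "T = mat_of k (shift_coords n k B \<epsilon> b)"
      have "opnorm (A l - B l) \<le> 24 * \<epsilon>" if l: "l < n" for l
      proof -
        have c: "A l \<in> carrier_mat k k" "B l \<in> carrier_mat k k" "S l \<in> carrier_mat k k" "T l \<in> carrier_mat k k"
          using F(2)[OF AB(1) l] F(2)[OF AB(2) l] by (simp_all add: sa_mats_carrier S_def T_def)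
        have "A l + complex_of_real \<epsilon> \<cdot>\<^sub>m S l = B l + complex_of_real \<epsilon> \<cdot>\<^sub>m T l"
          using mat_of_shift[where A = A and b = b, OF F(2)[OF AB(1)] \<epsilon>(1) l] mat_of_shift[where A = B and b = b, OF F(2)[OF AB(2)] \<epsilon>(1) l]
          by (simp add: S_def T_def)
        then have eq: "(A l + complex_of_real \<epsilon> \<cdot>\<^sub>m S l) $$ (i, j) = (B l + complex_of_real \<epsilon> \<cdot>\<^sub>m T l) $$ (i, j)" for i j by simp
        have ent: "A l $$ (i, j) + complex_of_real \<epsilon> * S l $$ (i, j) = B l $$ (i, j) + complex_of_real \<epsilon> * T l $$ (i, j)" if "i < k" "j < k" for i j
        proof -
          have dims: "dim_row (S l) = k" "dim_col (S l) = k" "dim_row (T l) = k" "dim_col (T l) = k" using c by auto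
          have "(A l + complex_of_real \<epsilon> \<cdot>\<^sub>m S l) $$ (i, j) = A l $$ (i, j) + complex_of_real \<epsilon> * S l $$ (i, j)"
            using that dims by simp
          moreover have "(B l + complex_of_real \<epsilon> \<cdot>\<^sub>m T l) $$ (i, j) = B l $$ (i, j) + complex_of_real \<epsilon> * T l $$ (i, j)"
            using that dims by simp
          ultimately show ?thesis using eq[of i j] by simp
        qed
        have e: "A l - B l = complex_of_real \<epsilon> \<cdot>\<^sub>m (T l + (- 1) \<cdot>\<^sub>m S l)"
        proof (rule eq_matI)
          fix i j assume "i < dim_row (complex_of_real \<epsilon> \<cdot>\<^sub>m (T l + (- 1) \<cdot>\<^sub>m S l))" "j < dim_col (complex_of_real \<epsilon> \<cdot>\<^sub>m (T l + (- 1) \<cdot>\<^sub>m S l))"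
          then have ij: "i < k" "j < k" using c by auto
          show "(A l - B l) $$ (i, j) = (complex_of_real \<epsilon> \<cdot>\<^sub>m (T l + (- 1) \<cdot>\<^sub>m S l)) $$ (i, j)"
            using ij c ent[OF ij] by (simp add: algebra_simps)
        qed (use c in auto)
        have sT: "opnorm (T l) \<le> 12" "opnorm (S l) \<le> 12" using g l by (simp_all add: good_coords_def S_def T_def)
        have "opnorm (A l - B l) \<le> \<epsilon> * opnorm (T l + (- 1) \<cdot>\<^sub>m S l)"
          unfolding e using opnorm_smult[of "T l + (- 1) \<cdot>\<^sub>m S l" k k "complex_of_real \<epsilon>"] c \<epsilon> by simp
        also have "\<dots> \<le> \<epsilon> * (opnorm (T l) + opnorm (S l))"
        proof (rule mult_left_mono)
          have "opnorm (T l + (- 1) \<cdot>\<^sub>m S l) \<le> opnorm (T l) + opnorm ((- 1) \<cdot>\<^sub>m S l)" using c by (intro opnorm_add[of _ k k]) auto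
          also have "opnorm ((- 1) \<cdot>\<^sub>m S l) \<le> opnorm (S l)" using opnorm_smult[OF c(3), of "- 1"] by simp
          finally show "opnorm (T l + (- 1) \<cdot>\<^sub>m S l) \<le> opnorm (T l) + opnorm (S l)" by simp
        qed (use \<epsilon> in simp)
        also have "\<dots> \<le> \<epsilon> * (12 + 12)" using sT \<epsilon> by (intro mult_left_mono add_mono) auto
        finally show ?thesis by simp
      qed
      then have "tuple_dist n A B \<le> 24 * \<epsilon>"
        unfolding tuple_dist_def using n by (subst Max_le_iff) auto
      then show False using sep[OF AB] \<epsilon> by simp
    qed
  qed
  have "of_nat (card F) * ennreal (\<epsilon> ^ N / (2 * sqrt (real k) ^ N)) = (\<Sum>A\<in>F. ennreal (\<epsilon> ^ N / (2 * sqrt (real k) ^ N)))" by simp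
  also have "\<dots> \<le> (\<Sum>A\<in>F. emeasure ?M (X A))" by (intro sum_mono X(2))
  also have "\<dots> = emeasure ?M (\<Union>A\<in>F. X A)" using X(1) by (intro sum_emeasure disj F(1)) auto
  also have "\<dots> \<le> emeasure ?M Q" using XQ Q by (intro emeasure_mono) auto
  finally show ?thesis unfolding sa_volume_eq Q_def N_def .
qed

section \<open>Comparison of the dimensions\<close>

lemma ext_log_mult_le:
  assumes "a * ennreal c \<le> v" "c > 0" "ereal y < ext_log a"
  shows "ereal (y + ln c) \<le> ext_log v"
proof (cases "v = \<infinity>")
  case True
  then show ?thesis by (simp add: ext_log_def)
next
  case False
  have "a \<noteq> \<infinity>"
  proof
    assume "a = \<infinity>"
    then have "a * ennreal c = \<infinity>" using assms(2) by (simp add: ennreal_top_mult)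
    then show False using assms(1) False by (simp add: top_unique)
  qed
  then obtain a0 where a0: "a = ennreal a0" "a0 \<ge> 0" by (cases a) auto
  have "a0 \<noteq> 0" using assms(3) a0 by (auto simp: ext_log_def)
  then have pos: "a0 > 0" using a0 by simp
  have y: "y < ln a0" using assms(3) pos by (simp add: ext_log_def a0)
  obtain v0 where v0: "v = ennreal v0" "v0 \<ge> 0" using False by (cases v) auto
  have "ennreal (a0 * c) \<le> ennreal v0" using assms(1,2) pos by (simp add: a0 v0 ennreal_mult)
  then have le: "a0 * c \<le> v0" using v0(2) by (simp add: ennreal_le_iff)
  have ac: "a0 * c > 0" using pos assms(2) by simp
  then have "v0 > 0" using le by linarith
  then have "ext_log v = ereal (ln v0)" by (simp add: ext_log_def v0)
  moreover have "ln (a0 * c) \<le> ln v0" using le ac by simp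
  then have "y + ln c \<le> ln v0" using y pos assms(2) by (simp add: ln_mult)
  ultimately show ?thesis by simp
qed

lemma less_Limsup_frequently:
  fixes f :: "'a \<Rightarrow> ereal"
  shows "c < Limsup F f \<Longrightarrow> \<exists>\<^sub>F x in F. c < f x"
  using Limsup_bounded[of f c F] unfolding frequently_def by (auto simp: not_less)

lemma frequently_le_Limsup:
  fixes f :: "'a \<Rightarrow> ereal"
  assumes "\<exists>\<^sub>F x in F. c \<le> f x"
  shows "c \<le> Limsup F f"
proof (rule ccontr)
  assume "\<not> c \<le> Limsup F f"
  then have "\<forall>\<^sub>F x in F. f x < c" by (intro Limsup_lessD) simp
  then have "\<forall>\<^sub>F x in F. \<not> c \<le> f x" by eventually_elim (simp add: not_le)
  with assms show False unfolding frequently_def by blast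
qed

lemma tuple_dist_refl:
  assumes "n > 0" "\<And>i. i < n \<Longrightarrow> A i \<in> carrier_mat k k" "\<omega> > 0"
  shows "tuple_dist n A A < \<omega>"
proof -
  have "opnorm (A i - A i) < \<omega>" if "i < n" for i
  proof -
    have "A i - A i = 0\<^sub>m k k" using assms(2)[OF that] by (intro eq_matI) auto
    then show ?thesis using opnorm_zero[of k] assms(3) by simp
  qed
  then show ?thesis unfolding tuple_dist_def using assms(1) by (subst Max_less_iff) auto
qed

lemma tuple_dist_commute:
  assumes "\<And>i. i < n \<Longrightarrow> A i \<in> carrier_mat k k" "\<And>i. i < n \<Longrightarrow> B i \<in> carrier_mat k k"
  shows "tuple_dist n A B = tuple_dist n B A"
proof -
  have "(\<lambda>i. opnorm (A i - B i)) ` {..<n} = (\<lambda>i. opnorm (B i - A i)) ` {..<n}"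
    using opnorm_minus_commute[OF assms] by (intro image_cong) auto
  then show ?thesis by (simp add: tuple_dist_def)
qed

text \<open>The free entropy of \<open>x + \<epsilon> * s\<close> in the presence of \<open>s\<close>, if \<open>\<mu>\<close> is the joint law of \<open>x\<close> and \<open>s\<close>.\<close>

definition pert_entropy :: "((nat + nat) ncpoly \<Rightarrow> complex) \<Rightarrow> nat \<Rightarrow> real \<Rightarrow> ereal" where
  "pert_entropy \<mu> n \<epsilon> = free_entropy \<mu> n (\<lambda>i. nc_var (Inl i) + nc_const (complex_of_real \<epsilon>) * nc_var (Inr i)) n (\<lambda>i. nc_var (Inr i))"

text \<open>The covering number at scale \<open>25 * \<epsilon>\<close> enters as a packing number through \<open>rel_volume_lower\<close>. After taking
  logarithms and dividing by \<open>k\<^sup>2\<close>, the Gaussian normalization contributes \<open>- n / 2 * ln k\<close>, which is the term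
  that the free entropy compensates. The cutoff for the relative microstates is \<open>R + 12\<close>, where \<open>R\<close> is the cutoff
  for the topological ones.\<close>

lemma pert_entropy_lower:
  fixes x :: "nat \<Rightarrow> 'a::cstar_algebra_1"
  assumes sa: "\<And>i. i < n \<Longrightarrow> selfadjoint (x i)" and gen: "cstar_subalgebra hull (x ` {..<n}) = UNIV"
    and P: "range P = rat_ncpolys n" and n: "n > 0"
    and \<tau>: "\<And>\<tau>'. \<tau>' \<in> tracial_states \<Longrightarrow> \<tau>' = \<tau>"
    and lin: "\<And>p q. \<mu> (p + q) = \<mu> p + \<mu> q" "\<And>z p. \<mu> (nc_const z * p) = z * \<mu> p"
    and law: "\<And>u. u \<in> nwords n \<Longrightarrow> \<mu> (Poly_Mapping.single (Word u) 1) = fock_word (\<lambda>a. \<tau> (prod_list (map x a))) u"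
    and \<epsilon>: "0 < \<epsilon>" "25 * \<epsilon> < 1"
    and top: "ereal s < (SUP R\<in>{0<..}. INF (\<epsilon>0, r)\<in>{0<..} \<times> {1..}.
         limsup (\<lambda>k. ext_log (covering_number (tuple_dist n) (top_microstates P n x R k \<epsilon>0 r) (25 * \<epsilon>))
                       / ereal (- (real k)\<^sup>2 * ln (25 * \<epsilon>))))"
  shows "ereal (s * (- ln (25 * \<epsilon>)) + real n * ln \<epsilon> - ln 2) \<le> pert_entropy \<mu> n \<epsilon>"
proof -
  define y where "y = s * (- ln (25 * \<epsilon>)) + real n * ln \<epsilon> - ln 2"
  define L where "L = - ln (25 * \<epsilon>)"
  have L: "L > 0" using \<epsilon> by (simp add: L_def)
  from top obtain R where R: "R > 0" and topR: "ereal s < (INF (\<epsilon>0, r)\<in>{0<..} \<times> {1..}.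
         limsup (\<lambda>k. ext_log (covering_number (tuple_dist n) (top_microstates P n x R k \<epsilon>0 r) (25 * \<epsilon>))
                       / ereal (- (real k)\<^sup>2 * ln (25 * \<epsilon>))))"
    unfolding less_SUP_iff by auto
  have main: "ereal y \<le> limsup (\<lambda>k. ext_log (sa_volume n k (rel_microstates \<mu> n (\<lambda>i. nc_var (Inl i) + nc_const (complex_of_real \<epsilon>) * nc_var (Inr i)) n (\<lambda>i. nc_var (Inr i)) (R + 12) k m \<eta>)) / ereal ((real k)\<^sup>2)
                      + ereal (real n / 2 * ln (real k)))" (is "_ \<le> limsup ?X") if \<eta>: "\<eta> > 0" for m \<eta>
  proof -
    define d where "d = \<eta> / 2 ^ Suc m"
    have d: "d > 0" "2 ^ m * d < \<eta>" using \<eta> by (simp_all add: d_def)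
    obtain \<epsilon>0 :: real and r :: nat where er: "\<epsilon>0 > 0" "r \<ge> 1" and ev: "\<forall>\<^sub>F k in sequentially. \<forall>A\<in>top_microstates P n x R k \<epsilon>0 r.
       measure (gauss (1 / sqrt (real k)) (coord_set n k)) (good_coords (\<lambda>a. \<tau> (prod_list (map x a))) n k A m d) \<ge> 1 / 2"
      using good_coords_probable[OF sa gen P n \<tau> d(1), of R m] by blast
    have "ereal s < limsup (\<lambda>k. ext_log (covering_number (tuple_dist n) (top_microstates P n x R k \<epsilon>0 r) (25 * \<epsilon>)) / ereal (- (real k)\<^sup>2 * ln (25 * \<epsilon>)))"
      using less_INF_D[OF topR, of "(\<epsilon>0, r)"] er by simp
    then have "\<exists>\<^sub>F k in sequentially. ereal s < ext_log (covering_number (tuple_dist n) (top_microstates P n x R k \<epsilon>0 r) (25 * \<epsilon>)) / ereal (- (real k)\<^sup>2 * ln (25 * \<epsilon>))"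
      by (rule less_Limsup_frequently)
    then have "\<exists>\<^sub>F k in sequentially. (ereal s < ext_log (covering_number (tuple_dist n) (top_microstates P n x R k \<epsilon>0 r) (25 * \<epsilon>)) / ereal (- (real k)\<^sup>2 * ln (25 * \<epsilon>))) \<and>
      ((\<forall>A\<in>top_microstates P n x R k \<epsilon>0 r. measure (gauss (1 / sqrt (real k)) (coord_set n k)) (good_coords (\<lambda>a. \<tau> (prod_list (map x a))) n k A m d) \<ge> 1 / 2) \<and> k > 0)"
      using eventually_conj[OF ev eventually_gt_at_top[of 0]] by (rule frequently_eventually_frequently)
    then have "\<exists>\<^sub>F k in sequentially. ereal y \<le> ?X k"
    proof (rule frequently_elim1)
      fix k
      assume k': "(ereal s < ext_log (covering_number (tuple_dist n) (top_microstates P n x R k \<epsilon>0 r) (25 * \<epsilon>)) / ereal (- (real k)\<^sup>2 * ln (25 * \<epsilon>))) \<and>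
        ((\<forall>A\<in>top_microstates P n x R k \<epsilon>0 r. measure (gauss (1 / sqrt (real k)) (coord_set n k)) (good_coords (\<lambda>a. \<tau> (prod_list (map x a))) n k A m d) \<ge> 1 / 2) \<and> k > 0)"
      then have k: "k > 0" by blast
      let ?cov = "covering_number (tuple_dist n) (top_microstates P n x R k \<epsilon>0 r) (25 * \<epsilon>)"
      let ?vol = "sa_volume n k (rel_microstates \<mu> n (\<lambda>i. nc_var (Inl i) + nc_const (complex_of_real \<epsilon>) * nc_var (Inr i)) n (\<lambda>i. nc_var (Inr i)) (R + 12) k m \<eta>)"
      define N where "N = n * k\<^sup>2"
      define c where "c = \<epsilon> ^ N / (2 * sqrt (real k) ^ N)"
      have c: "c > 0" using \<epsilon> k by (simp add: c_def)
      have Asa: "A i \<in> sa_mats k" if "A \<in> top_microstates P n x R k \<epsilon>0 r" "i < n" for A i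
        using top_microstates_sa that by blast
      have Ac: "A i \<in> carrier_mat k k" if "A \<in> top_microstates P n x R k \<epsilon>0 r" "i < n" for A i
        using Asa[OF that] by (rule sa_mats_carrier)
      have cov: "?cov * ennreal c \<le> ?vol"
      proof (rule covering_number_le_packing[OF _ _ c])
        fix A B assume A: "A \<in> top_microstates P n x R k \<epsilon>0 r" and B: "B \<in> top_microstates P n x R k \<epsilon>0 r"
        show "tuple_dist n A A < 25 * \<epsilon>" using tuple_dist_refl[where A = A and \<omega> = "25 * \<epsilon>", OF n Ac[OF A]] \<epsilon> by simp
        show "tuple_dist n A B = tuple_dist n B A" by (rule tuple_dist_commute[where A = A and B = B, OF Ac[OF A] Ac[OF B]])
      next
        fix F assume F: "finite F" "F \<subseteq> top_microstates P n x R k \<epsilon>0 r" and sep: "\<And>A B. A \<in> F \<Longrightarrow> B \<in> F \<Longrightarrow> A \<noteq> B \<Longrightarrow> 25 * \<epsilon> \<le> tuple_dist n A B"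
        show "of_nat (card F) * ennreal c \<le> ?vol"
          unfolding c_def N_def
        proof (rule rel_volume_lower[OF n k R \<epsilon>(1) _ lin law d(2,1) F(1) _ _ _ sep])
          show "\<epsilon> \<le> 1" using \<epsilon> by simp
        qed (use F(2) Asa k' in \<open>auto simp: top_microstates_def\<close>)
      qed
      have kL: "(real k)\<^sup>2 * L > 0" using k L by simp
      have "ereal (- (real k)\<^sup>2 * ln (25 * \<epsilon>)) = ereal ((real k)\<^sup>2 * L)" by (simp add: L_def)
      then have "ereal s < ext_log ?cov / ereal ((real k)\<^sup>2 * L)" using k' by simp
      then have "ereal ((real k)\<^sup>2 * L) * ereal s < ext_log ?cov"
        using kL by (subst (asm) ereal_less_divide_pos) auto
      then have "ereal ((real k)\<^sup>2 * L * s) < ext_log ?cov" by simp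
      from ext_log_mult_le[OF cov c this] have vol: "ereal ((real k)\<^sup>2 * L * s + ln c) \<le> ext_log ?vol" .
      have lc: "ln c = real N * ln \<epsilon> - ln 2 - real N * (ln (real k) / 2)"
        using \<epsilon> k by (simp add: c_def ln_div ln_mult ln_realpow ln_sqrt)
      have "y - real n / 2 * ln (real k) \<le> ((real k)\<^sup>2 * L * s + ln c) / (real k)\<^sup>2"
      proof -
        have k1: "1 \<le> (real k)\<^sup>2" using k by simp
        have "((real k)\<^sup>2 * L * s + ln c) / (real k)\<^sup>2 = L * s + real n * ln \<epsilon> - ln 2 / (real k)\<^sup>2 - real n / 2 * ln (real k)"
          unfolding lc using k by (simp add: N_def field_simps)
        moreover have "ln 2 / (real k)\<^sup>2 \<le> (ln 2 :: real)"
          using divide_left_mono[OF k1, of "ln 2"] k by simp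
        ultimately show ?thesis by (simp add: y_def L_def mult.commute)
      qed
      then have "ereal (y - real n / 2 * ln (real k)) \<le> ereal ((real k)\<^sup>2 * L * s + ln c) / ereal ((real k)\<^sup>2)" using k by simp
      also have "\<dots> \<le> ext_log ?vol / ereal ((real k)\<^sup>2)"
        using vol k by (intro ereal_divide_right_mono) auto
      finally have "ereal (y - real n / 2 * ln (real k)) + ereal (real n / 2 * ln (real k)) \<le> ?X k" by (rule add_right_mono)
      then show "ereal y \<le> ?X k" by simp
    qed
    then show ?thesis by (rule frequently_le_Limsup)
  qed
  have "ereal y \<le> (INF (m, \<eta>)\<in>{1..} \<times> {0<..}. limsup (\<lambda>k. ext_log (sa_volume n k (rel_microstates \<mu> n (\<lambda>i. nc_var (Inl i) + nc_const (complex_of_real \<epsilon>) * nc_var (Inr i)) n (\<lambda>i. nc_var (Inr i)) (R + 12) k m \<eta>)) / ereal ((real k)\<^sup>2)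
                      + ereal (real n / 2 * ln (real k))))"
    by (rule INF_greatest) (use main in auto)
  also have "\<dots> \<le> pert_entropy \<mu> n \<epsilon>"
    unfolding pert_entropy_def free_entropy_def using R by (intro SUP_upper) simp
  finally show ?thesis by (simp add: y_def)
qed

theorem theorem5p1:
  fixes x :: "nat \<Rightarrow> 'a::cstar_algebra_1" and n :: nat and P :: "nat \<Rightarrow> nat ncpoly"
  assumes "n \<ge> 1"
    and "\<And>i. i < n \<Longrightarrow> selfadjoint (x i)"
    and "cstar_subalgebra hull (x ` {..<n}) = UNIV"
    and "range P = rat_ncpolys n"
    and "\<exists>!\<tau> :: 'a \<Rightarrow> complex. \<tau> \<in> tracial_states"
  shows "delta_top P n x \<le> kappa_delta n x"
proof -
  obtain \<tau> :: "'a \<Rightarrow> complex" where \<tau>: "\<tau> \<in> tracial_states" "\<And>\<tau>'. \<tau>' \<in> tracial_states \<Longrightarrow> \<tau>' = \<tau>"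
    using assms(5) by blast
  have \<tau>1: "\<tau> 1 = 1" using \<tau>(1) by (simp add: tracial_states_def)
  define t where "t = (\<lambda>a. \<tau> (prod_list (map x a)))"
  define \<mu> where "\<mu> = (SOME \<mu>. free_semicircular_law \<tau> n x \<mu>)"
  have fl: "free_semicircular_law \<tau> n x (fock_law t)"
    unfolding t_def by (rule fock_law_is_free_semicircular[where \<tau> = \<tau>, OF \<tau>1])
  have \<mu>: "free_semicircular_law \<tau> n x \<mu>" unfolding \<mu>_def by (rule someI[of _ "fock_law t"]) (rule fl)
  have lin: "\<mu> (p + q) = \<mu> p + \<mu> q" "\<mu> (nc_const z * p) = z * \<mu> p" for p q z
    using \<mu> by (auto simp: free_semicircular_law_def)
  have law: "\<mu> (Poly_Mapping.single (Word u) 1) = fock_word t u" if "u \<in> nwords n" for u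
    using free_semicircular_law_unique[where \<tau> = \<tau>, OF \<mu> fl \<tau>1, of u] that by (simp add: nwords_def fock_law_word)
  define h where "h \<omega> = (SUP R\<in>{0<..}. INF (\<epsilon>0, r)\<in>{0<..} \<times> {1..}.
         limsup (\<lambda>k. ext_log (covering_number (tuple_dist n) (top_microstates P n x R k \<epsilon>0 r) \<omega>)
                       / ereal (- (real k)\<^sup>2 * ln \<omega>)))" for \<omega> :: real
  have "delta_top P n x \<le> delta0 \<tau> n x"
  proof (rule ccontr)
    assume "\<not> ?thesis"
    then have "delta0 \<tau> n x < delta_top P n x" by simp
    then obtain s' where s': "delta0 \<tau> n x < ereal s'" "ereal s' < delta_top P n x" using ereal_dense2 by blast
    \<comment> \<open>The gap between \<open>s'\<close> and \<open>s\<close> pays for the constants.\<close>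
    obtain s where s: "ereal s' < ereal s" "ereal s < delta_top P n x" using s'(2) ereal_dense2 by blast
    define g where "g \<epsilon> = pert_entropy \<mu> n \<epsilon> / ereal \<bar>ln \<epsilon>\<bar>" for \<epsilon>
    have "delta0 \<tau> n x = ereal (real n) + Limsup (at_right 0) g"
      by (simp add: delta0_def Let_def \<mu>_def[symmetric] g_def[abs_def] pert_entropy_def)
    then have "Limsup (at_right 0) g < ereal (s' - real n)"
      using s'(1) by (cases "Limsup (at_right 0) g") auto
    then have "\<forall>\<^sub>F \<epsilon> in at_right 0. g \<epsilon> < ereal (s' - real n)" by (rule Limsup_lessD)
    then obtain b where b: "b > 0" "\<And>\<epsilon>. 0 < \<epsilon> \<Longrightarrow> \<epsilon> < b \<Longrightarrow> g \<epsilon> < ereal (s' - real n)"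
      unfolding eventually_at_right_field by auto
    \<comment> \<open>The last condition on \<open>\<omega>\<close> makes \<open>(s - s') * \<bar>ln \<omega>\<bar>\<close> larger than the contributions of the
    constants \<open>2\<close> and \<open>25\<close>.\<close>
    have "\<exists>\<^sub>F \<omega> in at_right 0. ereal s < h \<omega>"
      using s(2) unfolding delta_top_def h_def by (rule less_Limsup_frequently)
    moreover have "\<forall>\<^sub>F \<omega> in at_right (0::real). 0 < \<omega> \<and> \<omega> < min 1 (25 * b) \<and> ln \<omega> < - ((ln 2 + s' * ln 25) / (s - s'))"
    proof (intro eventually_conj)
      show "\<forall>\<^sub>F \<omega> in at_right (0::real). 0 < \<omega>" by (rule eventually_at_right_less)
      have "0 < min 1 (25 * b)" using b by simp
      then show "\<forall>\<^sub>F \<omega> in at_right (0::real). \<omega> < min 1 (25 * b)"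
        unfolding eventually_at_right_field by blast
      show "\<forall>\<^sub>F \<omega> in at_right (0::real). ln \<omega> < - ((ln 2 + s' * ln 25) / (s - s'))"
        using ln_at_0 unfolding filterlim_at_bot_dense by blast
    qed
    ultimately have "\<exists>\<^sub>F \<omega> in at_right 0. ereal s < h \<omega> \<and> (0 < \<omega> \<and> \<omega> < min 1 (25 * b) \<and> ln \<omega> < - ((ln 2 + s' * ln 25) / (s - s')))"
      by (rule frequently_eventually_frequently)
    then obtain \<omega> where \<omega>: "ereal s < h \<omega>" "0 < \<omega>" "\<omega> < 1" "\<omega> < 25 * b" "ln \<omega> < - ((ln 2 + s' * ln 25) / (s - s'))"
      using frequently_ex by fastforce
    define \<epsilon> where "\<epsilon> = \<omega> / 25"
    have \<epsilon>: "0 < \<epsilon>" "\<epsilon> < b" "25 * \<epsilon> = \<omega>" using \<omega> by (simp_all add: \<epsilon>_def)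
    have "ereal (s * (- ln (25 * \<epsilon>)) + real n * ln \<epsilon> - ln 2) \<le> pert_entropy \<mu> n \<epsilon>"
    proof (rule pert_entropy_lower[OF assms(2,3,4) _ \<tau>(2) lin _ \<epsilon>(1)])
      show "ereal s < (SUP R\<in>{0<..}. INF (\<epsilon>0, r)\<in>{0<..} \<times> {1..}.
         limsup (\<lambda>k. ext_log (covering_number (tuple_dist n) (top_microstates P n x R k \<epsilon>0 r) (25 * \<epsilon>))
                       / ereal (- (real k)\<^sup>2 * ln (25 * \<epsilon>))))"
        using \<omega>(1) unfolding h_def \<epsilon>(3) .
    qed (use assms(1) law \<omega> \<epsilon> in \<open>auto simp: t_def\<close>)
    then have ent: "ereal (s * (- ln \<omega>) + real n * ln \<epsilon> - ln 2) \<le> pert_entropy \<mu> n \<epsilon>" by (simp only: \<epsilon>(3))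
    define L where "L = - ln \<omega>"
    have le: "ln \<epsilon> = - (L + ln 25)" using \<omega> by (simp add: \<epsilon>_def L_def ln_div)
    have L: "L > 0" using \<omega> by (simp add: L_def)
    have l25: "ln 25 > (0::real)" by simp
    have ss: "s - s' > 0" using s(1) by simp
    have "(ln 2 + s' * ln 25) / (s - s') < L" using \<omega>(5) by (simp add: L_def)
    then have key: "ln 2 + s' * ln 25 < (s - s') * L" using ss by (simp add: field_simps)
    have abs: "\<bar>ln \<epsilon>\<bar> = L + ln 25" using le L l25 by linarith
    have Ll: "L + ln 25 > 0" "L + ln 25 \<noteq> 0" using L l25 by linarith+
    have "s' - real n < (s * L + real n * ln \<epsilon> - ln 2) / (L + ln 25)"
    proof -
      have "(s' - real n) * (L + ln 25) < s * L + real n * ln \<epsilon> - ln 2"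
        using key unfolding le by (simp add: algebra_simps)
      then show ?thesis using L l25 by (subst pos_less_divide_eq) linarith+
    qed
    then have "ereal (s' - real n) < ereal (s * L + real n * ln \<epsilon> - ln 2) / ereal \<bar>ln \<epsilon>\<bar>"
      using Ll unfolding abs by simp
    also have "\<dots> \<le> g \<epsilon>"
      unfolding g_def abs using ent Ll by (intro ereal_divide_right_mono) (auto simp: L_def)
    finally show False using b(2)[OF \<epsilon>(1,2)] by simp
  qed
  also have "delta0 \<tau> n x \<le> kappa_delta n x" unfolding kappa_delta_def by (rule SUP_upper[OF \<tau>(1)])
  finally show ?thesis .
qed

end
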